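(* Let $d\ge 1$. There is an open dense subset $U$ of $\Sigma_{2d}$ such that, for every $f\in U$ and every $r$ in the Pataki range (i.e. every integer $r\ge 2$ with $\binom{r+1}{2}\le 2d+1$), one has $$\dim \mathrm{Ex}_r(f)=\tfrac12 (r-2)(2d-r+1).$$
   Context: Let $V=\mathbb{R}[x_1,x_2]_d$ be the space of real binary forms of degree $d$, and let $\Sigma_{2d}\subset\mathbb{R}[x_1,x_2]_{2d}$ be the cone of sums of squares of forms in $V$ (with the topology induced from $\mathbb{R}[x_1,x_2]_{2d}$). Let $\mathsf{S}_2V\subset V\otimes V$ be the space of symmetric tensors, let $\mathsf{S}_2^+V=\{\sum_{i=1}^r p_i\otimes p_i: r\ge 0,\ p_i\in V\}$ be the cone of positive semidefinite symmetric tensors, and let $\mu:\mathsf{S}_2V\to\mathbb{R}[x_1,x_2]_{2d}$ be the linear map induced by multiplication $p\otimes q\mapsto pq$. For $f\in\Sigma_{2d}$, the Gram spectrahedron is $\mathrm{Gram}(f)=\mathsf{S}_2^+V\cap\mu^{-1}(f)$, a closed convex set. The rank of $\theta\in\mathsf{S}_2V$ is the rank of the associated linear map $V^\vee\to V$; for $\theta=\sum_{i=1}^r p_i\otimes p_i$ with $p_1,\dots,p_r$ linearly independent it equals $r$. $\mathrm{Ex}_r(f)$ denotes the set of all extreme points of $\mathrm{Gram}(f)$ of rank $r$; it is a semialgebraic set, and $\dim$ denotes its dimension as a semialgebraic set. *)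

theory Defs
  imports "HOL-Analysis.Analysis" "HOL-Analysis.Finite_Function_Topology"
begin

text \<open>
  The polynomial ring \<open>R[x1,x2]\<close> is the monoid algebra on exponent pairs: \<open>(i,j)\<close> stands for
  the monomial \<open>x1^i x2^j\<close>.  The ring structure is that of HOL-Library.Poly_Mapping, the vector
  space structure and the norm (the l1-norm of the coefficients) come from
  HOL-Analysis.Finite_Function_Topology.  On a finite-dimensional subspace, such as a space of
  forms of fixed degree, the norm topology is the Euclidean one.
\<close>

type_synonym mono2 = "nat \<times> nat"
type_synonym poly2 = "mono2 \<Rightarrow>\<^sub>0 real"

definition binary_forms :: "nat \<Rightarrow> poly2 set" where
  "binary_forms n = {p. Poly_Mapping.keys p \<subseteq> {(i, j). i + j = n}}"

definition sos_cone :: "nat \<Rightarrow> poly2 set" where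
  "sos_cone d = {\<Sum>i<r. p i * p i | (r :: nat) p. \<forall>i<r. p i \<in> binary_forms d}"

text \<open>
  \<open>R[x1,x2] \<otimes> R[x1,x2]\<close> has the products of two monomials as a basis, hence it is modelled by
  finitely supported functions on pairs of monomials.  All tensor notions are defined on this
  big space; \<open>V \<otimes> V\<close> is the subspace spanned by the \<open>p \<otimes> q\<close> with \<open>p, q\<close> in \<open>V\<close>.
\<close>

type_synonym tensor2 = "(mono2 \<times> mono2) \<Rightarrow>\<^sub>0 real"

definition tensor :: "poly2 \<Rightarrow> poly2 \<Rightarrow> tensor2" where
  "tensor p q = (\<Sum>m\<in>Poly_Mapping.keys p. \<Sum>n\<in>Poly_Mapping.keys q.
     Poly_Mapping.single (m, n) (Poly_Mapping.lookup p m * Poly_Mapping.lookup q n))"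

definition sym_tensors :: "nat \<Rightarrow> tensor2 set" where
  "sym_tensors d =
     {\<theta> \<in> span {tensor p q | p q. p \<in> binary_forms d \<and> q \<in> binary_forms d}.
        \<forall>m n. Poly_Mapping.lookup \<theta> (m, n) = Poly_Mapping.lookup \<theta> (n, m)}"

definition psd_tensors :: "nat \<Rightarrow> tensor2 set" where
  "psd_tensors d = {\<Sum>i<r. tensor (p i) (p i) | (r :: nat) p. \<forall>i<r. p i \<in> binary_forms d}"

text \<open>The linear map \<open>\<mu>\<close> with \<open>\<mu> (p \<otimes> q) = p q\<close>, see \<open>mult_map_tensor\<close> below.\<close>

definition mult_map :: "tensor2 \<Rightarrow> poly2" where
  "mult_map \<theta> = (\<Sum>(m, n)\<in>Poly_Mapping.keys \<theta>.
     Poly_Mapping.single (m + n) (Poly_Mapping.lookup \<theta> (m, n)))"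

definition gram :: "nat \<Rightarrow> poly2 \<Rightarrow> tensor2 set" where
  "gram d f = {\<theta> \<in> psd_tensors d. mult_map \<theta> = f}"

text \<open>
  The contraction of \<open>\<theta>\<close> with a linear functional, \<open>p \<otimes> q \<mapsto> \<phi>(p) q\<close>; as a function of \<open>\<phi>\<close> it
  is the linear map from the dual of \<open>V\<close> to \<open>V\<close> attached to \<open>\<theta>\<close>.  For \<open>\<theta>\<close> in \<open>V \<otimes> V\<close> it only
  depends on the restriction of \<open>\<phi>\<close> to \<open>V\<close>, and every functional on \<open>V\<close> is such a restriction,
  so \<open>\<phi>\<close> may range over the functionals on the whole polynomial ring.
\<close>

definition contract :: "(poly2 \<Rightarrow> real) \<Rightarrow> tensor2 \<Rightarrow> poly2" where
  "contract \<phi> \<theta> = (\<Sum>(m, n)\<in>Poly_Mapping.keys \<theta>.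
     (Poly_Mapping.lookup \<theta> (m, n) * \<phi> (Poly_Mapping.single m 1)) *\<^sub>R Poly_Mapping.single n 1)"

definition tensor_rank :: "tensor2 \<Rightarrow> nat" where
  "tensor_rank \<theta> = dim {contract \<phi> \<theta> | \<phi>. linear \<phi>}"

definition extreme_points_of_rank :: "nat \<Rightarrow> nat \<Rightarrow> poly2 \<Rightarrow> tensor2 set" where
  "extreme_points_of_rank d r f = {\<theta>. \<theta> extreme_point_of gram d f \<and> tensor_rank \<theta> = r}"

text \<open>
  Semialgebraic subsets of a finite-dimensional subspace \<open>W\<close>: the Boolean algebra of subsets of
  \<open>W\<close> generated by the strict polynomial inequalities.  The restrictions to \<open>W\<close> of the library's
  polynomial functions are the polynomials in linear coordinates of \<open>W\<close>.
\<close>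

inductive semialgebraic_in :: "'a::real_normed_vector set \<Rightarrow> 'a set \<Rightarrow> bool" for W where
  positive: "real_polynomial_function p \<Longrightarrow> semialgebraic_in W {x \<in> W. p x > 0}"
| compl: "semialgebraic_in W A \<Longrightarrow> semialgebraic_in W (W - A)"
| union: "semialgebraic_in W A \<Longrightarrow> semialgebraic_in W B \<Longrightarrow> semialgebraic_in W (A \<union> B)"

text \<open>\<open>R^k\<close> and the cube \<open>(0,1)^k\<close>, with vectors extended by zero, so that \<open>k\<close> is a number
  rather than a type.\<close>

definition coord_space :: "nat \<Rightarrow> (nat \<Rightarrow>\<^sub>0 real) set" where
  "coord_space k = {x. Poly_Mapping.keys x \<subseteq> {..<k}}"

definition open_cube :: "nat \<Rightarrow> (nat \<Rightarrow>\<^sub>0 real) set" where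
  "open_cube k = {x \<in> coord_space k. \<forall>i<k. 0 < Poly_Mapping.lookup x i \<and> Poly_Mapping.lookup x i < 1}"

text \<open>\<open>A\<close> contains a cell of dimension \<open>k\<close>, i.e. a set that is semialgebraically homeomorphic
  to \<open>(0,1)^k\<close>.\<close>

definition has_cell :: "'a::real_normed_vector set \<Rightarrow> 'a set \<Rightarrow> nat \<Rightarrow> bool" where
  "has_cell W A k \<longleftrightarrow>
     (\<exists>F G. F ` open_cube k \<subseteq> A \<and> homeomorphism (open_cube k) (F ` open_cube k) F G \<and>
            semialgebraic_in (coord_space k \<times> W) ((\<lambda>x. (x, F x)) ` open_cube k))"

text \<open>
  The dimension of a semialgebraic subset \<open>A\<close> of the finite-dimensional space \<open>W\<close>, as the
  largest dimension of a cell in \<open>A\<close>.  The extended reals are used in order that the empty set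
  gets dimension \<open>-\<infinity>\<close> and not \<open>0\<close>.
\<close>

definition semialg_dim :: "'a::real_normed_vector set \<Rightarrow> 'a set \<Rightarrow> ereal" where
  "semialg_dim W A = (SUP k\<in>{k. has_cell W A k}. ereal (real k))"

lemma semialg_dim_empty: "semialg_dim W {} = -\<infinity>"
proof -
  have "open_cube k \<noteq> {}" for k
  proof -
    have "(\<Sum>i<k. Poly_Mapping.single i (1/2)) \<in> open_cube k"
      by (auto simp: open_cube_def coord_space_def in_keys_iff lookup_sum lookup_single when_def
          split: if_splits)
    thus ?thesis by blast
  qed
  thus ?thesis by (auto simp: semialg_dim_def has_cell_def bot_ereal_def)
qed

lemma lookup_tensor:
  "Poly_Mapping.lookup (tensor p q) (m, n) = Poly_Mapping.lookup p m * Poly_Mapping.lookup q n"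
proof -
  have "Poly_Mapping.lookup (tensor p q) (m, n) =
    (\<Sum>m'\<in>Poly_Mapping.keys p. \<Sum>n'\<in>Poly_Mapping.keys q.
       if m' = m then if n' = n then Poly_Mapping.lookup p m * Poly_Mapping.lookup q n else 0 else 0)"
    unfolding tensor_def lookup_sum
    by (intro sum.cong refl) (auto simp: lookup_single when_def)
  also have "\<dots> = (\<Sum>m'\<in>Poly_Mapping.keys p. if m' = m then
       (\<Sum>n'\<in>Poly_Mapping.keys q. if n' = n then Poly_Mapping.lookup p m * Poly_Mapping.lookup q n else 0) else 0)"
    by (intro sum.cong refl) auto
  also have "\<dots> = Poly_Mapping.lookup p m * Poly_Mapping.lookup q n"
    by (simp add: in_keys_iff)
  finally show ?thesis .
qed

lemma keys_tensor: "Poly_Mapping.keys (tensor p q) = Poly_Mapping.keys p \<times> Poly_Mapping.keys q"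
  by (auto simp: in_keys_iff lookup_tensor)

lemma mult_map_tensor: "mult_map (tensor p q) = p * q"
proof -
  have repr: "p = (\<Sum>m\<in>Poly_Mapping.keys p. Poly_Mapping.single m (Poly_Mapping.lookup p m))" for p :: poly2
    by (rule poly_mapping_eqI) (simp add: lookup_sum lookup_single when_def in_keys_iff)
  have "p * q = (\<Sum>m\<in>Poly_Mapping.keys p. \<Sum>n\<in>Poly_Mapping.keys q.
      Poly_Mapping.single m (Poly_Mapping.lookup p m) * Poly_Mapping.single n (Poly_Mapping.lookup q n))"
    by (subst repr[of p], subst repr[of q]) (simp add: sum_product)
  also have "\<dots> = mult_map (tensor p q)"
    by (simp add: mult_map_def keys_tensor lookup_tensor mult_single sum.cartesian_product)
  finally show ?thesis by simp
qed

lemma scaleR_lookup: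
  "Poly_Mapping.lookup (c *\<^sub>R x) i = c * Poly_Mapping.lookup (x :: 'a \<Rightarrow>\<^sub>0 real) i"
proof -
  have "finite {i. c *\<^sub>R Poly_Mapping.lookup x i \<noteq> 0}"
    by (rule finite_subset[OF _ finite_keys[of x]]) (auto simp: in_keys_iff)
  thus ?thesis by (simp add: scaleR_poly_mapping_def Abs_poly_mapping_inverse)
qed

lemma mult_map_superset:
  assumes "finite K" "Poly_Mapping.keys \<theta> \<subseteq> K"
  shows "mult_map \<theta> = (\<Sum>(m, n)\<in>K. Poly_Mapping.single (m + n) (Poly_Mapping.lookup \<theta> (m, n)))"
  unfolding mult_map_def using assms
  by (intro sum.mono_neutral_left) (auto simp: in_keys_iff)

lemma linear_mult_map: "linear mult_map"
proof (rule linearI)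
  fix a b :: tensor2 and c :: real
  let ?K = "Poly_Mapping.keys a \<union> Poly_Mapping.keys b"
  have K: "finite ?K" by simp
  have "Poly_Mapping.keys (a + b) \<subseteq> ?K" by (rule Poly_Mapping.keys_add)
  then show "mult_map (a + b) = mult_map a + mult_map b"
    using mult_map_superset[OF K, of a] mult_map_superset[OF K, of b]
      mult_map_superset[OF K, of "a + b"]
    by (simp add: lookup_add single_add case_prod_beta sum.distrib)
  have "Poly_Mapping.keys (c *\<^sub>R a) \<subseteq> ?K"
    by (auto simp: in_keys_iff scaleR_lookup)
  moreover have "Poly_Mapping.single m (c * t) = c *\<^sub>R Poly_Mapping.single m t" for m :: mono2 and t
    by (rule poly_mapping_eqI) (simp add: scaleR_lookup lookup_single when_def)
  ultimately show "mult_map (c *\<^sub>R a) = c *\<^sub>R mult_map a"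
    using mult_map_superset[OF K, of a] mult_map_superset[OF K, of "c *\<^sub>R a"]
    by (simp add: scaleR_lookup case_prod_beta scaleR_sum_right)
qed

lemma contract_tensor:
  assumes "linear \<phi>"
  shows "contract \<phi> (tensor p q) = \<phi> p *\<^sub>R q"
proof -
  have repr: "p = (\<Sum>m\<in>Poly_Mapping.keys p. Poly_Mapping.lookup p m *\<^sub>R Poly_Mapping.single m 1)" for p :: poly2
    by (rule poly_mapping_eqI)
      (simp add: lookup_sum scaleR_lookup lookup_single when_def in_keys_iff if_distrib cong: if_cong)
  have "\<phi> p = (\<Sum>m\<in>Poly_Mapping.keys p. Poly_Mapping.lookup p m * \<phi> (Poly_Mapping.single m 1))"
    by (subst repr[of p]) (simp add: linear_sum[OF assms] linear_scale[OF assms])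
  moreover have "contract \<phi> (tensor p q) = (\<Sum>m\<in>Poly_Mapping.keys p. \<Sum>n\<in>Poly_Mapping.keys q.
     (Poly_Mapping.lookup p m * \<phi> (Poly_Mapping.single m 1)) *\<^sub>R
       (Poly_Mapping.lookup q n *\<^sub>R Poly_Mapping.single n 1))"
    by (simp add: contract_def keys_tensor lookup_tensor sum.cartesian_product mult_ac)
  moreover have "\<dots> = (\<Sum>m\<in>Poly_Mapping.keys p.
     (Poly_Mapping.lookup p m * \<phi> (Poly_Mapping.single m 1)) *\<^sub>R q)"
    by (simp only: scaleR_sum_right[symmetric] repr[of q, symmetric])
  ultimately show ?thesis by (simp add: scaleR_sum_left)
qed

lemma psd_tensors_subset: "psd_tensors d \<subseteq> sym_tensors d"
proof
  fix \<theta> assume "\<theta> \<in> psd_tensors d"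
  then obtain r :: nat and p where "\<theta> = (\<Sum>i<r. tensor (p i) (p i))" "\<forall>i<r. p i \<in> binary_forms d"
    by (auto simp: psd_tensors_def)
  moreover from this have "\<theta> \<in> span {tensor p q | p q. p \<in> binary_forms d \<and> q \<in> binary_forms d}"
    by (simp, intro span_sum span_base) auto
  ultimately show "\<theta> \<in> sym_tensors d"
    by (auto simp: sym_tensors_def lookup_sum lookup_tensor mult.commute)
qed

end

theory Submission
  imports "HOL-Homology.Invariance_of_Domain" Defs "HOL-Computational_Algebra.Fundamental_Theorem_Algebra"
begin

text \<open>
  Let \<open>f\<close> be a binary form of degree \<open>2d\<close> and write its Gram tensors of rank \<open>r\<close> as
  \<open>\<theta> = \<Sum>\<^sub>j p\<^sub>j \<otimes> p\<^sub>j\<close> with linearly independent forms \<open>p\<^sub>0, \<dots>, p\<^sub>r\<^sub>-\<^sub>1\<close> of degree \<open>d\<close>.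

  Extremality. The tensors in the face of \<open>\<theta>\<close> are \<open>\<Sum> \<alpha>\<^sub>i\<^sub>j p\<^sub>i \<otimes> p\<^sub>j\<close> with \<open>\<alpha>\<close> symmetric and positive
  semidefinite, and they lie over \<open>f\<close> iff \<open>\<alpha> - 1\<close> is a quadratic relation between the \<open>p\<^sub>j\<close>. Hence
  \<open>\<theta>\<close> is extreme iff the products \<open>p\<^sub>i p\<^sub>j\<close>, \<open>i \<le> j\<close>, are linearly independent
  (\<open>extreme_point_if_indep_products\<close>, \<open>indep_products_if_extreme_point\<close>). This is an open condition,
  so \<open>Ex\<^sub>r(f)\<close> is open in the set of Gram tensors of rank \<open>r\<close>.

  Dimension. If \<open>f\<close> has no multiple factor, then the \<open>p\<^sub>j\<close> have no common factor, and every form of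
  degree \<open>2d\<close> is some \<open>\<Sum> p\<^sub>j X\<^sub>j\<close> with forms \<open>X\<^sub>j\<close> of degree \<open>d\<close> (\<open>coprime_multiples_surjective\<close>). So
  the derivative of \<open>(p\<^sub>j) \<mapsto> \<Sum> p\<^sub>j\<^sup>2\<close> is onto; since the \<open>p\<^sub>j\<close> are determined by \<open>\<theta>\<close> up to the orthogonal
  group, the Gram tensors of rank \<open>r\<close> form a manifold of dimension
  \<open>r(d + 1) - r(r - 1)/2 - (2d + 1) = (r - 2)(2d - r + 1)/2\<close>. The orthogonal group is removed by
  passing to the Cholesky factor, which lives in a linear space \<open>E\<close> of tuples. On \<open>E\<close> a suitable set \<open>C\<close> of
  entries of \<open>\<theta>\<close> together with \<open>f\<close> itself gives as many quadratic functions as \<open>E\<close> has dimensions, and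
  these are locally injective, because the difference of their values at two tuples is a
  bilinear expression in the sum and in the difference of the tuples (\<open>local_coordinates\<close>). Invariance
  of domain turns local injectivity into a local homeomorphism. It follows that a cell in \<open>Ex\<^sub>r(f)\<close>
  embeds locally into \<open>\<real>\<^sup>C\<close> (\<open>cell_dimension_le\<close>), and that a small cube in \<open>\<real>\<^sup>C\<close> parametrizes a cell
  in \<open>Ex\<^sub>r(f)\<close> if this set is nonempty (\<open>ex_cell_of_extreme_points\<close>). The graph of the parametrization is given
  by explicit polynomial conditions on the tensor, namely on the pivots and on the Schur complements,
  so that no elimination of quantifiers has to be carried out.

  Existence. A positive binary form is a sum of two squares, hence of \<open>r\<close> squares. A small change of
  the \<open>r\<close> forms makes their products independent, provided that a single tuple with independent
  products exists. Such a tuple is a rational curve of degree \<open>d\<close> in projective \<open>(r - 1)\<close>-space that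
  lies on no quadric. For \<open>r(r + 1)/2 \<le> 2d + 1\<close> it is found by degeneration to the union of a curve
  in a hyperplane and a rational normal curve (\<open>ex_rational_curve_off_quadrics\<close>).

  The set \<open>U\<close> consists of the sums of squares that have no multiple factor and a nonzero
  leading coefficient, and for which \<open>Ex\<^sub>r(f)\<close> is nonempty for every \<open>r\<close> in the Pataki range.
\<close>

section \<open>Linear systems\<close>

text \<open>The matrix \<open>f\<close> has rows \<open>B\<close>, possibly infinitely many, and finitely many columns \<open>K\<close>. Vectors are
  functions that may take any value outside \<open>K\<close>.\<close>

definition injective_system :: "'k set \<Rightarrow> 'b set \<Rightarrow> ('b \<Rightarrow> 'k \<Rightarrow> real) \<Rightarrow> bool" where
  "injective_system K B f \<longleftrightarrow>
     (\<forall>x. (\<forall>b\<in>B. (\<Sum>k\<in>K. f b k * x k) = 0) \<longrightarrow> (\<forall>k\<in>K. x k = 0))"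

lemma injective_systemD:
  assumes "injective_system K B f" "\<And>b. b \<in> B \<Longrightarrow> (\<Sum>k\<in>K. f b k * x k) = 0" "k \<in> K"
  shows "x k = 0"
  using assms unfolding injective_system_def by blast

text \<open>One step of Gaussian elimination with the pivot in row \<open>b0\<close> and column \<open>k\<close>. The rows are
  multiplied by the pivot instead of divided, so that polynomial entries stay polynomial.\<close>

lemma injective_system_eliminate:
  assumes K: "finite K" "k \<notin> K" and b0: "b0 \<in> B" "f b0 k \<noteq> 0"
  shows "injective_system (insert k K) B f \<longleftrightarrow>
         injective_system K B (\<lambda>b j. f b0 k * f b j - f b0 j * f b k)"
proof -
  have expand: "(\<Sum>j\<in>K. (f b0 k * f b j - f b0 j * f b k) * x j) =
      f b0 k * (\<Sum>j\<in>K. f b j * x j) - f b k * (\<Sum>j\<in>K. f b0 j * x j)" for b x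
    by (simp add: sum_distrib_left sum_subtractf[symmetric] algebra_simps)
  show ?thesis
  proof
    assume inj: "injective_system (insert k K) B f"
    show "injective_system K B (\<lambda>b j. f b0 k * f b j - f b0 j * f b k)"
      unfolding injective_system_def
    proof (intro allI impI ballI)
      fix x j assume x: "\<forall>b\<in>B. (\<Sum>j\<in>K. (f b0 k * f b j - f b0 j * f b k) * x j) = 0" and j: "j \<in> K"
      define y where "y = x(k := - (\<Sum>j\<in>K. f b0 j * x j) / f b0 k)"
      have yK: "(\<Sum>j\<in>K. f b j * y j) = (\<Sum>j\<in>K. f b j * x j)" for b
        using K by (intro sum.cong) (auto simp: y_def)
      have "(\<Sum>j\<in>insert k K. f b j * y j) = 0" if "b \<in> B" for b
      proof -
        have "f b0 k * (\<Sum>j\<in>insert k K. f b j * y j) = 0"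
          using x that K b0 by (simp add: yK expand) (simp add: y_def field_simps)
        then show ?thesis using b0 by simp
      qed
      then have "y j = 0" using injective_systemD[OF inj] j by blast
      then show "x j = 0" using j K by (auto simp: y_def split: if_splits)
    qed
  next
    assume inj: "injective_system K B (\<lambda>b j. f b0 k * f b j - f b0 j * f b k)"
    show "injective_system (insert k K) B f"
      unfolding injective_system_def
    proof (intro allI impI)
      fix x assume x: "\<forall>b\<in>B. (\<Sum>j\<in>insert k K. f b j * x j) = 0"
      have sK: "(\<Sum>j\<in>K. f b j * x j) = - f b k * x k" if "b \<in> B" for b
        using x that K by (auto simp: add_eq_0_iff)
      have xK: "x j = 0" if "j \<in> K" for j
        using that by (rule injective_systemD[OF inj, rotated]) (simp add: expand sK b0)
      then have "f b0 k * x k = 0" using sK[OF b0(1)] by simp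
      then show "\<forall>j\<in>insert k K. x j = 0" using xK b0 by simp
    qed
  qed
qed

text \<open>Injectivity of a matrix is an open condition: elimination uses only products and differences of
  entries, and it needs only that a pivot which is nonzero at \<open>p\<close> is nonzero nearby. The ring \<open>R\<close> and the
  filter \<open>F\<close> are left open in order to cover continuous entries near a point as well as
  polynomial entries outside a finite set; no determinants are involved.\<close>

lemma injective_system_eventually:
  fixes f :: "'s \<Rightarrow> 'b \<Rightarrow> 'k \<Rightarrow> real"
  assumes "finite K"
    and R_mult: "\<And>g h. g \<in> R \<Longrightarrow> h \<in> R \<Longrightarrow> (\<lambda>s. g s * h s) \<in> R"
    and R_diff: "\<And>g h. g \<in> R \<Longrightarrow> h \<in> R \<Longrightarrow> (\<lambda>s. g s - h s) \<in> R"
    and R_ev: "\<And>h. h \<in> R \<Longrightarrow> h p \<noteq> 0 \<Longrightarrow> eventually (\<lambda>s. h s \<noteq> 0) F"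
    and "\<And>b k. b \<in> B \<Longrightarrow> k \<in> K \<Longrightarrow> (\<lambda>s. f s b k) \<in> R"
    and "injective_system K B (f p)"
  shows "eventually (\<lambda>s. injective_system K B (f s)) F"
  using assms(1,5,6)
proof (induction K arbitrary: f rule: finite_induct)
  case empty
  then show ?case by (simp add: injective_system_def)
next
  case (insert k K)
  have "\<exists>b0\<in>B. f p b0 k \<noteq> 0"
  proof (rule ccontr)
    assume no: "\<not> ?thesis"
    have "(\<Sum>j\<in>insert k K. f p b j * (if j = k then 1 else 0)) = 0" if "b \<in> B" for b
      using no that insert.hyps by (auto intro!: sum.neutral)
    from injective_systemD[OF insert.prems(2) this, of k] show False by simp
  qed
  then obtain b0 where b0: "b0 \<in> B" "f p b0 k \<noteq> 0" by blast
  define f' where "f' = (\<lambda>s b j. f s b0 k * f s b j - f s b0 j * f s b k)"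
  have elim: "injective_system (insert k K) B (f s) = injective_system K B (f' s)" if "f s b0 k \<noteq> 0" for s
    using injective_system_eliminate[of K k b0 B "f s"] insert.hyps that b0(1) by (simp add: f'_def)
  have "eventually (\<lambda>s. injective_system K B (f' s)) F"
  proof (rule insert.IH)
    show "(\<lambda>s. f' s b j) \<in> R" if "b \<in> B" "j \<in> K" for b j
      unfolding f'_def using that b0 insert.prems(1) by (intro R_diff R_mult) auto
    show "injective_system K B (f' p)" using elim[OF b0(2)] insert.prems(2) by simp
  qed
  moreover have "eventually (\<lambda>s. f s b0 k \<noteq> 0) F"
    using R_ev[of "\<lambda>s. f s b0 k"] insert.prems(1) b0 by auto
  ultimately show ?case by eventually_elim (simp add: elim)
qed

lemma injective_system_tendsto:
  fixes f :: "'s \<Rightarrow> 'b \<Rightarrow> 'k \<Rightarrow> real"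
  assumes "finite K" "\<And>b k. b \<in> B \<Longrightarrow> k \<in> K \<Longrightarrow> ((\<lambda>s. f s b k) \<longlongrightarrow> f p b k) F"
    and "injective_system K B (f p)"
  shows "eventually (\<lambda>s. injective_system K B (f s)) F"
  by (rule injective_system_eventually[where R = "{h. (h \<longlongrightarrow> h p) F}" and p = p])
     (use assms in \<open>auto intro: tendsto_intros tendsto_imp_eventually_ne\<close>)

lemma injective_system_polynomial:
  fixes f :: "real \<Rightarrow> 'b \<Rightarrow> 'k \<Rightarrow> real"
  assumes "finite K" "\<And>b k. b \<in> B \<Longrightarrow> k \<in> K \<Longrightarrow> \<exists>P. \<forall>s. f s b k = poly P s"
    and "injective_system K B (f p)"
  shows "finite {s. \<not> injective_system K B (f s)}"
proof -
  have "eventually (\<lambda>s. injective_system K B (f s)) cofinite"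
  proof (rule injective_system_eventually[where R = "range poly" and p = p, OF assms(1)])
    show "(\<lambda>s. g s * h s) \<in> range poly" if "g \<in> range poly" "h \<in> range poly" for g h :: "real \<Rightarrow> real"
      using that by (auto simp: poly_mult[symmetric] fun_eq_iff image_iff simp del: poly_mult)
    show "(\<lambda>s. g s - h s) \<in> range poly" if "g \<in> range poly" "h \<in> range poly" for g h :: "real \<Rightarrow> real"
      using that by (auto simp: poly_diff[symmetric] fun_eq_iff image_iff simp del: poly_diff)
    show "eventually (\<lambda>s. h s \<noteq> 0) cofinite" if "h \<in> range poly" "h p \<noteq> 0" for h :: "real \<Rightarrow> real"
      using that by (auto simp: eventually_cofinite intro!: poly_roots_finite)
    show "(\<lambda>s. f s b k) \<in> range poly" if "b \<in> B" "k \<in> K" for b k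
      using assms(2)[OF that] by (auto simp: fun_eq_iff image_iff)
  qed (use assms in auto)
  then show ?thesis by (simp add: eventually_cofinite)
qed

definition surjective_system :: "'k set \<Rightarrow> 'b set \<Rightarrow> ('b \<Rightarrow> 'k \<Rightarrow> real) \<Rightarrow> bool" where
  "surjective_system K B f \<longleftrightarrow> (\<forall>y. \<exists>x. \<forall>b\<in>B. (\<Sum>k\<in>K. f b k * x k) = y b)"

lemma injective_system_card:
  assumes "finite K" "finite B" "injective_system K B f"
  shows "card K \<le> card B"
  using assms
proof (induction K arbitrary: B f rule: finite_induct)
  case (insert k K)
  have "\<exists>b0\<in>B. f b0 k \<noteq> 0"
  proof (rule ccontr)
    assume no: "\<not> ?thesis"
    have "(\<Sum>j\<in>insert k K. f b j * (if j = k then 1 else 0)) = 0" if "b \<in> B" for b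
      using no that insert.hyps by (auto intro!: sum.neutral)
    from injective_systemD[OF insert.prems(2) this, of k] show False by simp
  qed
  then obtain b0 where b0: "b0 \<in> B" "f b0 k \<noteq> 0" by blast
  define f' where "f' b j = f b0 k * f b j - f b0 j * f b k" for b j
  have "injective_system K B f'"
    using injective_system_eliminate[OF insert.hyps, of b0 B f] b0 insert.prems(2) unfolding f'_def by simp
  moreover have "(\<Sum>j\<in>K. f' b0 j * x j) = 0" for x by (simp add: f'_def)
  ultimately have "injective_system K (B - {b0}) f'"
    unfolding injective_system_def by blast
  then have "card K \<le> card (B - {b0})" using insert.prems(1) by (intro insert.IH) auto
  moreover have "card (B - {b0}) < card B" using b0 insert.prems(1) by (intro psubset_card_mono) auto
  ultimately show ?case using insert.hyps by simp
qed simp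

text \<open>The same elimination as above, for the dual property: eliminating one column and one row
  preserves solvability, so the number of rows is bounded by the number of columns.\<close>

lemma surjective_system_card:
  assumes "finite K" "finite B" "surjective_system K B f"
  shows "card B \<le> card K \<and> (card B = card K \<longrightarrow> injective_system K B f)"
  using assms
proof (induction K arbitrary: B f rule: finite_induct)
  case empty
  then have "\<exists>x :: 'a \<Rightarrow> real. \<forall>b\<in>B. (0::real) = 1"
    unfolding surjective_system_def by (auto dest: spec[of _ "\<lambda>_. 1"])
  then have "B = {}" by auto
  then show ?case by (simp add: injective_system_def)
next
  case (insert k K)
  show ?case
  proof (cases "\<exists>b0\<in>B. f b0 k \<noteq> 0")
    case True
    then obtain b0 where b0: "b0 \<in> B" "f b0 k \<noteq> 0" by blast
    define f' where "f' b j = f b0 k * f b j - f b0 j * f b k" for b j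
    have expand: "(\<Sum>j\<in>K. f' b j * x j) = f b0 k * (\<Sum>j\<in>K. f b j * x j) - f b k * (\<Sum>j\<in>K. f b0 j * x j)" for b x
      by (simp add: f'_def sum_distrib_left sum_subtractf[symmetric] algebra_simps)
    have "surjective_system K (B - {b0}) f'"
      unfolding surjective_system_def
    proof
      fix y
      obtain x where x: "\<forall>b\<in>B. (\<Sum>j\<in>insert k K. f b j * x j) = (if b = b0 then 0 else y b / f b0 k)"
        using insert.prems(2)[unfolded surjective_system_def, rule_format, of "\<lambda>b. if b = b0 then 0 else y b / f b0 k"] by (rule exE)
      have xK: "(\<Sum>j\<in>K. f b j * x j) = (if b = b0 then 0 else y b / f b0 k) - f b k * x k" if "b \<in> B" for b
        using x[rule_format, OF that] insert.hyps by simp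
      have "(\<Sum>j\<in>K. f' b j * x j) = y b" if "b \<in> B - {b0}" for b
        using that b0 by (simp add: expand xK right_diff_distrib)
      then show "\<exists>x. \<forall>b\<in>B - {b0}. (\<Sum>j\<in>K. f' b j * x j) = y b" by blast
    qed
    from insert.IH[OF _ this] have IH: "card (B - {b0}) \<le> card K"
      "card (B - {b0}) = card K \<Longrightarrow> injective_system K (B - {b0}) f'" using insert.prems(1) by auto
    have cB: "card B = Suc (card (B - {b0}))" using insert.prems(1) b0(1) by (rule card.remove)
    have "injective_system (insert k K) B f" if "card B = card (insert k K)"
    proof -
      have "injective_system K (B - {b0}) f'" using IH(2) that cB insert.hyps by simp
      then have "injective_system K B f'" unfolding injective_system_def by blast
      then show ?thesis using injective_system_eliminate[OF insert.hyps, of b0 B f] b0 unfolding f'_def by simp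
    qed
    then show ?thesis using IH(1) cB insert.hyps by simp
  next
    case False
    have "surjective_system K B f"
      unfolding surjective_system_def
    proof
      fix y
      obtain x where "\<forall>b\<in>B. (\<Sum>j\<in>insert k K. f b j * x j) = y b"
        using insert.prems(2)[unfolded surjective_system_def, rule_format, of y] by (rule exE)
      then show "\<exists>x. \<forall>b\<in>B. (\<Sum>j\<in>K. f b j * x j) = y b" using False insert.hyps by auto
    qed
    then have "card B \<le> card K" using insert.IH insert.prems(1) by blast
    then show ?thesis using insert.hyps by simp
  qed
qed

text \<open>This selects coordinates: if the rows \<open>B\<close> are independent and \<open>B'\<close> separates what \<open>B\<close> does not, then
  \<open>B\<close> can be completed by rows of \<open>B'\<close> to an invertible square matrix. As long as \<open>B\<close> has fewer rows
  than there are columns it has a nonzero kernel vector, and a row of \<open>B'\<close> that does not kill this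
  vector can be added.\<close>

lemma complete_to_square_system:
  assumes K: "finite K" and B: "finite B" "surjective_system K B f" and inj: "injective_system K (B \<union> B') f"
  shows "\<exists>C\<subseteq>B'. finite C \<and> card B + card C = card K \<and> injective_system K (B \<union> C) f"
  using B inj
proof (induction "card K - card B" arbitrary: B)
  case 0
  then have "card B = card K" "injective_system K B f" using surjective_system_card[OF K 0(2,3)] by auto
  then show ?case by (intro exI[of _ "{}"]) simp
next
  case (Suc n)
  then have "\<not> injective_system K B f" using injective_system_card[OF K Suc.prems(1)] by fastforce
  then obtain x k where x: "\<And>b. b \<in> B \<Longrightarrow> (\<Sum>k\<in>K. f b k * x k) = 0" "k \<in> K" "x k \<noteq> 0"
    unfolding injective_system_def by blast
  then obtain b where b: "b \<in> B'" "(\<Sum>k\<in>K. f b k * x k) \<noteq> 0"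
    using injective_systemD[OF Suc.prems(3), of x k] by blast
  have "b \<notin> B" using b x(1) by blast
  have "surjective_system K (insert b B) f"
    unfolding surjective_system_def
  proof
    fix y
    obtain z where z: "\<forall>b\<in>B. (\<Sum>k\<in>K. f b k * z k) = y b"
      using Suc.prems(2)[unfolded surjective_system_def, rule_format, of y] by (rule exE)
    define c where "c = (y b - (\<Sum>k\<in>K. f b k * z k)) / (\<Sum>k\<in>K. f b k * x k)"
    have "(\<Sum>k\<in>K. f b' k * (z k + c * x k)) = (\<Sum>k\<in>K. f b' k * z k) + c * (\<Sum>k\<in>K. f b' k * x k)" for b'
      by (simp add: sum.distrib distrib_left sum_distrib_left mult_ac)
    then have "\<forall>b'\<in>insert b B. (\<Sum>k\<in>K. f b' k * (z k + c * x k)) = y b'"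
      using z x(1) b(2) by (simp add: c_def)
    then show "\<exists>x. \<forall>b\<in>insert b B. (\<Sum>k\<in>K. f b k * x k) = y b" by (rule exI[of _ "\<lambda>k. z k + c * x k"])
  qed
  moreover have "injective_system K (insert b B \<union> B') f" using Suc.prems(3) b(1) by (simp add: insert_absorb)
  moreover have "n = card K - card (insert b B)" using Suc.hyps(2) Suc.prems(1) \<open>b \<notin> B\<close> by simp
  ultimately obtain C where C: "C \<subseteq> B'" "finite C" "card (insert b B) + card C = card K" "injective_system K (insert b B \<union> C) f"
    using Suc.hyps(1)[of "insert b B"] Suc.prems(1) by auto
  show ?case
  proof (cases "b \<in> C")
    case True
    have "surjective_system K (insert b B) f" by fact
    have "card K \<le> card (insert b B \<union> C)"
      using Suc.prems(1) C(2) by (intro injective_system_card[OF K _ C(4)]) auto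
    moreover have "insert b B \<union> C = B \<union> C" using True by blast
    ultimately have "card K \<le> card B + card C" using card_Un_le[of B C] by simp
    then show ?thesis using C(3) \<open>b \<notin> B\<close> Suc.prems(1) by simp
  next
    case False
    then show ?thesis using C b(1) \<open>b \<notin> B\<close> Suc.prems(1) by (intro exI[of _ "insert b C"]) auto
  qed
qed

section \<open>Rational curves on no quadric\<close>

definition quad :: "nat \<Rightarrow> (nat \<Rightarrow> nat \<Rightarrow> real) \<Rightarrow> (nat \<Rightarrow> real) \<Rightarrow> real" where
  "quad r q x = (\<Sum>i<r. \<Sum>j<r. q i j * x i * x j)"

definition off_quadrics :: "nat \<Rightarrow> (nat \<Rightarrow> real) set \<Rightarrow> bool" where
  "off_quadrics r X \<longleftrightarrow> (\<forall>q. (\<forall>i j. q i j = q j i) \<longrightarrow> (\<forall>x\<in>X. quad r q x = 0) \<longrightarrow>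
     (\<forall>i<r. \<forall>j<r. q i j = 0))"

lemma off_quadricsD:
  assumes "off_quadrics r X" "\<And>i j. q i j = q j i" "\<And>x. x \<in> X \<Longrightarrow> quad r q x = 0" "i < r" "j < r"
  shows "q i j = 0"
  using assms unfolding off_quadrics_def by blast

lemma quad_pairs:
  assumes "\<And>i j. q i j = q j i"
  shows "quad r q x = (\<Sum>(i, j)\<in>{(i, j). i \<le> j \<and> j < r}. x i * x j * (if i = j then q i j else 2 * q i j))"
proof -
  let ?L = "{(i, j). i \<le> j \<and> j < r}" and ?U = "{(i, j). j < i \<and> i < r}" and ?S = "{(i, j). i < j \<and> j < r}"
  have fin: "finite ?L" "finite ?U" "finite ?S"
    by (rule finite_subset[of _ "{..<r} \<times> {..<r}"]; auto)+
  have "quad r q x = (\<Sum>(i, j)\<in>{..<r} \<times> {..<r}. q i j * x i * x j)"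
    by (simp add: quad_def sum.cartesian_product)
  also have "{..<r} \<times> {..<r} = ?L \<union> ?U" by auto
  also have "(\<Sum>(i, j)\<in>?L \<union> ?U. q i j * x i * x j) = (\<Sum>(i, j)\<in>?L. q i j * x i * x j) + (\<Sum>(i, j)\<in>?U. q i j * x i * x j)"
    by (rule sum.union_disjoint[OF fin(1,2)]) auto
  also have "(\<Sum>(i, j)\<in>?U. q i j * x i * x j) = (\<Sum>(i, j)\<in>?S. q i j * x i * x j)"
    by (rule sum.reindex_bij_witness[of _ "\<lambda>(i, j). (j, i)" "\<lambda>(i, j). (j, i)"]) (auto simp: assms)
  also have "\<dots> = (\<Sum>(i, j)\<in>?L. if i = j then 0 else q i j * x i * x j)"
    by (rule sum.mono_neutral_cong_left[OF fin(1)]) (auto split: if_splits simp: le_less)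
  also have "(\<Sum>(i, j)\<in>?L. q i j * x i * x j) + (\<Sum>(i, j)\<in>?L. if i = j then 0 else q i j * x i * x j) =
      (\<Sum>(i, j)\<in>?L. x i * x j * (if i = j then q i j else 2 * q i j))"
    by (subst sum.distrib[symmetric], intro sum.cong) auto
  finally show ?thesis .
qed

text \<open>The vectors lie on no common quadric iff the matrix of their degree two monomials is injective;
  the coefficient of \<open>x\<^sub>i x\<^sub>j\<close> is \<open>q i i\<close> on the diagonal and \<open>2 q i j\<close> off it.\<close>

lemma off_quadrics_injective_system:
  "off_quadrics r (v ` B) \<longleftrightarrow> injective_system {(i, j). i \<le> j \<and> j < r} B (\<lambda>b (i, j). v b i * v b j)"
proof
  let ?K = "{(i, j). i \<le> j \<and> j < r}"
  assume L: "off_quadrics r (v ` B)"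
  show "injective_system ?K B (\<lambda>b (i, j). v b i * v b j)"
    unfolding injective_system_def
  proof (intro allI impI ballI, clarify)
    fix a i j assume a: "\<forall>b\<in>B. (\<Sum>k\<in>?K. (case k of (i, j) \<Rightarrow> v b i * v b j) * a k) = 0" and ij: "i \<le> j" "j < r"
    define q where "q i j = (if i = j then a (i, j) else a (min i j, max i j) / 2)" for i j
    have sym: "q i j = q j i" for i j by (auto simp: q_def min.commute max.commute)
    have "quad r q (v b) = 0" if "b \<in> B" for b
    proof -
      have "quad r q (v b) = (\<Sum>k\<in>?K. (case k of (i, j) \<Rightarrow> v b i * v b j) * a k)"
        unfolding quad_pairs[OF sym] by (intro sum.cong) (auto simp: q_def min_def max_def)
      then show ?thesis using a that by simp
    qed
    then have "q i j = 0" by (intro off_quadricsD[OF L sym]) (use ij in auto)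
    then show "a (i, j) = 0" using ij by (auto simp: q_def min_def max_def split: if_splits)
  qed
next
  let ?K = "{(i, j). i \<le> j \<and> j < r}"
  assume inj: "injective_system ?K B (\<lambda>b (i, j). v b i * v b j)"
  show "off_quadrics r (v ` B)"
    unfolding off_quadrics_def
  proof (intro allI impI)
    fix q :: "nat \<Rightarrow> nat \<Rightarrow> real" and i j
    assume sym: "\<forall>i j. q i j = q j i" and q: "\<forall>x\<in>v ` B. quad r q x = 0" and ij: "i < r" "j < r"
    have "(\<Sum>k\<in>?K. (case k of (i, j) \<Rightarrow> v b i * v b j) * (case k of (i, j) \<Rightarrow> if i = j then q i j else 2 * q i j)) = 0"
      if "b \<in> B" for b
      using quad_pairs[of q r "v b"] sym q that by (simp add: case_prod_beta)
    from injective_systemD[OF inj this]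
    have "q i j = 0" if "i \<le> j" "j < r" for i j
      using that by (force split: if_splits)
    then show "q i j = 0" using sym ij by (metis nle_le)
  qed
qed

lemma finite_pairs_le: "finite {(i, j :: nat). i \<le> j \<and> j < (r::nat)}"
  by (rule finite_subset[of _ "{..<r} \<times> {..<r}"]) auto

lemma card_pairs_le: "card {(i, j). i \<le> j \<and> j < (r::nat)} = (r + 1) choose 2"
proof (induction r)
  case (Suc r)
  have "{(i, j). i \<le> j \<and> j < Suc r} = {(i, j). i \<le> j \<and> j < r} \<union> (\<lambda>i. (i, r)) ` {..r}"
    by (auto simp: less_Suc_eq)
  moreover have "card ((\<lambda>i. (i, r)) ` {..r}) = r + 1"
    by (subst card_image) (auto simp: inj_on_def)
  moreover have "card ({(i, j). i \<le> j \<and> j < r} \<union> (\<lambda>i. (i, r)) ` {..r}) =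
      card {(i, j). i \<le> j \<and> j < r} + card ((\<lambda>i. (i, r)) ` {..r})"
    by (rule card_Un_disjoint[OF finite_pairs_le]) auto
  ultimately show ?case by (simp add: Suc numeral_2_eq_2)
qed simp

lemma off_quadrics_polynomial:
  fixes v :: "real \<Rightarrow> 'b \<Rightarrow> nat \<Rightarrow> real"
  assumes "\<And>b i. b \<in> B \<Longrightarrow> i < r \<Longrightarrow> \<exists>P. \<forall>s. v s b i = poly P s" "off_quadrics r (v p ` B)"
  shows "finite {s. \<not> off_quadrics r (v s ` B)}"
  unfolding off_quadrics_injective_system
proof (rule injective_system_polynomial)
  show "\<exists>P. \<forall>s. (case k of (i, j) \<Rightarrow> v s b i * v s b j) = poly P s"
    if bk: "b \<in> B" "k \<in> {(i, j). i \<le> j \<and> j < r}" for b k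
  proof -
    obtain i j where k: "k = (i, j)" "i < r" "j < r" using bk(2) by (cases k) auto
    obtain P Q where "\<forall>s. v s b i = poly P s" "\<forall>s. v s b j = poly Q s"
      using assms(1) bk(1) k by metis
    then have "\<forall>s. (case k of (i, j) \<Rightarrow> v s b i * v s b j) = poly (P * Q) s" by (simp add: k)
    then show ?thesis by blast
  qed
  show "injective_system {(i, j). i \<le> j \<and> j < r} B (\<lambda>b (i, j). v p b i * v p b j)"
    using assms(2) by (simp only: off_quadrics_injective_system)
qed (rule finite_pairs_le)

lemma quad_scale: "quad r q (\<lambda>i. a * x i) = a\<^sup>2 * quad r q x"
  by (simp add: quad_def sum_distrib_left power2_eq_square algebra_simps)

lemma quad_cong: "(\<And>i. i < r \<Longrightarrow> x i = y i) \<Longrightarrow> quad r q x = quad r q y"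
  unfolding quad_def by (intro sum.cong) auto

lemma quad_Suc:
  assumes "\<And>i j. q i j = q j i"
  shows "quad (Suc r) q x = quad r q x + 2 * x r * (\<Sum>i<r. q i r * x i) + q r r * (x r)\<^sup>2"
proof -
  have "(\<Sum>j<r. q r j * x r * x j) = x r * (\<Sum>i<r. q i r * x i)"
    unfolding sum_distrib_left by (intro sum.cong refl) (metis assms mult.assoc mult.commute)
  moreover have "(\<Sum>i<r. q i r * x i * x r) = x r * (\<Sum>i<r. q i r * x i)"
    by (simp add: sum_distrib_left mult_ac)
  ultimately show ?thesis
    by (simp add: quad_def sum.distrib power2_eq_square algebra_simps)
qed

lemma poly_eq_0_outside_finite:
  fixes p :: "real poly"
  assumes "finite S" "\<And>x. x \<notin> S \<Longrightarrow> poly p x = 0"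
  shows "p = 0"
proof (rule ccontr)
  assume "p \<noteq> 0"
  then have "finite (S \<union> {x. poly p x = 0})" using assms(1) poly_roots_finite by blast
  moreover have "S \<union> {x. poly p x = 0} = UNIV" using assms(2) by blast
  ultimately show False using infinite_UNIV_char_0 by metis
qed

text \<open>A parametrized curve \<open>c\<close>, at the real parameters, together with isolated points \<open>z\<close>. The points
  are what makes an induction possible: they take up the conditions that the curve alone does
  not impose.\<close>

definition curve_and_points :: "(nat \<Rightarrow> real poly) \<Rightarrow> (nat \<Rightarrow> nat \<Rightarrow> real) \<Rightarrow> real + nat \<Rightarrow> nat \<Rightarrow> real" where
  "curve_and_points c z = case_sum (\<lambda>t i. poly (c i) t) z"

lemma curve_and_points_simps [simp]:
  "curve_and_points c z (Inl t) = (\<lambda>i. poly (c i) t)" "curve_and_points c z (Inr k) = z k"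
  by (simp_all add: curve_and_points_def)

definition points_and_start :: "(nat \<Rightarrow> real poly) \<Rightarrow> (nat \<Rightarrow> nat \<Rightarrow> real) \<Rightarrow> nat \<Rightarrow> nat \<Rightarrow> real" where
  "points_and_start c z = case_nat (\<lambda>i. poly (c i) 0) z"

lemma points_and_start_simps [simp]:
  "points_and_start c z 0 = (\<lambda>i. poly (c i) 0)" "points_and_start c z (Suc k) = z k"
  by (simp_all add: points_and_start_def)

lemma Ball_curve_and_points:
  "(\<forall>x\<in>curve_and_points c z ` (UNIV <+> {..<s}). Q x) \<longleftrightarrow> (\<forall>t. Q (\<lambda>i. poly (c i) t)) \<and> (\<forall>k<s. Q (z k))"
  unfolding Plus_def image_Un ball_Un by auto

lemma quad_sum_of_unit_vectors:
  assumes "a < r" "b < r"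
  shows "quad r q (\<lambda>i. (if i = a then 1 else 0) + (if i = b then 1 else 0)) = q a a + q a b + q b a + q b b"
proof -
  have "quad r q (\<lambda>i. (if i = a then 1 else 0) + (if i = b then 1 else 0)) =
      (\<Sum>i<r. ((if i = a then 1 else 0) + (if i = b then 1 else 0)) *
        (\<Sum>j<r. ((if j = a then 1 else 0) + (if j = b then 1 else 0)) * q i j))"
    by (simp add: quad_def sum_distrib_left mult_ac)
  also have "\<dots> = q a a + q a b + q b a + q b b"
    using assms by (simp add: distrib_right sum.distrib if_distrib[of "\<lambda>x. x * _"] cong: if_cong)
  finally show ?thesis .
qed

text \<open>The points can be moved, together with the curve, so that in addition \<open>c(0), z\<^sub>0, \<dots>, z\<^sub>r\<^sub>-\<^sub>2\<close> is a
  basis. On the line from the given configuration to one with this property, either condition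
  fails for finitely many parameters only.\<close>

lemma off_quadrics_general_position:
  assumes off: "off_quadrics r (curve_and_points c z ` (UNIV <+> {..<s}))"
    and deg: "\<And>i. i < r \<Longrightarrow> degree (c i) \<le> d"
  obtains c' z' where "\<And>i. i < r \<Longrightarrow> degree (c' i) \<le> d"
    "off_quadrics r (curve_and_points c' z' ` (UNIV <+> {..<s}))"
    "injective_system {..<r} {..<r} (points_and_start c' z')"
proof -
  define c' where "c' l i = smult (1 - l) (c i) + (if i = 0 then [:l:] else 0)" for l i
  define z' where "z' l k i = (1 - l) * z k i + (if i = Suc k then l else 0)" for l k i
  have "finite {l. \<not> off_quadrics r (curve_and_points (c' l) (z' l) ` (UNIV <+> {..<s}))}"
  proof (rule off_quadrics_polynomial)
    show "\<exists>P. \<forall>l. curve_and_points (c' l) (z' l) b i = poly P l" for b :: "real + nat" and i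
    proof (cases b)
      case (Inl t)
      show ?thesis unfolding Inl
        by (intro exI[of _ "[:poly (c i) t, (if i = 0 then 1 else 0) - poly (c i) t:]"])
           (simp add: c'_def algebra_simps)
    next
      case (Inr k)
      show ?thesis unfolding Inr
        by (intro exI[of _ "[:z k i, (if i = Suc k then 1 else 0) - z k i:]"])
           (simp add: z'_def algebra_simps)
    qed
    show "off_quadrics r (curve_and_points (c' 0) (z' 0) ` (UNIV <+> {..<s}))"
    proof -
      have "c' 0 = c" "z' 0 = z" by (simp_all add: fun_eq_iff c'_def z'_def)
      then show ?thesis using off by simp
    qed
  qed
  moreover have "finite {l. \<not> injective_system {..<r} {..<r} (points_and_start (c' l) (z' l))}"
  proof (rule injective_system_polynomial)
    show "\<exists>P. \<forall>l. points_and_start (c' l) (z' l) b i = poly P l" for b i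
    proof (cases b)
      case 0
      show ?thesis unfolding 0
        by (intro exI[of _ "[:poly (c i) 0, (if i = 0 then 1 else 0) - poly (c i) 0:]"])
           (simp add: c'_def algebra_simps)
    next
      case (Suc k)
      show ?thesis unfolding Suc
        by (intro exI[of _ "[:z k i, (if i = Suc k then 1 else 0) - z k i:]"])
           (simp add: z'_def algebra_simps)
    qed
    have "points_and_start (c' 1) (z' 1) = (\<lambda>b i. if i = b then 1 else 0)"
      by (auto simp: fun_eq_iff c'_def z'_def points_and_start_def split: nat.split)
    then show "injective_system {..<r} {..<r} (points_and_start (c' 1) (z' 1))"
      by (simp add: injective_system_def mult_delta_left)
  qed simp
  ultimately have "finite ({l. \<not> off_quadrics r (curve_and_points (c' l) (z' l) ` (UNIV <+> {..<s}))} \<union>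
      {l. \<not> injective_system {..<r} {..<r} (points_and_start (c' l) (z' l))})" by (rule finite_UnI)
  from ex_new_if_finite[OF infinite_UNIV_char_0 this]
  obtain l where "off_quadrics r (curve_and_points (c' l) (z' l) ` (UNIV <+> {..<s}))"
    "injective_system {..<r} {..<r} (points_and_start (c' l) (z' l))" by auto
  moreover have "degree (c' l i) \<le> d" if "i < r" for i
    unfolding c'_def using deg[OF that] by (intro degree_add_le degree_smult_le[THEN order_trans]) auto
  ultimately show thesis using that by blast
qed

text \<open>The start of the induction. The curve \<open>(1, t, \<dots>, t\<^sup>d, 0, \<dots>, 0)\<close> imposes \<open>2d + 1\<close> conditions, the vanishing of
  the antidiagonal sums of the upper left block. The monomials \<open>x\<^sub>0 x\<^sub>j\<close> and \<open>x\<^sub>i x\<^sub>d\<close> represent these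
  antidiagonals; for every other monomial \<open>x\<^sub>i x\<^sub>j\<close> the point \<open>e\<^sub>i + e\<^sub>j\<close> is added.\<close>

lemma off_quadrics_rational_normal:
  assumes "d < r" "(r + 1) choose 2 \<le> 2 * d + 1 + s"
  obtains c z where "\<And>i. i < r \<Longrightarrow> degree (c i) \<le> d"
    "off_quadrics r (curve_and_points c z ` (UNIV <+> {..<s}))"
proof -
  define c :: "nat \<Rightarrow> real poly" where "c i = (if i \<le> d then monom 1 i else 0)" for i
  \<comment> \<open>One monomial for each of the \<open>2 d + 1\<close> antidiagonals.\<close>
  define L where "L = (\<lambda>j. (0, j)) ` {..d} \<union> (\<lambda>i. (i, d)) ` {1..d}"
  define M where "M = {(i, j). i \<le> j \<and> j < r} - L"
  have "card L = card ((\<lambda>j. (0::nat, j)) ` {..d}) + card ((\<lambda>i. (i, d)) ` {1..d})"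
    unfolding L_def by (intro card_Un_disjoint) auto
  also have "\<dots> = 2 * d + 1" by (simp add: card_image inj_on_def)
  finally have "card L = 2 * d + 1" .
  moreover have "L \<subseteq> {(i, j). i \<le> j \<and> j < r}" using assms(1) by (auto simp: L_def)
  ultimately have "card M \<le> s"
    unfolding M_def using assms(2) by (subst card_Diff_subset) (auto simp: card_pairs_le L_def)
  moreover have "finite M" unfolding M_def by (rule finite_Diff) (rule finite_pairs_le)
  then obtain g where "bij_betw g {0..<card M} M" using ex_bij_betw_nat_finite by blast
  then have "g ` {..<card M} = M" by (simp add: bij_betw_def atLeast0LessThan)
  ultimately obtain m where g: "m \<le> s" "g ` {..<m} = M" by blast
  define z where "z k i = (if i = fst (g k) then 1 else 0) + (if i = snd (g k) then 1 else 0 :: real)" for k i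
  show thesis
  proof (rule that)
    show "degree (c i) \<le> d" for i by (simp add: c_def degree_monom_eq)
    show "off_quadrics r (curve_and_points c z ` (UNIV <+> {..<s}))"
      unfolding off_quadrics_def
    proof (intro allI impI)
      fix q :: "nat \<Rightarrow> nat \<Rightarrow> real" and i j
      assume sym: "\<forall>i j. q i j = q j i" and i: "i < r" and j: "j < r"
        and q: "\<forall>x\<in>curve_and_points c z ` (UNIV <+> {..<s}). quad r q x = 0"
      define G where "G = (\<Sum>i<r. \<Sum>j<r. smult (q i j) (c i * c j))"
      have "poly G t = quad r q (\<lambda>i. poly (c i) t)" for t
        by (simp add: G_def quad_def poly_sum mult.assoc)
      then have "poly G t = 0" for t using q[unfolded Ball_curve_and_points] by simp
      then have "G = 0" using poly_all_0_iff_0 by blast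
      have coeff: "(\<Sum>i\<le>d. \<Sum>j\<le>d. if i + j = n then q i j else 0) = 0" for n
      proof -
        have "0 = coeff G n" using \<open>G = 0\<close> by simp
        also have "\<dots> = (\<Sum>i<r. \<Sum>j<r. if i \<le> d \<and> j \<le> d \<and> i + j = n then q i j else 0)"
          unfolding G_def coeff_sum by (intro sum.cong refl) (auto simp: c_def mult_monom)
        also have "\<dots> = (\<Sum>i\<le>d. \<Sum>j<r. if i \<le> d \<and> j \<le> d \<and> i + j = n then q i j else 0)"
          using assms(1) by (intro sum.mono_neutral_right) auto
        also have "\<dots> = (\<Sum>i\<le>d. \<Sum>j\<le>d. if i + j = n then q i j else 0)"
          using assms(1) by (intro sum.cong[OF refl], intro sum.mono_neutral_cong_right) auto
        finally show ?thesis by simp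
      qed
      have pt: "q i i + q j j + 2 * q i j = 0" if "(i, j) \<in> M" for i j
      proof -
        from that have "(i, j) \<in> g ` {..<m}" by (simp add: g(2))
        then obtain k where k: "k < m" "g k = (i, j)" by auto
        have "quad r q (z k) = 0" using q[unfolded Ball_curve_and_points] k(1) g(1) by simp
        moreover have "i < r" "j < r" using that by (auto simp: M_def)
        moreover have "z k = (\<lambda>l. (if l = i then 1 else 0) + (if l = j then 1 else 0))"
          by (simp add: z_def k(2) fun_eq_iff)
        moreover have "q j i = q i j" using sym by blast
        ultimately show ?thesis by (simp add: quad_sum_of_unit_vectors)
      qed
      have diag: "q i i = 0" if "i < r" for i
      proof (cases "i = 0 \<or> i = d")
        case True
        have "(\<Sum>a\<le>d. \<Sum>b\<le>d. if a + b = 2 * i then q a b else 0) =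
            (\<Sum>a\<le>d. \<Sum>b\<le>d. if a = i then if b = i then q a b else 0 else 0)"
          using True by (intro sum.cong refl) auto
        also have "\<dots> = (\<Sum>a\<le>d. if a = i then q i i else 0)"
          using True by (intro sum.cong refl) auto
        also have "\<dots> = q i i" using True by auto
        finally show ?thesis using coeff[of "2 * i"] by simp
      next
        case False
        then have "(i, i) \<in> M" using that by (auto simp: M_def L_def)
        from pt[OF this] show ?thesis by simp
      qed
      have M0: "q i j = 0" if "(i, j) \<in> M" for i j
        using pt[OF that] diag[of i] diag[of j] that by (auto simp: M_def)
      have L0: "q i j = 0" if ij: "(i, j) \<in> L" for i j
      proof -
        have LD: "x = 0 \<or> y = d" "x \<le> d" "y \<le> d" if "(x, y) \<in> L" for x y using that by (auto simp: L_def)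
        note ijd = LD[OF ij]
        have zero': "q a b = 0" if ab: "a \<le> b" "b \<le> d" "a + b = i + j" "(a, b) \<noteq> (i, j)" for a b
        proof -
          have "(a, b) \<notin> L"
          proof
            assume "(a, b) \<in> L"
            from LD(1)[OF this] ab ijd show False by auto
          qed
          then have "(a, b) \<in> M" using ab assms(1) by (simp add: M_def)
          then show ?thesis by (rule M0)
        qed
        have zero: "q a b = 0" if "a \<le> d" "b \<le> d" "a + b = i + j" "(a, b) \<noteq> (i, j)" "(a, b) \<noteq> (j, i)" for a b
          using zero'[of a b] zero'[of b a] that sym[rule_format, of a b] by (cases "a \<le> b") auto
        have "0 = (\<Sum>(a, b)\<in>{..d} \<times> {..d}. if a + b = i + j then q a b else 0)"
          using coeff[of "i + j"] by (simp add: sum.cartesian_product)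
        also have "\<dots> = (\<Sum>(a, b)\<in>{(i, j), (j, i)}. if a + b = i + j then q a b else 0)"
        proof (intro sum.mono_neutral_right)
          show "\<forall>k\<in>{..d} \<times> {..d} - {(i, j), (j, i)}. (case k of (a, b) \<Rightarrow> if a + b = i + j then q a b else 0) = 0"
          proof
            fix k assume "k \<in> {..d} \<times> {..d} - {(i, j), (j, i)}"
            then show "(case k of (a, b) \<Rightarrow> if a + b = i + j then q a b else 0) = 0"
              using zero[of "fst k" "snd k"] by (cases k) simp
          qed
        qed (use ijd in simp_all)
        also have "\<dots> = (if i = j then q i j else 2 * q i j)"
          using sym[rule_format, of i j] by (simp add: add.commute)
        finally show ?thesis by (auto split: if_splits)
      qed
      have le: "q i j = 0" if "i \<le> j" "j < r" for i j
        using that M0 L0 by (cases "(i, j) \<in> L") (auto simp: M_def)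
      show "q i j = 0" using le[of i j] le[of j i] sym i j by (metis nle_le)
    qed
  qed
qed

text \<open>The induction step. Let \<open>w\<^sub>0, \<dots>, w\<^sub>r\<^sub>-\<^sub>2\<close> be the first \<open>r - 1\<close> points, placed in the hyperplane
  \<open>x\<^sub>r = 0\<close>, and let \<open>w\<^sub>r\<^sub>-\<^sub>1 = e\<^sub>r\<close>. Up to the common denominator the new curve is
  \<open>c(t) + e \<Sum>\<^sub>k w\<^sub>k / (t - e k)\<close>. For \<open>e \<rightarrow> 0\<close> it degenerates to \<open>c\<close> and, in the variable \<open>u = t / e\<close>, to the
  rational normal curve \<open>c(0) + \<Sum>\<^sub>k w\<^sub>k / (u - k)\<close>, which meets the hyperplane in \<open>c(0)\<close> and in the points
  \<open>w\<^sub>0, \<dots>, w\<^sub>r\<^sub>-\<^sub>2\<close>. A quadric through both limits and through the remaining points contains the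
  hyperplane, by hypothesis, so it is \<open>x\<^sub>r L = 0\<close> for a linear form \<open>L\<close>; then \<open>L\<close> vanishes on the
  rational normal curve, hence everywhere. As the entries are polynomial in \<open>e\<close>, the conclusion
  passes from \<open>e = 0\<close> to almost all \<open>e\<close>.\<close>

lemma off_quadrics_attach_rational_normal:
  assumes r: "r \<ge> 1"
    and deg: "\<And>i. i < r \<Longrightarrow> degree (c i) \<le> d"
    and off: "off_quadrics r (curve_and_points c z ` (UNIV <+> {..<s + (r - 1)}))"
    and inj: "injective_system {..<r} {..<r} (points_and_start c z)"
  obtains C Z where "\<And>i. i < Suc r \<Longrightarrow> degree (C i) \<le> d + r"
    "off_quadrics (Suc r) (curve_and_points C Z ` (UNIV <+> {..<s}))"
proof -
  define c' where "c' i = (if i < r then c i else 0)" for i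
  define w :: "nat \<Rightarrow> nat \<Rightarrow> real" where "w k i = (if k < r - 1 then if i < r then z k i else 0 else if i = r then 1 else 0)" for k i
  define Z where "Z k i = (if i < r then z (r - 1 + k) i else 0)" for k i
  define C where "C e i = c' i * (\<Prod>k<r. [:- (e * real k), 1:]) +
      smult e (\<Sum>k<r. smult (w k i) (\<Prod>l\<in>{..<r} - {k}. [:- (e * real l), 1:]))" for e i
  \<comment> \<open>The curve in the variable \<open>u = t / e\<close>, divided by \<open>e\<^sup>r\<close>; see \<open>Ch\<close> below.\<close>
  define h where "h e u i = poly (c' i) (e * u) * (\<Prod>k<r. u - real k) +
      (\<Sum>k<r. w k i * (\<Prod>l\<in>{..<r} - {k}. u - real l))" for e u i
  define v where "v e = case_sum (case_sum (\<lambda>t i. poly (C e i) t) (h e)) Z" for e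
  define B :: "((real + real) + nat) set" where "B = UNIV <+> {..<s}"
  have ball: "(\<forall>x\<in>v e ` B. Q x) \<longleftrightarrow> (\<forall>t. Q (\<lambda>i. poly (C e i) t)) \<and> (\<forall>u. Q (h e u)) \<and> (\<forall>k<s. Q (Z k))" for e Q
    unfolding B_def Plus_def UNIV_sum image_Un ball_Un by (auto simp: v_def)
  have Ch: "poly (C e i) (e * u) = e ^ r * h e u i" for e u i
  proof -
    have "(\<Prod>k<r. e * u - e * real k) = e ^ r * (\<Prod>k<r. u - real k)"
      by (simp add: right_diff_distrib[symmetric] prod.distrib)
    moreover have "e * (\<Prod>l\<in>{..<r} - {k}. e * u - e * real l) = e ^ r * (\<Prod>l\<in>{..<r} - {k}. u - real l)"
      if "k < r" for k
      using that r by (simp add: right_diff_distrib[symmetric] prod.distrib flip: power_Suc)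
    then have "e * (\<Sum>k<r. w k i * (\<Prod>l\<in>{..<r} - {k}. e * u - e * real l)) =
        e ^ r * (\<Sum>k<r. w k i * (\<Prod>l\<in>{..<r} - {k}. u - real l))"
      unfolding sum_distrib_left by (intro sum.cong refl) (metis lessThan_iff mult.left_commute)
    ultimately show ?thesis
      by (simp add: C_def h_def poly_sum poly_prod algebra_simps)
  qed
  have "finite {e. \<not> off_quadrics (Suc r) (v e ` B)}"
  proof (rule off_quadrics_polynomial)
    show "\<exists>P. \<forall>e. v e b i = poly P e" for b i
    proof (cases b)
      case (Inl a)
      show ?thesis
      proof (cases a)
        case (Inl t)
        have "\<forall>e. v e b i = poly (smult (poly (c' i) t) (\<Prod>k<r. [:t, - real k:]) +
            [:0, 1:] * (\<Sum>k<r. smult (w k i) (\<Prod>l\<in>{..<r} - {k}. [:t, - real l:]))) e"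
          by (simp add: \<open>b = Inl a\<close> Inl v_def C_def poly_sum poly_prod)
        then show ?thesis by blast
      next
        case (Inr u)
        have "\<forall>e. v e b i = poly (smult (\<Prod>k<r. u - real k) (pcompose (c' i) [:0, u:]) +
            [:\<Sum>k<r. w k i * (\<Prod>l\<in>{..<r} - {k}. u - real l):]) e"
          by (simp add: \<open>b = Inl a\<close> Inr v_def h_def poly_pcompose)
        then show ?thesis by blast
      qed
    next
      case (Inr k)
      have "\<forall>e. v e b i = poly [:Z k i:] e" by (simp add: Inr v_def)
      then show ?thesis by blast
    qed
    show "off_quadrics (Suc r) (v 0 ` B)"
      unfolding off_quadrics_def ball
    proof (intro allI impI, elim conjE)
      fix q :: "nat \<Rightarrow> nat \<Rightarrow> real" and i j
      assume sym: "\<forall>i j. q i j = q j i" and ij: "i < Suc r" "j < Suc r"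
        and qC: "\<forall>t. quad (Suc r) q (\<lambda>i. poly (C 0 i) t) = 0"
        and qh: "\<forall>u. quad (Suc r) q (h 0 u) = 0" and qZ: "\<forall>k<s. quad (Suc r) q (Z k) = 0"
      note Suc_r = quad_Suc[of q r, OF sym[rule_format]]
      define G where "G = (\<Sum>i<r. \<Sum>j<r. smult (q i j) (c i * c j))"
      have G: "poly G t = quad r q (\<lambda>i. poly (c i) t)" for t
        by (simp add: G_def quad_def poly_sum mult.assoc)
      have "G = 0"
      proof (rule poly_eq_0_outside_finite)
        fix t :: real assume t: "t \<notin> {0}"
        have "0 = quad (Suc r) q (\<lambda>i. t ^ r * poly (c' i) t)"
          using qC[rule_format, of t] by (simp add: C_def poly_prod mult.commute)
        also have "\<dots> = (t ^ r)\<^sup>2 * quad (Suc r) q (\<lambda>i. poly (c' i) t)" by (rule quad_scale)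
        also have "quad (Suc r) q (\<lambda>i. poly (c' i) t) = quad r q (\<lambda>i. poly (c' i) t)"
          by (simp add: Suc_r c'_def)
        also have "\<dots> = poly G t" unfolding G by (rule quad_cong) (simp add: c'_def)
        finally show "poly G t = 0" using t by simp
      qed simp
      then have qc: "quad r q (\<lambda>i. poly (c i) t) = 0" for t using G[of t] by simp
      have h_node: "h 0 (real k) i = (\<Prod>l\<in>{..<r} - {k}. real k - real l) * w k i" if "k < r" for k i
      proof -
        have "(\<Prod>l\<in>{..<r} - {m}. real k - real l) = 0" if "m \<noteq> k" for m
          using that \<open>k < r\<close> by (auto intro!: prod_zero)
        then have "(\<Sum>m<r. w m i * (\<Prod>l\<in>{..<r} - {m}. real k - real l)) =
            (\<Sum>m<r. if m = k then w k i * (\<Prod>l\<in>{..<r} - {k}. real k - real l) else 0)"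
          by (intro sum.cong) auto
        moreover have "(\<Prod>m<r. real k - real m) = 0" using that by (auto intro!: prod_zero)
        ultimately show ?thesis using that by (simp add: h_def)
      qed
      \<comment> \<open>The rational normal curve passes through \<open>w k\<close>, up to a factor, at the parameter \<open>k\<close>.\<close>
      have qw: "quad (Suc r) q (w k) = 0" if "k < r" for k
      proof -
        have "0 = quad (Suc r) q (\<lambda>i. (\<Prod>l\<in>{..<r} - {k}. real k - real l) * w k i)"
          using qh[rule_format, of "real k"] h_node[OF that] by (simp add: quad_def)
        also have "\<dots> = (\<Prod>l\<in>{..<r} - {k}. real k - real l)\<^sup>2 * quad (Suc r) q (w k)"
          by (rule quad_scale)
        finally show ?thesis by simp
      qed
      have qz: "quad r q (z k) = 0" if "k < s + (r - 1)" for k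
      proof (cases "k < r - 1")
        case True
        have "quad r q (z k) = quad r q (w k)" using True by (intro quad_cong) (simp add: w_def)
        also have "\<dots> = quad (Suc r) q (w k)" using True by (simp add: Suc_r) (simp add: w_def)
        finally show ?thesis using qw[of k] True by simp
      next
        case False
        then have "quad r q (z k) = quad r q (Z (k - (r - 1)))" by (intro quad_cong) (simp add: Z_def)
        also have "\<dots> = quad (Suc r) q (Z (k - (r - 1)))" by (simp add: Suc_r) (simp add: Z_def)
        finally show ?thesis using qZ that False by simp
      qed
      have small: "q a b = 0" if "a < r" "b < r" for a b
        by (rule off_quadricsD[OF off sym[rule_format] _ that])
           (use qc qz Ball_curve_and_points[of c z "s + (r - 1)" "\<lambda>x. quad r q x = 0"] in blast)
      have quad_r: "quad r q x = 0" for x by (simp add: quad_def small)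
      have qrr: "q r r = 0"
        using qw[of "r - 1"] r by (simp add: Suc_r quad_r) (simp add: w_def)
      define L where "L x = (\<Sum>i<r. q i r * x i)" for x
      define Lp where "Lp = smult (L (\<lambda>i. poly (c i) 0)) (\<Prod>k<r. [:- real k, 1:]) +
          (\<Sum>k<r. smult (L (w k)) (\<Prod>l\<in>{..<r} - {k}. [:- real l, 1:]))"
      have Lp: "poly Lp u = L (h 0 u)" for u
      proof -
        have "L (h 0 u) = (\<Sum>i<r. q i r * poly (c i) 0) * (\<Prod>k<r. u - real k) +
            (\<Sum>i<r. \<Sum>k<r. q i r * (w k i * (\<Prod>l\<in>{..<r} - {k}. u - real l)))"
          by (simp add: L_def h_def c'_def distrib_left sum.distrib sum_distrib_left sum_distrib_right mult.assoc)
        also have "(\<Sum>i<r. \<Sum>k<r. q i r * (w k i * (\<Prod>l\<in>{..<r} - {k}. u - real l))) =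
            (\<Sum>k<r. L (w k) * (\<Prod>l\<in>{..<r} - {k}. u - real l))"
          by (subst sum.swap) (simp add: L_def sum_distrib_right mult.assoc)
        finally show ?thesis by (simp add: Lp_def L_def poly_sum poly_prod)
      qed
      have "Lp = 0"
      proof (rule poly_eq_0_outside_finite)
        fix u assume u: "u \<notin> real ` {..<r}"
        have "h 0 u r = (\<Sum>k<r. if k = r - 1 then \<Prod>l\<in>{..<r} - {k}. u - real l else 0)"
        proof -
          have "(\<Sum>k<r. w k r * (\<Prod>l\<in>{..<r} - {k}. u - real l)) =
              (\<Sum>k<r. if k = r - 1 then \<Prod>l\<in>{..<r} - {k}. u - real l else 0)"
            by (intro sum.cong) (auto simp: w_def)
          then show ?thesis unfolding h_def by (simp only: c'_def) simp
        qed
        also have "\<dots> = (\<Prod>l\<in>{..<r} - {r - 1}. u - real l)" using r by simp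
        also have "\<dots> \<noteq> 0" using u by auto
        finally have "h 0 u r \<noteq> 0" .
        moreover have "2 * h 0 u r * L (h 0 u) = 0"
          using qh[rule_format, of u] by (simp add: Suc_r quad_r qrr L_def)
        ultimately show "poly Lp u = 0" by (simp add: Lp)
      qed simp
      have Lw: "L (w k) = 0" if "k < r" for k
      proof -
        have "0 = L (h 0 (real k))" using \<open>Lp = 0\<close> Lp by (metis poly_0)
        also have "\<dots> = (\<Prod>l\<in>{..<r} - {k}. real k - real l) * L (w k)"
          unfolding L_def h_node[OF that] sum_distrib_left by (intro sum.cong) auto
        finally show ?thesis by simp
      qed
      have "L (\<lambda>i. poly (c i) 0) = 0"
      proof -
        have "0 = poly Lp (real r)" using \<open>Lp = 0\<close> by simp
        also have "\<dots> = L (\<lambda>i. poly (c i) 0) * (\<Prod>k<r. real r - real k)"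
          by (simp add: Lp_def Lw poly_prod)
        finally show ?thesis by simp
      qed
      moreover have "L (z k) = 0" if "Suc k < r" for k
      proof -
        have "L (z k) = L (w k)" using that unfolding L_def by (intro sum.cong) (auto simp: w_def)
        then show ?thesis using Lw[of k] that by simp
      qed
      ultimately have "(\<Sum>i<r. points_and_start c z b i * q i r) = 0" if "b < r" for b
        using that by (cases b) (simp_all add: L_def mult.commute)
      then have "q i r = 0" if "i < r" for i
        using injective_systemD[OF inj, of "\<lambda>i. q i r"] that by simp
      then show "q i j = 0" using ij small qrr sym by (metis less_SucE)
    qed
  qed
  then have "finite (insert 0 {e. \<not> off_quadrics (Suc r) (v e ` B)})" by simp
  from ex_new_if_finite[OF infinite_UNIV_char_0 this]
  obtain e where e: "e \<noteq> 0" and off': "off_quadrics (Suc r) (v e ` B)" by auto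
  have "off_quadrics (Suc r) (curve_and_points (C e) Z ` (UNIV <+> {..<s}))"
    unfolding off_quadrics_def Ball_curve_and_points
  proof (intro allI impI, elim conjE)
    fix q :: "nat \<Rightarrow> nat \<Rightarrow> real" and i j
    assume sym: "\<forall>i j. q i j = q j i" and ij: "i < Suc r" "j < Suc r"
      and q: "\<forall>t. quad (Suc r) q (\<lambda>i. poly (C e i) t) = 0" "\<forall>k<s. quad (Suc r) q (Z k) = 0"
    have "quad (Suc r) q (h e u) = 0" for u
    proof -
      have "0 = quad (Suc r) q (\<lambda>i. e ^ r * h e u i)" using q(1)[rule_format, of "e * u"] by (simp add: Ch)
      also have "\<dots> = (e ^ r)\<^sup>2 * quad (Suc r) q (h e u)" by (rule quad_scale)
      finally show ?thesis using e by simp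
    qed
    with q have "\<forall>x\<in>v e ` B. quad (Suc r) q x = 0" unfolding ball by blast
    then show "q i j = 0" using off' sym ij unfolding off_quadrics_def by blast
  qed
  moreover have "degree (C e i) \<le> d + r" if "i < Suc r" for i
  proof -
    have lin: "degree (\<Prod>l\<in>S. [:- (e * real l), 1:]) \<le> card S" if "finite S" for S
      using degree_prod_sum_le[OF that, of "\<lambda>l. [:- (e * real l), 1:]"] by simp
    have "degree (c' i) \<le> d" by (simp add: c'_def deg)
    then have "degree (c' i * (\<Prod>k<r. [:- (e * real k), 1:])) \<le> d + r"
      using lin[of "{..<r}"] by (intro order_trans[OF degree_mult_le]) (simp add: add_mono)
    moreover have "degree (smult e (\<Sum>k<r. smult (w k i) (\<Prod>l\<in>{..<r} - {k}. [:- (e * real l), 1:]))) \<le> d + r"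
    proof (intro order_trans[OF degree_smult_le] degree_sum_le)
      fix k assume "k \<in> {..<r}"
      have "card ({..<r} - {k}) \<le> d + r" using card_mono[of "{..<r}" "{..<r} - {k}"] by simp
      then show "degree (\<Prod>l\<in>{..<r} - {k}. [:- (e * real l), 1:]) \<le> d + r"
        using lin[of "{..<r} - {k}"] by simp
    qed simp
    ultimately show ?thesis unfolding C_def by (rule degree_add_le)
  qed
  ultimately show thesis using that by blast
qed

text \<open>Passing from \<open>r\<close> to \<open>r + 1\<close> coordinates costs the degree \<open>r\<close> and \<open>r - 1\<close> points. Both sides of the
  inequality then grow by \<open>r + 1\<close>, so nothing is lost on the way.\<close>

theorem ex_rational_curve_off_quadrics:
  assumes "r \<ge> 1" "(r + 1) choose 2 \<le> 2 * d + 1 + s"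
  shows "\<exists>c z. (\<forall>i<r. degree (c i) \<le> d) \<and> off_quadrics r (curve_and_points c z ` (UNIV <+> {..<s}))"
  using assms
proof (induction r arbitrary: d s rule: dec_induct)
  case base
  have "off_quadrics 1 (curve_and_points (\<lambda>_. 1) z ` (UNIV <+> {..<s}))" for z
    unfolding off_quadrics_def Ball_curve_and_points by (simp add: quad_def)
  then show ?case by (metis degree_1 le0)
next
  case (step r)
  show ?case
  proof (cases "d < Suc r")
    case True
    then show ?thesis using off_quadrics_rational_normal[OF True] step.prems by metis
  next
    case False
    have "((Suc r + 1) choose 2) = ((r + 1) choose 2) + (r + 1)" by (simp add: numeral_2_eq_2)
    then have "(r + 1) choose 2 \<le> 2 * (d - r) + 1 + (s + (r - 1))"
      using step.prems step.hyps False by linarith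
    from step.IH[OF this] obtain c0 z0 where c0: "\<And>i. i < r \<Longrightarrow> degree (c0 i) \<le> d - r"
      "off_quadrics r (curve_and_points c0 z0 ` (UNIV <+> {..<s + (r - 1)}))" by blast
    obtain c z where cz: "\<And>i. i < r \<Longrightarrow> degree (c i) \<le> d - r"
      "off_quadrics r (curve_and_points c z ` (UNIV <+> {..<s + (r - 1)}))"
      "injective_system {..<r} {..<r} (points_and_start c z)"
      using off_quadrics_general_position[OF c0(2,1)] by blast
    obtain C Z where CZ: "\<And>i. i < Suc r \<Longrightarrow> degree (C i) \<le> d - r + r"
      "off_quadrics (Suc r) (curve_and_points C Z ` (UNIV <+> {..<s}))"
      using off_quadrics_attach_rational_normal[OF step.hyps(1) cz] by blast
    then show ?thesis using False by (metis le_add_diff_inverse2 less_or_eq_imp_le not_less_eq linorder_not_less)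
  qed
qed

section \<open>Invariance of domain in coordinates\<close>

lemma norm_poly_mapping_eq_sum:
  assumes "finite K" "Poly_Mapping.keys x \<subseteq> K"
  shows "norm (x :: 'a \<Rightarrow>\<^sub>0 real) = (\<Sum>k\<in>K. \<bar>Poly_Mapping.lookup x k\<bar>)"
  unfolding norm_poly_mapping_def dist_poly_mapping_def
  using assms by (intro sum.mono_neutral_cong_left) (auto simp: in_keys_iff)

lemma abs_lookup_le_norm: "\<bar>Poly_Mapping.lookup x k\<bar> \<le> norm (x :: 'a \<Rightarrow>\<^sub>0 real)"
proof (cases "k \<in> Poly_Mapping.keys x")
  case True
  then show ?thesis
    by (subst norm_poly_mapping_eq_sum[OF finite_keys order_refl]) (rule member_le_sum, auto)
qed (simp add: in_keys_iff)

lemma bounded_linear_lookup: "bounded_linear (\<lambda>x :: 'a \<Rightarrow>\<^sub>0 real. Poly_Mapping.lookup x k)"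
  by (rule bounded_linear_intro[where K = 1]) (simp_all add: lookup_add scaleR_lookup abs_lookup_le_norm)

lemma continuous_on_lookup [continuous_intros]:
  "continuous_on S f \<Longrightarrow> continuous_on S (\<lambda>x. Poly_Mapping.lookup (f x :: 'a \<Rightarrow>\<^sub>0 real) k)"
  by (rule bounded_linear.continuous_on[OF bounded_linear_lookup])

lemma tendsto_lookup [tendsto_intros]:
  "(f \<longlongrightarrow> l) F \<Longrightarrow> ((\<lambda>x. Poly_Mapping.lookup (f x :: 'a \<Rightarrow>\<^sub>0 real) k) \<longlongrightarrow> Poly_Mapping.lookup l k) F"
  by (rule bounded_linear.tendsto[OF bounded_linear_lookup])

lemma scaleR_single: "c *\<^sub>R Poly_Mapping.single k (t :: real) = Poly_Mapping.single k (c * t)"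
  by (rule poly_mapping_eqI) (simp add: scaleR_lookup lookup_single when_def)

lemma poly_mapping_sum_single:
  assumes "finite K" "Poly_Mapping.keys x \<subseteq> K"
  shows "(\<Sum>k\<in>K. Poly_Mapping.single k (Poly_Mapping.lookup x k)) = (x :: 'a \<Rightarrow>\<^sub>0 real)"
  using assms by (intro poly_mapping_eqI) (auto simp: lookup_sum lookup_single when_def in_keys_iff)

lemma continuous_on_single [continuous_intros]:
  assumes "continuous_on S f"
  shows "continuous_on S (\<lambda>x. Poly_Mapping.single k (f x :: real))"
proof -
  have "continuous_on S (\<lambda>x. f x *\<^sub>R Poly_Mapping.single k (1::real))" by (intro continuous_intros assms)
  then show ?thesis unfolding scaleR_single by simp
qed

lemma continuous_on_poly_mapping:
  fixes f :: "'s::topological_space \<Rightarrow> 'a \<Rightarrow>\<^sub>0 real"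
  assumes K: "finite K" "\<And>x. x \<in> S \<Longrightarrow> Poly_Mapping.keys (f x) \<subseteq> K"
    and "\<And>k. k \<in> K \<Longrightarrow> continuous_on S (\<lambda>x. Poly_Mapping.lookup (f x) k)"
  shows "continuous_on S f"
proof -
  have "continuous_on S (\<lambda>x. \<Sum>k\<in>K. Poly_Mapping.single k (Poly_Mapping.lookup (f x) k))"
    by (intro continuous_intros assms(3))
  moreover have "continuous_on S (\<lambda>x. \<Sum>k\<in>K. Poly_Mapping.single k (Poly_Mapping.lookup (f x) k)) = continuous_on S f"
    by (rule continuous_on_cong[OF refl]) (simp add: poly_mapping_sum_single K)
  ultimately show ?thesis by simp
qed

lemma Euclidean_space_eq_top_of_set: "Euclidean_space n = top_of_set {x. \<forall>i\<ge>n. x i = 0}"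
  by (simp add: Euclidean_space_def euclidean_product_topology)

text \<open>Invariance of domain for finitely supported functions, in the form of a solvability statement:
  as many continuous functions as there are coordinates, if jointly injective, can take all
  values close to the values at \<open>p\<close>. It serves as inverse function theorem.\<close>

lemma coordinate_invariance_of_domain:
  fixes g :: "('a \<Rightarrow>\<^sub>0 real) \<Rightarrow> 'b \<Rightarrow> real"
  assumes fin: "finite K" "finite K'" and card: "card K = card K'"
    and S: "openin (top_of_set {x. Poly_Mapping.keys x \<subseteq> K}) S"
    and cont: "\<And>b. b \<in> K' \<Longrightarrow> continuous_on S (\<lambda>x. g x b)"
    and inj: "\<And>x y. x \<in> S \<Longrightarrow> y \<in> S \<Longrightarrow> (\<And>b. b \<in> K' \<Longrightarrow> g x b = g y b) \<Longrightarrow> x = y"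
    and p: "p \<in> S"
  obtains e where "e > 0" "\<And>y. (\<And>b. b \<in> K' \<Longrightarrow> \<bar>y b - g p b\<bar> < e) \<Longrightarrow> \<exists>x\<in>S. \<forall>b\<in>K'. g x b = y b"
proof -
  define n where "n = card K"
  obtain \<alpha> where \<alpha>: "bij_betw \<alpha> {..<n} K"
    using ex_bij_betw_nat_finite[OF fin(1)] by (auto simp: n_def atLeast0LessThan)
  obtain \<beta> where \<beta>: "bij_betw \<beta> {..<n} K'"
    using ex_bij_betw_nat_finite[OF fin(2)] by (auto simp: n_def card atLeast0LessThan)
  define E :: "(nat \<Rightarrow> real) set" where "E = {x. \<forall>i\<ge>n. x i = 0}"
  define \<iota> where "\<iota> v = (\<Sum>i<n. Poly_Mapping.single (\<alpha> i) (v i :: real))" for v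
  have lookup_\<iota>: "Poly_Mapping.lookup (\<iota> v) (\<alpha> i) = v i" if "i < n" for v i
  proof -
    have "Poly_Mapping.lookup (\<iota> v) (\<alpha> i) = (\<Sum>j<n. if j = i then v j else 0)"
      unfolding \<iota>_def lookup_sum using \<alpha> that
      by (intro sum.cong) (auto simp: lookup_single when_def bij_betw_def inj_on_def)
    then show ?thesis using that by simp
  qed
  have keys_\<iota>: "Poly_Mapping.keys (\<iota> v) \<subseteq> K" for v
    unfolding \<iota>_def using \<alpha> by (intro order_trans[OF keys_sum]) (auto simp: bij_betw_def split: if_splits)
  have cont_coord: "continuous_on A (\<lambda>v :: nat \<Rightarrow> real. v i)" for A i
    by (rule continuous_on_product_coordinates[THEN continuous_on_subset]) simp
  have cont_\<iota>: "continuous_on A \<iota>" for A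
    unfolding \<iota>_def by (intro continuous_intros cont_coord)
  define U where "U = E \<inter> \<iota> -` S"
  define h where "h v i = (if i < n then g (\<iota> v) (\<beta> i) else 0)" for v i
  have U: "openin (top_of_set E) U"
    unfolding U_def using S keys_\<iota> by (intro continuous_openin_preimage[OF cont_\<iota>]) auto
  have "openin (Euclidean_space n) (h ` U)"
  proof (rule invariance_of_domain_Euclidean_space)
    show "openin (Euclidean_space n) U" using U by (simp add: E_def Euclidean_space_eq_top_of_set)
    have "continuous_on U (\<lambda>v. h v i)" for i
    proof (cases "i < n")
      case True
      then have "\<beta> i \<in> K'" using \<beta> by (auto simp: bij_betw_def)
      then have "continuous_on U (\<lambda>v. g (\<iota> v) (\<beta> i))"
        by (intro continuous_on_compose2[OF cont cont_\<iota>]) (auto simp: U_def)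
      then show ?thesis using True by (simp add: h_def)
    qed (simp add: h_def)
    then have "continuous_on U h" by (rule continuous_on_coordinatewise_then_product)
    moreover have "h ` U \<subseteq> E" by (auto simp: h_def E_def)
    moreover have "U \<subseteq> E" by (auto simp: U_def)
    ultimately show "continuous_map (subtopology (Euclidean_space n) U) (Euclidean_space n) h"
      by (simp add: Euclidean_space_eq_top_of_set E_def[symmetric] subtopology_subtopology Int_absorb1 image_subset_iff_funcset[symmetric])
    show "inj_on h U"
    proof (rule inj_onI)
      fix v w assume vw: "v \<in> U" "w \<in> U" and "h v = h w"
      then have eq: "g (\<iota> v) (\<beta> i) = g (\<iota> w) (\<beta> i)" if "i < n" for i
        using that by (auto simp: h_def fun_eq_iff split: if_splits)
      have "\<iota> v = \<iota> w"
      proof (rule inj)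
        show "g (\<iota> v) b = g (\<iota> w) b" if "b \<in> K'" for b
          using eq that \<beta> by (auto simp: bij_betw_def)
      qed (use vw in \<open>auto simp: U_def\<close>)
      then have "v i = w i" if "i < n" for i using lookup_\<iota>[OF that] by metis
      moreover have "v i = w i" if "\<not> i < n" for i using that vw by (auto simp: U_def E_def)
      ultimately show "v = w" by blast
    qed
  qed
  then obtain T where T: "open T" "h ` U = E \<inter> T"
    by (auto simp: Euclidean_space_eq_top_of_set E_def[symmetric] openin_open)
  define p0 where "p0 i = (if i < n then Poly_Mapping.lookup p (\<alpha> i) else 0)" for i
  have "\<iota> p0 = p"
  proof (rule poly_mapping_eqI)
    fix k
    show "Poly_Mapping.lookup (\<iota> p0) k = Poly_Mapping.lookup p k"
    proof (cases "k \<in> K")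
      case True
      then obtain i where "i < n" "k = \<alpha> i" using \<alpha> by (auto simp: bij_betw_def)
      then show ?thesis by (simp add: lookup_\<iota> p0_def)
    next
      case False
      moreover have "Poly_Mapping.keys p \<subseteq> K" using S p openin_imp_subset by blast
      ultimately show ?thesis using keys_\<iota>[of p0] by (metis in_keys_iff subsetD)
    qed
  qed
  then have "p0 \<in> U" using p by (simp add: U_def E_def p0_def)
  then have "h p0 \<in> T" using T by blast
  have "openin (powertop_real UNIV) T" using T by (simp add: euclidean_product_topology)
  from product_topology_open_contains_basis[OF this \<open>h p0 \<in> T\<close>]
  obtain X where "h p0 \<in> PiE UNIV X \<and> (\<forall>i. openin euclideanreal (X i)) \<and>
      finite {i. X i \<noteq> topspace euclideanreal} \<and> PiE UNIV X \<subseteq> T" by (rule exE)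
  then have X: "h p0 \<in> PiE UNIV X" "\<And>i. openin euclideanreal (X i)" "PiE UNIV X \<subseteq> T"
    by (elim conjE, simp_all only:)+
  have "\<exists>e. \<forall>i. e i > 0 \<and> (\<forall>y. \<bar>y - h p0 i\<bar> < e i \<longrightarrow> y \<in> X i)"
  proof (rule choice, rule allI)
    fix i
    have "open (X i)" using X(2)[of i] by simp
    moreover have "h p0 i \<in> X i" using X(1) by (simp add: PiE_iff)
    ultimately
    show "\<exists>e>0. \<forall>y. \<bar>y - h p0 i\<bar> < e \<longrightarrow> y \<in> X i"
      unfolding open_dist dist_real_def by blast
  qed
  then obtain e where e: "\<And>i. e i > 0" "\<And>i y. \<bar>y - h p0 i\<bar> < e i \<Longrightarrow> y \<in> X i" by blast
  define e0 where "e0 = Min (insert 1 (e ` {..<n}))"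
  show thesis
  proof (rule that)
    show "e0 > 0" unfolding e0_def using e by (subst Min_gr_iff) auto
    fix y assume y: "\<And>b. b \<in> K' \<Longrightarrow> \<bar>y b - g p b\<bar> < e0"
    define y0 where "y0 i = (if i < n then y (\<beta> i) else 0)" for i
    have "\<bar>y0 i - h p0 i\<bar> < e i" for i
    proof (cases "i < n")
      case True
      then have "\<beta> i \<in> K'" using \<beta> by (auto simp: bij_betw_def)
      moreover have "e0 \<le> e i" unfolding e0_def using True by (intro Min_le) auto
      ultimately show ?thesis using y[of "\<beta> i"] True \<open>\<iota> p0 = p\<close> by (simp add: y0_def h_def)
    qed (use e in \<open>simp add: y0_def h_def\<close>)
    then have "y0 \<in> PiE UNIV X" using e(2) by auto
    moreover have "y0 \<in> E" by (simp add: y0_def E_def)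
    ultimately have "y0 \<in> h ` U" using X T by blast
    then obtain v where v: "v \<in> U" "y0 = h v" by blast
    then have "g (\<iota> v) (\<beta> i) = y (\<beta> i)" if "i < n" for i
      using that by (metis h_def y0_def)
    then show "\<exists>x\<in>S. \<forall>b\<in>K'. g x b = y b" using v(1) \<beta> by (intro bexI[of _ "\<iota> v"]) (auto simp: U_def bij_betw_def)
  qed
qed

text \<open>If there were too few functions, they could be completed by zero functions to the right
  number, contradicting invariance of domain.\<close>

lemma coordinate_invariance_of_dimension:
  fixes g :: "('a \<Rightarrow>\<^sub>0 real) \<Rightarrow> 'b \<Rightarrow> real"
  assumes fin: "finite K" "finite K'"
    and S: "openin (top_of_set {x. Poly_Mapping.keys x \<subseteq> K}) S"
    and cont: "\<And>b. b \<in> K' \<Longrightarrow> continuous_on S (\<lambda>x. g x b)"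
    and inj: "\<And>x y. x \<in> S \<Longrightarrow> y \<in> S \<Longrightarrow> (\<And>b. b \<in> K' \<Longrightarrow> g x b = g y b) \<Longrightarrow> x = y"
    and p: "p \<in> S"
  shows "card K \<le> card K'"
proof (rule ccontr)
  assume less: "\<not> card K \<le> card K'"
  \<comment> \<open>The indices \<open>Inr i\<close> stand for additional functions that are identically zero.\<close>
  define L where "L = K' <+> {..<card K - card K'}"
  define g' where "g' x = case_sum (g x) (\<lambda>_ :: nat. 0)" for x
  have L: "finite L" "card K = card L" using fin less by (simp_all add: L_def card_Plus)
  have cont': "continuous_on S (\<lambda>x. g' x b)" if "b \<in> L" for b
    using that cont by (auto simp: L_def g'_def)
  have inj': "x = y" if "x \<in> S" "y \<in> S" "\<And>b. b \<in> L \<Longrightarrow> g' x b = g' y b" for x y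
    using that(3)[of "Inl _"] by (intro inj that) (auto simp: L_def g'_def)
  obtain e where e: "e > 0" "\<And>y. (\<And>b. b \<in> L \<Longrightarrow> \<bar>y b - g' p b\<bar> < e) \<Longrightarrow> \<exists>x\<in>S. \<forall>b\<in>L. g' x b = y b"
    using coordinate_invariance_of_domain[where g = g', OF fin(1) L S cont' inj' p] by blast
  have "\<exists>x\<in>S. \<forall>b\<in>L. g' x b = case_sum (g p) (\<lambda>_. e / 2) b"
    by (rule e(2)) (use e(1) in \<open>auto simp: g'_def split: sum.split\<close>)
  then obtain x where "\<forall>b\<in>L. g' x b = case_sum (g p) (\<lambda>_. e / 2) b" by blast
  moreover have "Inr 0 \<in> L" using less by (auto simp: L_def)
  ultimately have "g' x (Inr (0::nat)) = case_sum (g p) (\<lambda>_. e / 2) (Inr (0::nat))" by blast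
  then show False using e(1) by (simp add: g'_def)
qed

section \<open>Elimination of symmetric matrices\<close>

definition nonneg_form :: "'a set \<Rightarrow> ('a \<Rightarrow> 'a \<Rightarrow> real) \<Rightarrow> bool" where
  "nonneg_form X A \<longleftrightarrow> (\<forall>m n. A m n = A n m) \<and> (\<forall>x. 0 \<le> (\<Sum>m\<in>X. \<Sum>n\<in>X. A m n * x m * x n))"

text \<open>Evaluate the form at \<open>s x + t e\<^sub>a\<close> and choose \<open>s\<close>, \<open>t\<close>.\<close>

lemma nonneg_form_Cauchy_Schwarz:
  assumes X: "finite X" and A: "nonneg_form X A" and a: "a \<in> X"
  shows "0 \<le> A a a" "(\<Sum>n\<in>X. A a n * x n)\<^sup>2 \<le> A a a * (\<Sum>m\<in>X. \<Sum>n\<in>X. A m n * x m * x n)"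
proof -
  define b where "b = (\<Sum>n\<in>X. A a n * x n)"
  define c where "c = (\<Sum>m\<in>X. \<Sum>n\<in>X. A m n * x m * x n)"
  have sym: "A m n = A n m" for m n using A by (simp add: nonneg_form_def)
  have expand: "0 \<le> c * s\<^sup>2 + 2 * (s * t * b) + t\<^sup>2 * A a a" for s t
  proof -
    define y where "y n = s * x n + (if n = a then t else 0)" for n
    have row: "(\<Sum>n\<in>X. A m n * y m * y n) = s * y m * (\<Sum>n\<in>X. A m n * x n) + t * y m * A a m" for m
    proof -
      have "(\<Sum>n\<in>X. A m n * y m * y n) = (\<Sum>n\<in>X. s * y m * (A m n * x n) + (if n = a then t * y m * A a m else 0))"
        by (intro sum.cong) (auto simp: y_def algebra_simps sym[of m a])
      then show ?thesis using X a by (simp add: sum.distrib sum_distrib_left)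
    qed
    have "(\<Sum>m\<in>X. \<Sum>n\<in>X. A m n * y m * y n) =
        (\<Sum>m\<in>X. (s\<^sup>2 * (x m * (\<Sum>n\<in>X. A m n * x n)) + s * t * (A a m * x m)) +
          (if m = a then s * t * b + t\<^sup>2 * A a a else 0))"
      unfolding row by (intro sum.cong) (auto simp: y_def b_def power2_eq_square algebra_simps)
    also have "\<dots> = s\<^sup>2 * (\<Sum>m\<in>X. x m * (\<Sum>n\<in>X. A m n * x n)) + s * t * b + (s * t * b + t\<^sup>2 * A a a)"
      using X a by (simp add: sum.distrib sum_distrib_left[symmetric] b_def)
    also have "(\<Sum>m\<in>X. x m * (\<Sum>n\<in>X. A m n * x n)) = c"
      by (simp add: c_def sum_distrib_left mult_ac)
    finally have "(\<Sum>m\<in>X. \<Sum>n\<in>X. A m n * y m * y n) = c * s\<^sup>2 + 2 * (s * t * b) + t\<^sup>2 * A a a" by simp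
    moreover have "0 \<le> (\<Sum>m\<in>X. \<Sum>n\<in>X. A m n * y m * y n)" using A unfolding nonneg_form_def by blast
    ultimately show ?thesis by simp
  qed
  show "0 \<le> A a a" using expand[of 0 1] by simp
  show "b\<^sup>2 \<le> A a a * c"
  proof (cases "A a a = 0")
    case True
    have "b = 0"
    proof (rule ccontr)
      assume "b \<noteq> 0"
      then show False using expand[of 1 "- (c + 1) / (2 * b)"] True by (simp add: field_simps)
    qed
    then show ?thesis by (simp add: True)
  next
    case False
    then have "A a a > 0" using \<open>0 \<le> A a a\<close> by simp
    moreover have "0 \<le> A a a * (A a a * c - b\<^sup>2)"
      using expand[of "A a a" "- b"] by (simp add: power2_eq_square algebra_simps)
    ultimately show ?thesis by (simp add: zero_le_mult_iff)
  qed
qed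

text \<open>The iterated Schur complement of \<open>A\<close> with the pivots \<open>M 0, M 1, \<dots>\<close>, multiplied by the pivots
  instead of divided. This keeps the entries polynomial in the entries of \<open>A\<close>, which is needed for a
  semialgebraic description of the matrices of given rank.\<close>

primrec schur :: "(nat \<Rightarrow> 'a) \<Rightarrow> ('a \<Rightarrow> 'a \<Rightarrow> real) \<Rightarrow> nat \<Rightarrow> 'a \<Rightarrow> 'a \<Rightarrow> real" where
  "schur M A 0 = A"
| "schur M A (Suc j) = (\<lambda>m n. schur M A j (M j) (M j) * schur M A j m n - schur M A j m (M j) * schur M A j (M j) n)"

lemma schur_sym: "(\<And>m n. A m n = A n m) \<Longrightarrow> schur M A j m n = schur M A j n m"
  by (induction j arbitrary: m n) (simp_all add: mult.commute)

lemma schur_cong: "(\<And>i. i < j \<Longrightarrow> M i = M' i) \<Longrightarrow> schur M A j = schur M' A j"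
  by (induction j) simp_all

lemma schur_pivot_row: "i < j \<Longrightarrow> schur M A j (M i) n = 0"
proof (induction j arbitrary: n)
  case (Suc j)
  then show ?case by (cases "i = j") auto
qed simp

lemma schur_support: "(\<And>n. A m n = 0) \<Longrightarrow> schur M A j m n = 0"
  by (induction j arbitrary: n) simp_all

text \<open>That the Schur complement of a positive semidefinite form is again positive semidefinite is the
  Cauchy-Schwarz inequality for the pivot.\<close>

lemma nonneg_form_schur:
  assumes X: "finite X" and A: "nonneg_form X A" and M: "\<And>i. i < j \<Longrightarrow> M i \<in> X"
  shows "nonneg_form X (schur M A j)"
  using M
proof (induction j)
  case (Suc j)
  then have S: "nonneg_form X (schur M A j)" by simp
  have sym: "schur M A k m n = schur M A k n m" for k m n
    using A schur_sym[of A] by (auto simp: nonneg_form_def)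
  have "0 \<le> (\<Sum>m\<in>X. \<Sum>n\<in>X. schur M A (Suc j) m n * x m * x n)" for x
  proof -
    let ?S = "schur M A j" let ?a = "M j"
    have "(\<Sum>m\<in>X. \<Sum>n\<in>X. schur M A (Suc j) m n * x m * x n) =
        (\<Sum>m\<in>X. \<Sum>n\<in>X. ?S ?a ?a * (?S m n * x m * x n)) - (\<Sum>m\<in>X. \<Sum>n\<in>X. (?S ?a m * x m) * (?S ?a n * x n))"
      unfolding sum_subtractf[symmetric]
    proof (intro sum.cong refl)
      fix m n
      show "schur M A (Suc j) m n * x m * x n =
          ?S ?a ?a * (?S m n * x m * x n) - (?S ?a m * x m) * (?S ?a n * x n)"
        by (simp add: sym[of j m ?a] algebra_simps)
    qed
    also have "\<dots> = ?S ?a ?a * (\<Sum>m\<in>X. \<Sum>n\<in>X. ?S m n * x m * x n) - (\<Sum>n\<in>X. ?S ?a n * x n)\<^sup>2"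
      by (simp add: sum_distrib_left[symmetric] sum_distrib_right[symmetric] power2_eq_square)
    finally show ?thesis using nonneg_form_Cauchy_Schwarz(2)[OF X S, of ?a x] Suc.prems by simp
  qed
  then show ?case unfolding nonneg_form_def using sym by blast
qed (simp add: A)

text \<open>As long as the Schur complement is nonzero it has a positive diagonal entry, which serves as
  next pivot; afterwards its row is zero, so it is never chosen again.\<close>

lemma ex_complete_pivots:
  assumes X: "finite X" and A: "nonneg_form X A" and supp: "\<And>m n. m \<notin> X \<Longrightarrow> A m n = 0"
    and M: "\<And>j. j < s \<Longrightarrow> M j \<in> X" "\<And>j. j < s \<Longrightarrow> schur M A j (M j) (M j) > 0"
  shows "\<exists>M' r. s \<le> r \<and> (\<forall>j<s. M' j = M j) \<and> (\<forall>j<r. M' j \<in> X \<and> schur M' A j (M' j) (M' j) > 0) \<and>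
    (\<forall>m n. schur M' A r m n = 0)"
  using M
proof (induction "card (X - M ` {..<s})" arbitrary: s M rule: less_induct)
  case less
  show ?case
  proof (cases "\<forall>m n. schur M A s m n = 0")
    case True
    then show ?thesis using less.prems by (intro exI[of _ M] exI[of _ s]) auto
  next
    case False
    have S: "nonneg_form X (schur M A s)" using nonneg_form_schur[OF X A] less.prems(1) by blast
    have sym: "schur M A k m n = schur M A k n m" for k m n
      using A schur_sym[of A] by (auto simp: nonneg_form_def)
    obtain m n where mn: "schur M A s m n \<noteq> 0" using False by blast
    have "m \<in> X" using mn schur_support[of A m M s n] supp by blast
    moreover have "n \<in> X" using mn sym[of s m n] schur_support[of A n M s m] supp by metis
    ultimately have "schur M A s m m \<noteq> 0"
      using mn nonneg_form_Cauchy_Schwarz(2)[OF X S, of m "\<lambda>k. if k = n then 1 else 0"] X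
      by (auto simp: if_distrib[of "\<lambda>z. _ * z"] cong: if_cong)
    then have pos: "schur M A s m m > 0"
      using nonneg_form_Cauchy_Schwarz(1)[OF X S \<open>m \<in> X\<close>] by simp
    have new: "m \<notin> M ` {..<s}"
      using schur_pivot_row[of _ s M A m] pos by auto
    define M1 where "M1 = M(s := m)"
    have img: "M1 ` {..<Suc s} = insert m (M ` {..<s})" by (auto simp: M1_def lessThan_Suc)
    have cong: "schur M1 A j = schur M A j" if "j \<le> s" for j
      using that by (intro schur_cong) (simp add: M1_def)
    have "card (X - M1 ` {..<Suc s}) < card (X - M ` {..<s})"
      using X new \<open>m \<in> X\<close> unfolding img by (intro psubset_card_mono) auto
    moreover have "M1 j \<in> X" "schur M1 A j (M1 j) (M1 j) > 0" if "j < Suc s" for j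
      using that less.prems pos \<open>m \<in> X\<close> cong[of j] by (auto simp: M1_def less_Suc_eq)
    ultimately obtain M' r where M': "Suc s \<le> r" "\<forall>j<Suc s. M' j = M1 j"
      "\<forall>j<r. M' j \<in> X \<and> schur M' A j (M' j) (M' j) > 0" "\<forall>m n. schur M' A r m n = 0"
      using less.hyps[of M1 "Suc s"] by blast
    have "\<forall>j<s. M' j = M j" using M'(2) by (simp add: M1_def)
    then show ?thesis using M' Suc_leD by blast
  qed
qed

text \<open>The factor by which \<open>schur M A j\<close> differs from the true Schur complement.\<close>

primrec pivot_product :: "(nat \<Rightarrow> 'a) \<Rightarrow> ('a \<Rightarrow> 'a \<Rightarrow> real) \<Rightarrow> nat \<Rightarrow> real" where
  "pivot_product M A 0 = 1"
| "pivot_product M A (Suc j) = pivot_product M A j * schur M A j (M j) (M j)"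

definition cholesky :: "(nat \<Rightarrow> 'a) \<Rightarrow> ('a \<Rightarrow> 'a \<Rightarrow> real) \<Rightarrow> nat \<Rightarrow> 'a \<Rightarrow> real" where
  "cholesky M A j n = schur M A j (M j) n / sqrt (pivot_product M A (Suc j))"

lemma pivot_product_pos:
  "(\<And>i. i < j \<Longrightarrow> schur M A i (M i) (M i) > 0) \<Longrightarrow> pivot_product M A j > 0"
  by (induction j) simp_all

text \<open>Dividing by the pivot products turns the recursion into the removal of one square per step, and
  the sum telescopes.\<close>

lemma cholesky_factorization:
  assumes sym: "\<And>m n. A m n = A n m" and piv: "\<And>j. j < r \<Longrightarrow> schur M A j (M j) (M j) > 0"
    and zero: "\<And>m n. schur M A r m n = 0"
  shows "A m n = (\<Sum>j<r. cholesky M A j m * cholesky M A j n)"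
    and "\<And>i j n. i < j \<Longrightarrow> cholesky M A j (M i) = 0" and "\<And>j. j < r \<Longrightarrow> cholesky M A j (M j) > 0"
proof -
  have "A m n = (\<Sum>j<k. cholesky M A j m * cholesky M A j n) + schur M A k m n / pivot_product M A k"
    if "k \<le> r" for k
    using that
  proof (induction k)
    case (Suc k)
    have p: "pivot_product M A k > 0" "schur M A k (M k) (M k) > 0"
      using Suc.prems piv by (auto intro!: pivot_product_pos)
    have "cholesky M A k m * cholesky M A k n =
        schur M A k m (M k) * schur M A k (M k) n / (pivot_product M A k * schur M A k (M k) (M k))"
      using p by (simp add: cholesky_def schur_sym[where j = k and m = "M k" and n = m, OF sym] real_sqrt_mult[symmetric])
    moreover have "schur M A (Suc k) m n / pivot_product M A (Suc k) = schur M A k m n / pivot_product M A k -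
        schur M A k m (M k) * schur M A k (M k) n / (pivot_product M A k * schur M A k (M k) (M k))"
      using p by (simp add: diff_divide_distrib)
    ultimately show ?case using Suc by simp
  qed simp
  from this[of r] show "A m n = (\<Sum>j<r. cholesky M A j m * cholesky M A j n)" by (simp add: zero)
  show "cholesky M A j (M i) = 0" if "i < j" for i j
  proof -
    have "schur M A j (M j) (M i) = schur M A j (M i) (M j)" by (rule schur_sym) (rule sym)
    then show ?thesis using that by (simp add: cholesky_def schur_pivot_row)
  qed
  show "cholesky M A j (M j) > 0" if "j < r" for j
  proof -
    have "pivot_product M A (Suc j) > 0" using that piv by (intro pivot_product_pos) auto
    then show ?thesis using piv[OF that] by (simp add: cholesky_def del: pivot_product.simps)
  qed
qed

text \<open>A triangular factorization forces \<open>schur M A j\<close> to be a multiple of the sum of the squares from \<open>j\<close> on, so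
  the factor can be read off.\<close>

lemma cholesky_unique:
  assumes A: "\<And>m n. A m n = (\<Sum>j<r. q j m * q j n)"
    and tri: "\<And>i j. i < j \<Longrightarrow> j < r \<Longrightarrow> q j (M i) = 0" and pos: "\<And>j. j < r \<Longrightarrow> q j (M j) > 0"
  shows "\<And>j. j < r \<Longrightarrow> schur M A j (M j) (M j) > 0" and "\<And>m n. schur M A r m n = 0"
    and "\<And>j n. j < r \<Longrightarrow> cholesky M A j n = q j n"
proof -
  have main: "pivot_product M A j > 0 \<and> (\<forall>m n. schur M A j m n = pivot_product M A j * (\<Sum>i\<in>{j..<r}. q i m * q i n))"
    if "j \<le> r" for j
    using that
  proof (induction j)
    case 0
    show ?case by (simp add: A atLeast0LessThan)
  next
    case (Suc j)
    let ?p = "pivot_product M A j"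
    have p: "?p > 0" and IH: "schur M A j m n = ?p * (\<Sum>i\<in>{j..<r}. q i m * q i n)" for m n
      using Suc by auto
    have "{j..<r} = insert j {Suc j..<r}" using Suc.prems by auto
    then have split: "(\<Sum>i\<in>{j..<r}. q i m * q i n) = q j m * q j n + (\<Sum>i\<in>{Suc j..<r}. q i m * q i n)" for m n
      by simp
    have tail: "(\<Sum>i\<in>{Suc j..<r}. q i (M j) * q i n) = 0" "(\<Sum>i\<in>{Suc j..<r}. q i n * q i (M j)) = 0" for n
      by (intro sum.neutral; simp add: tri)+
    have "schur M A (Suc j) m n = ?p * (?p * (q j (M j) * q j (M j))) * (\<Sum>i\<in>{Suc j..<r}. q i m * q i n)" for m n
      by (simp add: IH split tail algebra_simps)
    moreover have "pivot_product M A (Suc j) = ?p * (?p * (q j (M j) * q j (M j)))"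
      by (simp add: IH split tail)
    ultimately show ?case using p pos[of j] Suc.prems by simp
  qed
  have row: "schur M A j (M j) n = pivot_product M A j * (q j (M j) * q j n)" if "j < r" for j n
  proof -
    have "(\<Sum>i\<in>{j..<r}. q i (M j) * q i n) = (\<Sum>i\<in>{j}. q i (M j) * q i n)"
      using that tri by (intro sum.mono_neutral_right) auto
    then show ?thesis using main[of j] that by simp
  qed
  show piv: "schur M A j (M j) (M j) > 0" if "j < r" for j
    using row[OF that] main[of j] pos[OF that] that by simp
  show "schur M A r m n = 0" for m n using main[of r] by simp
  show "cholesky M A j n = q j n" if "j < r" for j n
  proof -
    let ?p = "pivot_product M A j"
    have p: "?p > 0" using main[of j] that by simp
    have "pivot_product M A (Suc j) = (?p * q j (M j))\<^sup>2"
      by (simp add: row[OF that] power2_eq_square)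
    then have "sqrt (pivot_product M A (Suc j)) = ?p * q j (M j)"
      using p pos[OF that] by (simp add: real_sqrt_mult)
    then show ?thesis using p pos[OF that] by (simp add: cholesky_def row[OF that])
  qed
qed

section \<open>Gram tensors and their extreme points\<close>

definition mons :: "nat \<Rightarrow> mono2 set" where "mons d = {(i, j). i + j = d}"

lemma mons_eq_image: "mons d = (\<lambda>i. (i, d - i)) ` {..d}"
  by (force simp: mons_def image_iff)

lemma finite_mons [simp]: "finite (mons d)" by (simp add: mons_eq_image)

lemma card_mons: "card (mons d) = d + 1"
  unfolding mons_eq_image by (subst card_image) (auto simp: inj_on_def)

lemma binary_forms_iff: "p \<in> binary_forms d \<longleftrightarrow> Poly_Mapping.keys p \<subseteq> mons d"
  by (simp add: binary_forms_def mons_def)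

lemma lookup_binary_form: "p \<in> binary_forms d \<Longrightarrow> m \<notin> mons d \<Longrightarrow> Poly_Mapping.lookup p m = 0"
  by (auto simp: binary_forms_iff in_keys_iff)

lemma subspace_keys: "subspace {x :: 'a \<Rightarrow>\<^sub>0 real. Poly_Mapping.keys x \<subseteq> K}"
  unfolding subspace_def by (auto simp: subset_iff in_keys_iff lookup_add scaleR_lookup) (metis add.right_neutral)

lemma binary_forms_eq: "binary_forms d = {p. Poly_Mapping.keys p \<subseteq> mons d}"
  using binary_forms_iff by blast

lemma subspace_binary_forms: "subspace (binary_forms d)"
  unfolding binary_forms_eq by (rule subspace_keys)

text \<open>In coordinates: a symmetric tensor is a symmetric matrix indexed by the monomials of degree \<open>d\<close>.\<close>

lemma sym_tensors_iff:
  "\<theta> \<in> sym_tensors d \<longleftrightarrow> Poly_Mapping.keys \<theta> \<subseteq> mons d \<times> mons d \<and>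
     (\<forall>m n. Poly_Mapping.lookup \<theta> (m, n) = Poly_Mapping.lookup \<theta> (n, m))"
proof -
  let ?G = "{tensor p q | p q. p \<in> binary_forms d \<and> q \<in> binary_forms d}"
  have "\<theta> \<in> span ?G \<longleftrightarrow> Poly_Mapping.keys \<theta> \<subseteq> mons d \<times> mons d"
  proof
    assume "\<theta> \<in> span ?G"
    moreover have "?G \<subseteq> {\<theta>. Poly_Mapping.keys \<theta> \<subseteq> mons d \<times> mons d}"
      by (auto simp: keys_tensor binary_forms_iff)
    ultimately show "Poly_Mapping.keys \<theta> \<subseteq> mons d \<times> mons d"
      using span_minimal[OF _ subspace_keys] by blast
  next
    assume keys: "Poly_Mapping.keys \<theta> \<subseteq> mons d \<times> mons d"
    have "Poly_Mapping.single k (Poly_Mapping.lookup \<theta> k) \<in> span ?G" if "k \<in> mons d \<times> mons d" for k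
    proof -
      have "Poly_Mapping.single k (Poly_Mapping.lookup \<theta> k) =
          tensor (Poly_Mapping.single (fst k) (Poly_Mapping.lookup \<theta> k)) (Poly_Mapping.single (snd k) 1)"
      proof (rule poly_mapping_eqI)
        fix k'
        show "Poly_Mapping.lookup (Poly_Mapping.single k (Poly_Mapping.lookup \<theta> k)) k' = Poly_Mapping.lookup
            (tensor (Poly_Mapping.single (fst k) (Poly_Mapping.lookup \<theta> k)) (Poly_Mapping.single (snd k) 1)) k'"
          using lookup_tensor[of _ _ "fst k'" "snd k'"] by (simp add: lookup_single when_def prod_eq_iff)
      qed
      moreover have "Poly_Mapping.single (fst k) (Poly_Mapping.lookup \<theta> k) \<in> binary_forms d"
        "Poly_Mapping.single (snd k) (1::real) \<in> binary_forms d"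
        using that by (auto simp: binary_forms_iff)
      ultimately show ?thesis by (intro span_base) blast
    qed
    then have "(\<Sum>k\<in>mons d \<times> mons d. Poly_Mapping.single k (Poly_Mapping.lookup \<theta> k)) \<in> span ?G"
      by (rule span_sum)
    then show "\<theta> \<in> span ?G" using keys by (simp add: poly_mapping_sum_single)
  qed
  then show ?thesis by (simp add: sym_tensors_def)
qed

lemma contract_superset:
  assumes "finite K" "Poly_Mapping.keys \<theta> \<subseteq> K"
  shows "contract \<phi> \<theta> = (\<Sum>(m, n)\<in>K. (Poly_Mapping.lookup \<theta> (m, n) * \<phi> (Poly_Mapping.single m 1)) *\<^sub>R Poly_Mapping.single n 1)"
  unfolding contract_def using assms by (intro sum.mono_neutral_left) (auto simp: in_keys_iff)

lemma linear_contract: "linear (contract \<phi>)"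
proof (rule linearI)
  fix a b :: tensor2 and c :: real
  let ?K = "Poly_Mapping.keys a \<union> Poly_Mapping.keys b"
  have K: "finite ?K" by simp
  have "Poly_Mapping.keys (a + b) \<subseteq> ?K" by (rule Poly_Mapping.keys_add)
  then show "contract \<phi> (a + b) = contract \<phi> a + contract \<phi> b"
    using contract_superset[OF K, of a] contract_superset[OF K, of b] contract_superset[OF K, of "a + b"]
    by (simp add: lookup_add case_prod_beta sum.distrib distrib_right scaleR_left.add)
  have "Poly_Mapping.keys (c *\<^sub>R a) \<subseteq> ?K" by (auto simp: in_keys_iff scaleR_lookup)
  then show "contract \<phi> (c *\<^sub>R a) = c *\<^sub>R contract \<phi> a"
    using contract_superset[OF K, of a] contract_superset[OF K, of "c *\<^sub>R a"]
    by (simp add: scaleR_lookup case_prod_beta scaleR_sum_right mult.assoc)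
qed

definition indep_family :: "nat \<Rightarrow> (nat \<Rightarrow> 'a::real_vector) \<Rightarrow> bool" where
  "indep_family r p \<longleftrightarrow> (\<forall>a. (\<Sum>j<r. a j *\<^sub>R p j) = 0 \<longrightarrow> (\<forall>j<r. a j = 0))"

lemma indep_family_independent:
  assumes "indep_family r p"
  shows "inj_on p {..<r}" "independent (p ` {..<r})"
proof -
  show inj: "inj_on p {..<r}"
  proof (rule inj_onI, rule ccontr)
    fix i j assume ij: "i \<in> {..<r}" "j \<in> {..<r}" "p i = p j" "i \<noteq> j"
    define a where "a k = (if k = i then 1 else 0) - (if k = j then 1 else 0 :: real)" for k
    have "(\<Sum>k<r. a k *\<^sub>R p k) = (\<Sum>k<r. if k = i then p k else 0) - (\<Sum>k<r. if k = j then p k else 0)"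
      unfolding a_def sum_subtractf[symmetric] by (intro sum.cong) auto
    also have "\<dots> = 0" using ij by simp
    finally have "a i = 0" using assms ij unfolding indep_family_def by blast
    then show False using ij by (simp add: a_def)
  qed
  show "independent (p ` {..<r})"
  proof (rule independent_if_scalars_zero)
    fix g x assume g: "(\<Sum>x\<in>p ` {..<r}. g x *\<^sub>R x) = 0" and x: "x \<in> p ` {..<r}"
    have "(\<Sum>j<r. g (p j) *\<^sub>R p j) = 0" using g by (simp add: sum.reindex[OF inj])
    then have "\<forall>j<r. g (p j) = 0" using assms[unfolded indep_family_def, rule_format, of "\<lambda>j. g (p j)"] by blast
    then show "g x = 0" using x by auto
  qed simp
qed

lemma dual_functionals:
  fixes p :: "nat \<Rightarrow> 'a::real_vector"
  assumes "indep_family r p"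
  obtains \<phi> :: "nat \<Rightarrow> 'a \<Rightarrow> real" where "\<And>i. linear (\<phi> i)" "\<And>i j. j < r \<Longrightarrow> \<phi> i (p j) = (if i = j then 1 else 0)"
proof -
  note indep = indep_family_independent[OF assms]
  have "\<exists>g :: 'a \<Rightarrow> real. linear g \<and> (\<forall>j<r. g (p j) = (if i = j then 1 else 0))" for i
  proof -
    from linear_independent_extend[OF indep(2), of "\<lambda>x. if inv_into {..<r} p x = i then 1 else 0 :: real"]
    obtain g :: "'a \<Rightarrow> real" where g: "linear g" "\<forall>x\<in>p ` {..<r}. g x = (if inv_into {..<r} p x = i then 1 else 0)"
      by (elim exE conjE)
    then have "\<forall>j<r. g (p j) = (if i = j then 1 else 0)" using inv_into_f_f[OF indep(1)] by auto
    with g(1) show ?thesis by blast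
  qed
  then have "\<exists>\<phi> :: nat \<Rightarrow> 'a \<Rightarrow> real. \<forall>i. linear (\<phi> i) \<and> (\<forall>j<r. \<phi> i (p j) = (if i = j then 1 else 0))"
    by (intro choice allI)
  then show thesis using that by blast
qed

lemma separating_functional:
  fixes p :: "nat \<Rightarrow> 'a::real_vector"
  assumes "indep_family r p" "a \<notin> span (p ` {..<r})"
  obtains \<phi> :: "'a \<Rightarrow> real" where "linear \<phi>" "\<And>j. j < r \<Longrightarrow> \<phi> (p j) = 0" "\<phi> a = 1"
proof -
  have "independent (insert a (p ` {..<r}))"
    using indep_family_independent(2)[OF assms(1)] assms(2) by (simp add: independent_insertI)
  from linear_independent_extend[OF this, of "\<lambda>x. if x = a then 1 else 0 :: real"]
  obtain \<phi> :: "'a \<Rightarrow> real" where \<phi>: "linear \<phi>" "\<forall>x\<in>insert a (p ` {..<r}). \<phi> x = (if x = a then 1 else 0)"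
    by (elim exE conjE)
  have "p j \<noteq> a" if "j < r" for j using assms(2) that span_base[of "p j" "p ` {..<r}"] by auto
  then have "\<phi> (p j) = 0" if "j < r" for j using \<phi>(2) that by auto
  moreover have "\<phi> a = 1" using \<phi>(2) by simp
  ultimately show thesis using that \<phi>(1) by blast
qed

lemma span_family:
  assumes "a \<in> span (p ` {..<r :: nat})"
  obtains c where "a = (\<Sum>j<r. c j *\<^sub>R p j)"
proof -
  have "subspace (range (\<lambda>c. \<Sum>j<r. c j *\<^sub>R p j))"
    unfolding subspace_def
  proof (intro conjI ballI allI)
    show "0 \<in> (range (\<lambda>c. \<Sum>j<r. c j *\<^sub>R p j))" by (rule range_eqI[of _ _ "\<lambda>_. 0"]) simp
    show "x + y \<in> (range (\<lambda>c. \<Sum>j<r. c j *\<^sub>R p j))"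
      if xy: "x \<in> (range (\<lambda>c. \<Sum>j<r. c j *\<^sub>R p j))" "y \<in> (range (\<lambda>c. \<Sum>j<r. c j *\<^sub>R p j))" for x y
    proof -
      obtain c c' where "x = (\<Sum>j<r. c j *\<^sub>R p j)" "y = (\<Sum>j<r. c' j *\<^sub>R p j)" using xy by blast
      then have "x + y = (\<Sum>j<r. (c j + c' j) *\<^sub>R p j)" by (simp add: sum.distrib scaleR_left.add)
      then show ?thesis by (rule range_eqI[of _ _ "\<lambda>j. c j + c' j"])
    qed
    show "t *\<^sub>R x \<in> (range (\<lambda>c. \<Sum>j<r. c j *\<^sub>R p j))" if x: "x \<in> (range (\<lambda>c. \<Sum>j<r. c j *\<^sub>R p j))" for t x
    proof -
      obtain c where "x = (\<Sum>j<r. c j *\<^sub>R p j)" using x by blast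
      then have "t *\<^sub>R x = (\<Sum>j<r. (t * c j) *\<^sub>R p j)" by (simp add: scaleR_sum_right)
      then show ?thesis by (rule range_eqI[of _ _ "\<lambda>j. t * c j"])
    qed
  qed
  moreover have "p ` {..<r} \<subseteq> (range (\<lambda>c. \<Sum>j<r. c j *\<^sub>R p j))"
  proof clarify
    fix i assume "i < r"
    then have "p i = (\<Sum>j<r. (if j = i then 1 else 0) *\<^sub>R p j)"
      by (simp add: if_distrib[of "\<lambda>x. x *\<^sub>R _"] cong: if_cong)
    then show "p i \<in> (range (\<lambda>c. \<Sum>j<r. c j *\<^sub>R p j))" by (rule range_eqI[of _ _ "\<lambda>j. if j = i then 1 else 0"])
  qed
  ultimately show thesis using assms that span_minimal by blast
qed

definition gram_tensor :: "nat \<Rightarrow> (nat \<Rightarrow> poly2) \<Rightarrow> tensor2" where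
  "gram_tensor r p = (\<Sum>j<r. tensor (p j) (p j))"

lemma lookup_gram_tensor:
  "Poly_Mapping.lookup (gram_tensor r p) (m, n) = (\<Sum>j<r. Poly_Mapping.lookup (p j) m * Poly_Mapping.lookup (p j) n)"
  by (simp add: gram_tensor_def lookup_sum lookup_tensor)

lemma psd_tensors_iff: "\<theta> \<in> psd_tensors d \<longleftrightarrow> (\<exists>r p. \<theta> = gram_tensor r p \<and> (\<forall>j<r. p j \<in> binary_forms d))"
  unfolding psd_tensors_def gram_tensor_def by blast

lemma mult_map_gram_tensor: "mult_map (gram_tensor r p) = (\<Sum>j<r. p j * p j)"
  by (simp add: gram_tensor_def linear_sum[OF linear_mult_map] mult_map_tensor)

lemma contract_gram_tensor: "linear \<phi> \<Longrightarrow> contract \<phi> (gram_tensor r p) = (\<Sum>j<r. \<phi> (p j) *\<^sub>R p j)"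
  by (simp add: gram_tensor_def linear_sum[OF linear_contract] contract_tensor)

lemma tensor_rank_gram_tensor:
  assumes "indep_family r p"
  shows "tensor_rank (gram_tensor r p) = r"
  unfolding tensor_rank_def
proof (rule dim_unique)
  obtain \<phi> :: "nat \<Rightarrow> poly2 \<Rightarrow> real" where \<phi>: "\<And>i. linear (\<phi> i)" "\<And>i j. j < r \<Longrightarrow> \<phi> i (p j) = (if i = j then 1 else 0)"
    using dual_functionals[OF assms] by blast
  have "p i = contract (\<phi> i) (gram_tensor r p)" if "i < r" for i
  proof -
    have "(\<Sum>j<r. \<phi> i (p j) *\<^sub>R p j) = (\<Sum>j<r. if j = i then p j else 0)"
      by (intro sum.cong) (auto simp: \<phi>)
    then show ?thesis using that by (simp add: contract_gram_tensor \<phi>)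
  qed
  then show "p ` {..<r} \<subseteq> {contract \<phi> (gram_tensor r p) |\<phi>. linear \<phi>}" using \<phi>(1) by blast
  show "{contract \<phi> (gram_tensor r p) |\<phi>. linear \<phi>} \<subseteq> span (p ` {..<r})"
    by (clarsimp simp: contract_gram_tensor, intro span_sum span_scale span_base imageI, simp)
  show "independent (p ` {..<r})" "card (p ` {..<r}) = r"
    using indep_family_independent[OF assms] by (simp_all add: card_image)
qed

text \<open>The element of the second symmetric power of the span of \<open>p\<close> that belongs to the quadratic form \<open>q\<close>.\<close>

definition quad_tensor :: "nat \<Rightarrow> (nat \<Rightarrow> nat \<Rightarrow> real) \<Rightarrow> (nat \<Rightarrow> poly2) \<Rightarrow> tensor2" where
  "quad_tensor r q p = (\<Sum>i<r. \<Sum>j<r. q i j *\<^sub>R tensor (p i) (p j))"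

definition indep_products :: "nat \<Rightarrow> (nat \<Rightarrow> poly2) \<Rightarrow> bool" where
  "indep_products r p \<longleftrightarrow> (\<forall>q. (\<forall>i j. q i j = q j i) \<longrightarrow> mult_map (quad_tensor r q p) = 0 \<longrightarrow>
     (\<forall>i<r. \<forall>j<r. q i j = 0))"

lemma indep_productsD:
  assumes "indep_products r p" "\<And>i j. q i j = q j i" "mult_map (quad_tensor r q p) = 0" "i < r" "j < r"
  shows "q i j = 0"
  using assms unfolding indep_products_def by blast

lemma lookup_quad_tensor:
  "Poly_Mapping.lookup (quad_tensor r q p) (m, n) =
     (\<Sum>i<r. \<Sum>j<r. q i j * Poly_Mapping.lookup (p i) m * Poly_Mapping.lookup (p j) n)"
  by (simp add: quad_tensor_def lookup_sum scaleR_lookup lookup_tensor mult.assoc)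

lemma gram_tensor_eq_quad_tensor: "gram_tensor r p = quad_tensor r (\<lambda>i j. if i = j then 1 else 0) p"
  by (simp add: gram_tensor_def quad_tensor_def if_distrib[of "\<lambda>x. x *\<^sub>R _"] cong: if_cong)

lemma indep_family_if_indep_products:
  assumes "indep_products r p"
  shows "indep_family r p"
  unfolding indep_family_def
proof (intro allI impI)
  fix a j assume a: "(\<Sum>j<r. a j *\<^sub>R p j) = 0" and j: "j < r"
  have "quad_tensor r (\<lambda>i j. a i * a j) p = 0"
  proof (rule poly_mapping_eqI)
    fix mn :: "mono2 \<times> mono2"
    obtain m n where mn: "mn = (m, n)" by (cases mn)
    have "(\<Sum>i<r. \<Sum>j<r. a i * a j * Poly_Mapping.lookup (p i) m * Poly_Mapping.lookup (p j) n) =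
        Poly_Mapping.lookup (\<Sum>j<r. a j *\<^sub>R p j) m * Poly_Mapping.lookup (\<Sum>j<r. a j *\<^sub>R p j) n"
      by (simp add: lookup_sum scaleR_lookup sum_product mult_ac)
    then show "Poly_Mapping.lookup (quad_tensor r (\<lambda>i j. a i * a j) p) mn = Poly_Mapping.lookup 0 mn"
      by (simp add: mn lookup_quad_tensor a)
  qed
  then have "a j * a j = 0"
    by (intro indep_productsD[OF assms, of "\<lambda>i j. a i * a j"]) (simp_all add: j linear_0[OF linear_mult_map] mult.commute)
  then show "a j = 0" by simp
qed

text \<open>If a functional vanishes on all \<open>p\<^sub>j\<close>, then it vanishes on every \<open>a\<^sub>k\<close>, as the squares of its values add
  up to zero.\<close>

lemma psd_summand_in_span:
  assumes p: "indep_family r p" and a: "gram_tensor r p = u *\<^sub>R gram_tensor s a + v *\<^sub>R gram_tensor t b"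
    and uv: "u > 0" "v \<ge> 0" and k: "k < s"
  shows "a k \<in> span (p ` {..<r})"
proof (rule ccontr)
  assume "a k \<notin> span (p ` {..<r})"
  then obtain \<phi> :: "poly2 \<Rightarrow> real" where \<phi>: "linear \<phi>" "\<And>j. j < r \<Longrightarrow> \<phi> (p j) = 0" "\<phi> (a k) = 1"
    using separating_functional[OF p] by blast
  have ev: "\<phi> (contract \<phi> (gram_tensor l c)) = (\<Sum>j<l. (\<phi> (c j))\<^sup>2)" for l c
    by (simp add: contract_gram_tensor linear_sum[OF \<phi>(1)] linear_scale[OF \<phi>(1)] \<phi>(1) power2_eq_square)
  have "0 = \<phi> (contract \<phi> (gram_tensor r p))" by (simp add: ev \<phi>)
  also have "\<dots> = u * (\<Sum>j<s. (\<phi> (a j))\<^sup>2) + v * (\<Sum>j<t. (\<phi> (b j))\<^sup>2)"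
    by (simp add: a linear_add[OF linear_contract] linear_scale[OF linear_contract]
        linear_add[OF \<phi>(1)] linear_scale[OF \<phi>(1)] ev)
  finally have "0 \<ge> u * (\<Sum>j<s. (\<phi> (a j))\<^sup>2)" using uv by (smt (verit) mult_nonneg_nonneg sum_nonneg zero_le_power2)
  moreover have "(\<Sum>j<s. (\<phi> (a j))\<^sup>2) \<ge> (\<phi> (a k))\<^sup>2" using k by (intro member_le_sum) auto
  ultimately show False using uv \<phi>(3) by (simp add: mult_le_0_iff)
qed

text \<open>The summand is \<open>\<Sum> q\<^sub>i\<^sub>j p\<^sub>i \<otimes> p\<^sub>j\<close> for some symmetric \<open>q\<close>. It has the same image under the
  multiplication as \<open>\<Sum> p\<^sub>j \<otimes> p\<^sub>j\<close>, so \<open>q\<close> is the identity.\<close>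

lemma gram_tensor_unique:
  assumes p: "indep_products r p" and a: "gram_tensor r p = u *\<^sub>R gram_tensor s a + v *\<^sub>R gram_tensor t b"
    and uv: "u > 0" "v \<ge> 0" and f: "mult_map (gram_tensor s a) = mult_map (gram_tensor r p)"
  shows "gram_tensor s a = gram_tensor r p"
proof -
  have "\<exists>c. a k = (\<Sum>j<r. c j *\<^sub>R p j)" if "k < s" for k
    using psd_summand_in_span[OF indep_family_if_indep_products[OF p] a uv that] span_family by metis
  then obtain c where c: "\<And>k. k < s \<Longrightarrow> a k = (\<Sum>j<r. c k j *\<^sub>R p j)" by metis
  define q where "q i j = (\<Sum>k<s. c k i * c k j)" for i j
  have "gram_tensor s a = quad_tensor r q p"
  proof (rule poly_mapping_eqI)
    fix mn :: "mono2 \<times> mono2"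
    obtain m n where mn: "mn = (m, n)" by (cases mn)
    have "Poly_Mapping.lookup (gram_tensor s a) mn =
        (\<Sum>k<s. \<Sum>i<r. \<Sum>j<r. c k i * c k j * Poly_Mapping.lookup (p i) m * Poly_Mapping.lookup (p j) n)"
      unfolding mn lookup_gram_tensor
      by (intro sum.cong) (simp_all add: c lookup_sum scaleR_lookup sum_product mult_ac)
    also have "\<dots> = (\<Sum>i<r. \<Sum>k<s. \<Sum>j<r. c k i * c k j * Poly_Mapping.lookup (p i) m * Poly_Mapping.lookup (p j) n)"
      by (rule sum.swap)
    also have "\<dots> = (\<Sum>i<r. \<Sum>j<r. \<Sum>k<s. c k i * c k j * Poly_Mapping.lookup (p i) m * Poly_Mapping.lookup (p j) n)"
      by (intro sum.cong refl sum.swap)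
    finally show "Poly_Mapping.lookup (gram_tensor s a) mn = Poly_Mapping.lookup (quad_tensor r q p) mn"
      by (simp add: mn lookup_quad_tensor q_def sum_distrib_right)
  qed
  moreover define q' where "q' i j = q i j - (if i = j then 1 else 0)" for i j
  have diff: "quad_tensor r q' p = quad_tensor r q p - gram_tensor r p"
    by (simp add: gram_tensor_eq_quad_tensor quad_tensor_def q'_def scaleR_left.diff sum_subtractf)
  ultimately have "mult_map (quad_tensor r q' p) = 0"
    using f by (simp add: linear_diff[OF linear_mult_map])
  moreover have "q' i j = q' j i" for i j by (simp add: q'_def q_def mult.commute)
  ultimately have "q' i j = 0" if "i < r" "j < r" for i j
    using that by (intro indep_productsD[OF p])
  then have "quad_tensor r q' p = 0" by (simp add: quad_tensor_def)
  then show ?thesis using diff \<open>gram_tensor s a = quad_tensor r q p\<close> by simp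
qed

lemma extreme_point_if_indep_products:
  assumes V: "\<And>j. j < r \<Longrightarrow> p j \<in> binary_forms d" and p: "indep_products r p"
  shows "gram_tensor r p \<in> extreme_points_of_rank d r (mult_map (gram_tensor r p))"
proof -
  let ?f = "mult_map (gram_tensor r p)"
  have "gram_tensor r p extreme_point_of gram d ?f"
    unfolding extreme_point_of_def
  proof (intro conjI ballI notI)
    show "gram_tensor r p \<in> gram d ?f" using V by (auto simp: gram_def psd_tensors_iff)
    fix x y assume x: "x \<in> gram d ?f" and y: "y \<in> gram d ?f" and mid: "gram_tensor r p \<in> open_segment x y"
    obtain s a where a: "x = gram_tensor s a" using x by (auto simp: gram_def psd_tensors_iff)
    obtain t b where b: "y = gram_tensor t b" using y by (auto simp: gram_def psd_tensors_iff)
    obtain u where u: "x \<noteq> y" "0 < u" "u < 1" "gram_tensor r p = (1 - u) *\<^sub>R x + u *\<^sub>R y"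
      using mid by (auto simp: in_segment)
    have "x = gram_tensor r p"
      unfolding a
    proof (rule gram_tensor_unique[OF p])
      show "gram_tensor r p = (1 - u) *\<^sub>R gram_tensor s a + u *\<^sub>R gram_tensor t b" using u(4) by (simp only: a b)
      show "mult_map (gram_tensor s a) = ?f" using x by (simp add: gram_def a)
    qed (use u in simp_all)
    moreover have "y = gram_tensor r p"
      unfolding b
    proof (rule gram_tensor_unique[OF p])
      show "gram_tensor r p = u *\<^sub>R gram_tensor t b + (1 - u) *\<^sub>R gram_tensor s a"
        using u(4) by (simp only: a b add.commute)
      show "mult_map (gram_tensor t b) = ?f" using y by (simp add: gram_def b)
    qed (use u in simp_all)
    ultimately show False using u(1) by simp
  qed
  then show ?thesis
    by (simp add: extreme_points_of_rank_def tensor_rank_gram_tensor indep_family_if_indep_products[OF p])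
qed

definition form_of :: "nat \<Rightarrow> (mono2 \<Rightarrow> real) \<Rightarrow> poly2" where
  "form_of d c = (\<Sum>n\<in>mons d. Poly_Mapping.single n (c n))"

lemma lookup_form_of: "Poly_Mapping.lookup (form_of d c) n = (if n \<in> mons d then c n else 0)"
  by (simp add: form_of_def lookup_sum lookup_single when_def)

lemma form_of_in_binary_forms: "form_of d c \<in> binary_forms d"
  by (auto simp: binary_forms_iff in_keys_iff lookup_form_of split: if_splits)

definition entries :: "tensor2 \<Rightarrow> mono2 \<Rightarrow> mono2 \<Rightarrow> real" where
  "entries \<theta> m n = Poly_Mapping.lookup \<theta> (m, n)"

lemma entries_sym: "\<theta> \<in> sym_tensors d \<Longrightarrow> entries \<theta> m n = entries \<theta> n m"
  unfolding sym_tensors_iff entries_def by blast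

lemma entries_outside: "\<theta> \<in> sym_tensors d \<Longrightarrow> m \<notin> mons d \<Longrightarrow> entries \<theta> m n = 0"
  unfolding sym_tensors_iff entries_def by (metis in_keys_iff mem_Sigma_iff subsetD)

lemma entries_gram_tensor:
  "entries (gram_tensor r p) m n = (\<Sum>j<r. Poly_Mapping.lookup (p j) m * Poly_Mapping.lookup (p j) n)"
  by (simp add: entries_def lookup_gram_tensor)

text \<open>The normal form of the tuples \<open>p\<close> with given Gram tensor modulo orthogonal transformations:
  the coefficients at the pivot monomials form a triangular matrix with positive diagonal.\<close>

definition triangular :: "(nat \<Rightarrow> mono2) \<Rightarrow> nat \<Rightarrow> (nat \<Rightarrow> poly2) \<Rightarrow> bool" where
  "triangular M r p \<longleftrightarrow> (\<forall>j<r. (\<forall>i<j. Poly_Mapping.lookup (p j) (M i) = 0) \<and> Poly_Mapping.lookup (p j) (M j) > 0)"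

lemma indep_family_if_triangular:
  assumes "triangular M r p"
  shows "indep_family r p"
  unfolding indep_family_def
proof (intro allI impI)
  fix a i assume a: "(\<Sum>j<r. a j *\<^sub>R p j) = 0" and "i < r"
  then show "a i = 0"
  proof (induction i rule: less_induct)
    case (less i)
    have "0 = Poly_Mapping.lookup (\<Sum>j<r. a j *\<^sub>R p j) (M i)" by (simp add: a)
    also have "\<dots> = (\<Sum>j<r. a j * Poly_Mapping.lookup (p j) (M i))" by (simp add: lookup_sum scaleR_lookup)
    also have "\<dots> = (\<Sum>j\<in>{i}. a j * Poly_Mapping.lookup (p j) (M i))"
    proof (rule sum.mono_neutral_right)
      show "\<forall>j\<in>{..<r} - {i}. a j * Poly_Mapping.lookup (p j) (M i) = 0"
      proof
        fix j assume j: "j \<in> {..<r} - {i}"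
        show "a j * Poly_Mapping.lookup (p j) (M i) = 0"
        proof (cases "j < i")
          case True
          then show ?thesis using less.IH[OF True a] less.prems by simp
        next
          case False
          then show ?thesis using j assms by (auto simp: triangular_def)
        qed
      qed
    qed (use less.prems in auto)
    finally have "a i * Poly_Mapping.lookup (p i) (M i) = 0" by simp
    moreover have "Poly_Mapping.lookup (p i) (M i) > 0" using assms less.prems by (simp add: triangular_def)
    ultimately show ?case by simp
  qed
qed

lemma psd_tensors_nonneg_form:
  assumes "\<theta> \<in> psd_tensors d"
  shows "nonneg_form (mons d) (entries \<theta>)"
proof -
  obtain r p where \<theta>: "\<theta> = gram_tensor r p" using assms by (auto simp: psd_tensors_iff)
  have "(\<Sum>m\<in>mons d. \<Sum>n\<in>mons d. entries \<theta> m n * x m * x n) =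
      (\<Sum>j<r. (\<Sum>m\<in>mons d. Poly_Mapping.lookup (p j) m * x m)\<^sup>2)" for x
  proof -
    have "(\<Sum>m\<in>mons d. \<Sum>n\<in>mons d. entries \<theta> m n * x m * x n) =
      (\<Sum>m\<in>mons d. \<Sum>n\<in>mons d. \<Sum>j<r. (Poly_Mapping.lookup (p j) m * x m) * (Poly_Mapping.lookup (p j) n * x n))"
      by (intro sum.cong refl) (simp add: \<theta> entries_gram_tensor sum_distrib_left sum_distrib_right mult_ac)
    also have "\<dots> = (\<Sum>m\<in>mons d. \<Sum>j<r. \<Sum>n\<in>mons d. (Poly_Mapping.lookup (p j) m * x m) * (Poly_Mapping.lookup (p j) n * x n))"
      by (intro sum.cong refl sum.swap)
    also have "\<dots> = (\<Sum>j<r. \<Sum>m\<in>mons d. \<Sum>n\<in>mons d. (Poly_Mapping.lookup (p j) m * x m) * (Poly_Mapping.lookup (p j) n * x n))"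
      by (rule sum.swap)
    also have "\<dots> = (\<Sum>j<r. (\<Sum>m\<in>mons d. Poly_Mapping.lookup (p j) m * x m)\<^sup>2)"
      by (simp add: power2_eq_square sum_product)
    finally show ?thesis .
  qed
  moreover have "entries \<theta> m n = entries \<theta> n m" for m n
    using assms psd_tensors_subset entries_sym by blast
  ultimately show ?thesis by (auto simp: nonneg_form_def intro!: sum_nonneg)
qed

definition cholesky_form :: "nat \<Rightarrow> (nat \<Rightarrow> mono2) \<Rightarrow> tensor2 \<Rightarrow> nat \<Rightarrow> poly2" where
  "cholesky_form d M \<theta> j = form_of d (cholesky M (entries \<theta>) j)"

lemma cholesky_form_in_binary_forms: "cholesky_form d M \<theta> j \<in> binary_forms d"
  by (simp add: cholesky_form_def form_of_in_binary_forms)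

lemma cholesky_form_factorization:
  assumes \<theta>: "\<theta> \<in> sym_tensors d" and M: "\<And>j. j < r \<Longrightarrow> M j \<in> mons d"
    and piv: "\<And>j. j < r \<Longrightarrow> schur M (entries \<theta>) j (M j) (M j) > 0"
    and zero: "\<And>m n. schur M (entries \<theta>) r m n = 0"
  shows "\<theta> = gram_tensor r (cholesky_form d M \<theta>)" "triangular M r (cholesky_form d M \<theta>)"
proof -
  note fac = cholesky_factorization[OF entries_sym[OF \<theta>] piv zero]
  have lookup: "Poly_Mapping.lookup (cholesky_form d M \<theta> j) n = cholesky M (entries \<theta>) j n" for j n
  proof (cases "n \<in> mons d")
    case False
    have "schur M (entries \<theta>) j (M j) n = schur M (entries \<theta>) j n (M j)"
      by (rule schur_sym) (rule entries_sym[OF \<theta>])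
    also have "\<dots> = 0" by (rule schur_support) (rule entries_outside[OF \<theta> False])
    finally show ?thesis using False by (simp add: cholesky_form_def lookup_form_of cholesky_def)
  qed (simp add: cholesky_form_def lookup_form_of)
  show "\<theta> = gram_tensor r (cholesky_form d M \<theta>)"
  proof (rule poly_mapping_eqI)
    fix mn :: "mono2 \<times> mono2"
    show "Poly_Mapping.lookup \<theta> mn = Poly_Mapping.lookup (gram_tensor r (cholesky_form d M \<theta>)) mn"
      using fac(1)[of "fst mn" "snd mn"] lookup_gram_tensor[of r "cholesky_form d M \<theta>" "fst mn" "snd mn"]
      by (simp add: lookup entries_def)
  qed
  show "triangular M r (cholesky_form d M \<theta>)"
    using fac(2,3) by (simp add: triangular_def lookup)
qed

lemma cholesky_form_gram_tensor:
  assumes V: "\<And>j. j < r \<Longrightarrow> p j \<in> binary_forms d" and tri: "triangular M r p"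
  shows "\<And>j. j < r \<Longrightarrow> schur M (entries (gram_tensor r p)) j (M j) (M j) > 0"
    and "\<And>m n. schur M (entries (gram_tensor r p)) r m n = 0"
    and "\<And>j. j < r \<Longrightarrow> cholesky_form d M (gram_tensor r p) j = p j"
proof -
  note uniq = cholesky_unique[where A = "entries (gram_tensor r p)" and r = r and
      q = "\<lambda>j. Poly_Mapping.lookup (p j)" and M = M, OF entries_gram_tensor]
  have t: "\<And>i j. i < j \<Longrightarrow> j < r \<Longrightarrow> Poly_Mapping.lookup (p j) (M i) = 0"
    "\<And>j. j < r \<Longrightarrow> Poly_Mapping.lookup (p j) (M j) > 0"
    using tri by (auto simp: triangular_def)
  show "schur M (entries (gram_tensor r p)) j (M j) (M j) > 0" if "j < r" for j
    using uniq(1)[OF t that] by simp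
  show "schur M (entries (gram_tensor r p)) r m n = 0" for m n using uniq(2)[OF t] by simp
  show "cholesky_form d M (gram_tensor r p) j = p j" if "j < r" for j
  proof (rule poly_mapping_eqI)
    fix n
    show "Poly_Mapping.lookup (cholesky_form d M (gram_tensor r p) j) n = Poly_Mapping.lookup (p j) n"
      using uniq(3)[OF t that] lookup_binary_form[OF V[OF that]] by (simp add: cholesky_form_def lookup_form_of)
  qed
qed

lemma ex_triangular_extension:
  assumes \<theta>: "\<theta> \<in> sym_tensors d" "nonneg_form (mons d) (entries \<theta>)"
    and M: "\<And>j. j < s \<Longrightarrow> M j \<in> mons d" "\<And>j. j < s \<Longrightarrow> schur M (entries \<theta>) j (M j) (M j) > 0"
  obtains M' r p where "s \<le> r" "\<And>j. j < s \<Longrightarrow> M' j = M j" "\<And>j. j < r \<Longrightarrow> M' j \<in> mons d"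
    "\<And>j. j < r \<Longrightarrow> p j \<in> binary_forms d" "triangular M' r p" "\<theta> = gram_tensor r p"
proof -
  have "\<exists>M' r. s \<le> r \<and> (\<forall>j<s. M' j = M j) \<and> (\<forall>j<r. M' j \<in> mons d \<and> schur M' (entries \<theta>) j (M' j) (M' j) > 0) \<and>
      (\<forall>m n. schur M' (entries \<theta>) r m n = 0)"
    by (rule ex_complete_pivots) (use \<theta> M entries_outside in auto)
  then obtain M' r where M': "s \<le> r" "\<forall>j<s. M' j = M j"
    "\<forall>j<r. M' j \<in> mons d \<and> schur M' (entries \<theta>) j (M' j) (M' j) > 0"
    "\<forall>m n. schur M' (entries \<theta>) r m n = 0" by blast
  note fac = cholesky_form_factorization[OF \<theta>(1), of r M']
  show thesis
    by (rule that[of r M' "cholesky_form d M' \<theta>"])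
       (use M' fac cholesky_form_in_binary_forms in auto)
qed

lemma psd_tensors_if_nonneg_form:
  assumes "\<theta> \<in> sym_tensors d" "nonneg_form (mons d) (entries \<theta>)"
  shows "\<theta> \<in> psd_tensors d"
proof -
  obtain M' r p where "\<And>j. j < r \<Longrightarrow> p j \<in> binary_forms d" "\<theta> = gram_tensor r p"
    by (rule ex_triangular_extension[OF assms, of 0 "\<lambda>_. (0, d)"]) (simp, simp, blast)
  then show ?thesis by (auto simp: psd_tensors_iff)
qed

lemma psd_tensor_triangular:
  assumes "\<theta> \<in> psd_tensors d"
  obtains M p where "\<And>j. j < tensor_rank \<theta> \<Longrightarrow> M j \<in> mons d"
    "\<And>j. j < tensor_rank \<theta> \<Longrightarrow> p j \<in> binary_forms d" "triangular M (tensor_rank \<theta>) p" "\<theta> = gram_tensor (tensor_rank \<theta>) p"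
proof -
  have \<theta>: "\<theta> \<in> sym_tensors d" "nonneg_form (mons d) (entries \<theta>)"
    using assms psd_tensors_subset psd_tensors_nonneg_form by auto
  obtain M' r p where *: "\<And>j. j < r \<Longrightarrow> M' j \<in> mons d" "\<And>j. j < r \<Longrightarrow> p j \<in> binary_forms d"
    "triangular M' r p" "\<theta> = gram_tensor r p"
    by (rule ex_triangular_extension[OF \<theta>, of 0 "\<lambda>_. (0, d)"]) (simp, simp, blast)
  moreover have "tensor_rank \<theta> = r"
    unfolding *(4) by (rule tensor_rank_gram_tensor) (rule indep_family_if_triangular[OF *(3)])
  ultimately show thesis using that[of M' p] by simp
qed

text \<open>If the rank is \<open>r\<close>, then any \<open>r\<close> successive positive pivots exhaust the tensor; otherwise they could be
  continued to a longer sequence, and the rank would be larger.\<close>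

lemma psd_tensor_pivots_complete:
  assumes \<theta>: "\<theta> \<in> psd_tensors d"
    and M: "\<And>j. j < tensor_rank \<theta> \<Longrightarrow> M j \<in> mons d"
    and piv: "\<And>j. j < tensor_rank \<theta> \<Longrightarrow> schur M (entries \<theta>) j (M j) (M j) > 0"
  shows "schur M (entries \<theta>) (tensor_rank \<theta>) m n = 0"
proof -
  have \<theta>': "\<theta> \<in> sym_tensors d" "nonneg_form (mons d) (entries \<theta>)"
    using \<theta> psd_tensors_subset psd_tensors_nonneg_form by auto
  obtain M' r p where *: "tensor_rank \<theta> \<le> r" "\<And>j. j < tensor_rank \<theta> \<Longrightarrow> M' j = M j"
    "\<And>j. j < r \<Longrightarrow> p j \<in> binary_forms d" "triangular M' r p" "\<theta> = gram_tensor r p"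
    by (rule ex_triangular_extension[OF \<theta>', of "tensor_rank \<theta>" M]) (use M piv in \<open>simp, simp, blast\<close>)
  have r: "tensor_rank \<theta> = r"
    unfolding *(5) by (rule tensor_rank_gram_tensor) (rule indep_family_if_triangular[OF *(4)])
  have "schur M (entries \<theta>) r = schur M' (entries \<theta>) r"
    by (rule schur_cong) (simp add: *(2) r)
  then show ?thesis using cholesky_form_gram_tensor(2)[OF *(3,4)] by (simp add: r flip: *(5))
qed

lemma gram_tensor_in_sym_tensors: "(\<And>j. j < r \<Longrightarrow> p j \<in> binary_forms d) \<Longrightarrow> gram_tensor r p \<in> sym_tensors d"
  using psd_tensors_subset psd_tensors_iff by blast

text \<open>The identity matrix stays positive semidefinite under a symmetric perturbation whose entries
  have absolute values with sum at most 1.\<close>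

lemma nonneg_form_perturbed:
  assumes sym: "\<And>i j. q i j = q j i" and s: "\<bar>s\<bar> * (\<Sum>i<r. \<Sum>j<r. \<bar>q i j\<bar>) \<le> 1"
  shows "nonneg_form X (\<lambda>m n. entries (gram_tensor r p) m n + s * entries (quad_tensor r q p) m n)"
  unfolding nonneg_form_def
proof (intro conjI allI)
  fix m n
  have "entries (quad_tensor r q p) m n = entries (quad_tensor r q p) n m"
    unfolding entries_def lookup_quad_tensor
    by (subst sum.swap) (intro sum.cong refl, metis sym mult.assoc mult.commute)
  then show "entries (gram_tensor r p) m n + s * entries (quad_tensor r q p) m n =
      entries (gram_tensor r p) n m + s * entries (quad_tensor r q p) n m"
    by (simp add: entries_gram_tensor mult.commute)
next
  fix x
  define y where "y j = (\<Sum>m\<in>X. Poly_Mapping.lookup (p j) m * x m)" for j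
  define Y where "Y = (\<Sum>j<r. (y j)\<^sup>2)"
  have quad: "(\<Sum>m\<in>X. \<Sum>n\<in>X. entries (quad_tensor r q p) m n * x m * x n) = (\<Sum>i<r. \<Sum>j<r. q i j * (y i * y j))" for q
  proof -
    have "(\<Sum>m\<in>X. \<Sum>n\<in>X. entries (quad_tensor r q p) m n * x m * x n) =
        (\<Sum>(m, n)\<in>X \<times> X. \<Sum>(i, j)\<in>{..<r} \<times> {..<r}. q i j * (Poly_Mapping.lookup (p i) m * x m) * (Poly_Mapping.lookup (p j) n * x n))"
      by (simp add: sum.cartesian_product[symmetric] entries_def lookup_quad_tensor sum_distrib_right sum_distrib_left mult_ac)
    also have "\<dots> = (\<Sum>(i, j)\<in>{..<r} \<times> {..<r}. \<Sum>(m, n)\<in>X \<times> X. q i j * (Poly_Mapping.lookup (p i) m * x m) * (Poly_Mapping.lookup (p j) n * x n))"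
      unfolding split_def by (rule sum.swap)
    also have "\<dots> = (\<Sum>i<r. \<Sum>j<r. q i j * (y i * y j))"
    proof -
      have "q i j * (y i * y j) = (\<Sum>m\<in>X. \<Sum>n\<in>X. q i j * (Poly_Mapping.lookup (p i) m * x m) * (Poly_Mapping.lookup (p j) n * x n))" for i j
        unfolding y_def sum_product by (simp add: sum_distrib_left mult.assoc)
      then show ?thesis by (simp add: sum.cartesian_product[symmetric])
    qed
    finally show ?thesis .
  qed
  have "(\<Sum>m\<in>X. \<Sum>n\<in>X. (entries (gram_tensor r p) m n + s * entries (quad_tensor r q p) m n) * x m * x n) =
      (\<Sum>m\<in>X. \<Sum>n\<in>X. entries (gram_tensor r p) m n * x m * x n) +
      s * (\<Sum>m\<in>X. \<Sum>n\<in>X. entries (quad_tensor r q p) m n * x m * x n)"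
    by (simp add: sum.distrib distrib_right sum_distrib_left mult.assoc)
  also have "\<dots> = Y + s * (\<Sum>i<r. \<Sum>j<r. q i j * (y i * y j))"
    unfolding quad gram_tensor_eq_quad_tensor
    by (simp add: Y_def power2_eq_square if_distrib[of "\<lambda>a. a * _"] cong: if_cong)
  also have "\<dots> \<ge> 0"
  proof -
    have yY: "\<bar>y i * y j\<bar> \<le> Y" if "i < r" "j < r" for i j
    proof -
      have "(y i)\<^sup>2 \<le> Y" "(y j)\<^sup>2 \<le> Y" unfolding Y_def using that by (auto intro!: member_le_sum)
      moreover have "2 * \<bar>y i * y j\<bar> \<le> (y i)\<^sup>2 + (y j)\<^sup>2"
        using sum_squares_bound[of "\<bar>y i\<bar>" "\<bar>y j\<bar>"] by (simp add: abs_mult)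
      ultimately show ?thesis by linarith
    qed
    have "Y \<ge> 0" by (simp add: Y_def sum_nonneg)
    have "\<bar>\<Sum>i<r. \<Sum>j<r. q i j * (y i * y j)\<bar> \<le> (\<Sum>i<r. \<Sum>j<r. \<bar>q i j\<bar> * Y)"
    proof (intro order_trans[OF sum_abs] sum_mono)
      fix i j assume "i \<in> {..<r}" "j \<in> {..<r}"
      then show "\<bar>q i j * (y i * y j)\<bar> \<le> \<bar>q i j\<bar> * Y"
        using yY[of i j] unfolding abs_mult[of "q i j"] by (intro mult_left_mono) auto
    qed
    also have "\<dots> = (\<Sum>i<r. \<Sum>j<r. \<bar>q i j\<bar>) * Y" by (simp add: sum_distrib_right)
    finally have "\<bar>s * (\<Sum>i<r. \<Sum>j<r. q i j * (y i * y j))\<bar> \<le> \<bar>s\<bar> * ((\<Sum>i<r. \<Sum>j<r. \<bar>q i j\<bar>) * Y)"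
      by (simp add: abs_mult mult_left_mono)
    also have "\<dots> \<le> Y" using mult_right_mono[OF s \<open>Y \<ge> 0\<close>] by (simp add: mult.assoc)
    finally show ?thesis by linarith
  qed
  finally show "0 \<le> (\<Sum>m\<in>X. \<Sum>n\<in>X. (entries (gram_tensor r p) m n + s * entries (quad_tensor r q p) m n) * x m * x n)" .
qed

text \<open>A relation \<open>\<Sum> q\<^sub>i\<^sub>j p\<^sub>i p\<^sub>j = 0\<close> gives a segment \<open>\<theta> \<plusminus> s Q\<close> in the Gram spectrahedron with midpoint \<open>\<theta>\<close>, so
  \<open>Q = 0\<close>, and \<open>q = 0\<close> by independence of the \<open>p\<^sub>j\<close>.\<close>

lemma indep_products_if_extreme_point:
  assumes V: "\<And>j. j < r \<Longrightarrow> p j \<in> binary_forms d" and p: "indep_family r p"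
    and ext: "gram_tensor r p extreme_point_of gram d f"
  shows "indep_products r p"
  unfolding indep_products_def
proof (intro allI impI)
  fix q :: "nat \<Rightarrow> nat \<Rightarrow> real" and i j
  assume sym: "\<forall>i j. q i j = q j i" and q: "mult_map (quad_tensor r q p) = 0" and ij: "i < r" "j < r"
  let ?Q = "quad_tensor r q p" and ?G = "gram_tensor r p"
  define s where "s = 1 / (1 + (\<Sum>i<r. \<Sum>j<r. \<bar>q i j\<bar>))"
  have "0 \<le> (\<Sum>i<r. \<Sum>j<r. \<bar>q i j\<bar>)" by (intro sum_nonneg) auto
  then have s: "s > 0" "\<bar>s\<bar> * (\<Sum>i<r. \<Sum>j<r. \<bar>q i j\<bar>) \<le> 1"
    by (simp_all add: s_def field_simps)
  have G: "mult_map ?G = f" using ext by (simp add: extreme_point_of_def gram_def)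
  have mem: "?G + t *\<^sub>R ?Q \<in> gram d f" if "\<bar>t\<bar> = \<bar>s\<bar>" for t
  proof -
    have entries: "entries (?G + t *\<^sub>R ?Q) = (\<lambda>m n. entries ?G m n + t * entries ?Q m n)"
      by (simp add: fun_eq_iff entries_def lookup_add scaleR_lookup)
    have nonneg: "nonneg_form (mons d) (entries (?G + t *\<^sub>R ?Q))"
      unfolding entries by (rule nonneg_form_perturbed) (use sym s that in auto)
    moreover have "?G + t *\<^sub>R ?Q \<in> sym_tensors d"
      unfolding sym_tensors_iff
    proof (intro conjI allI)
      show "Poly_Mapping.lookup (?G + t *\<^sub>R ?Q) (m, n) = Poly_Mapping.lookup (?G + t *\<^sub>R ?Q) (n, m)" for m n
        using nonneg unfolding nonneg_form_def entries_def by blast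
      show "Poly_Mapping.keys (?G + t *\<^sub>R ?Q) \<subseteq> mons d \<times> mons d"
      proof
        fix mn assume "mn \<in> Poly_Mapping.keys (?G + t *\<^sub>R ?Q)"
        then have "entries ?G (fst mn) (snd mn) + t * entries ?Q (fst mn) (snd mn) \<noteq> 0"
          by (simp add: in_keys_iff entries_def lookup_add scaleR_lookup)
        moreover have "entries ?G m n + t * entries ?Q m n = 0" if "m \<notin> mons d \<or> n \<notin> mons d" for m n
        proof -
          have "Poly_Mapping.lookup (p j) k = 0" if "j < r" "k \<notin> mons d" for j k
            using that lookup_binary_form[OF V] by blast
          then show ?thesis using that by (elim disjE) (simp_all add: entries_def lookup_gram_tensor lookup_quad_tensor)
        qed
        ultimately have "fst mn \<in> mons d" "snd mn \<in> mons d" by blast+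
        then show "mn \<in> mons d \<times> mons d" by (simp add: mem_Times_iff)
      qed
    qed
    ultimately show ?thesis
      using psd_tensors_if_nonneg_form by (simp add: gram_def G q linear_add[OF linear_mult_map] linear_scale[OF linear_mult_map])
  qed
  have "?Q = 0"
  proof (rule ccontr)
    assume "?Q \<noteq> 0"
    have "?G = (1 - 1/2) *\<^sub>R (?G + (- s) *\<^sub>R ?Q) + (1/2) *\<^sub>R (?G + s *\<^sub>R ?Q)"
      by (rule poly_mapping_eqI, simp only: lookup_add scaleR_lookup) (simp add: field_simps)
    moreover have "?G + (- s) *\<^sub>R ?Q \<noteq> ?G + s *\<^sub>R ?Q"
    proof
      assume eq: "?G + (- s) *\<^sub>R ?Q = ?G + s *\<^sub>R ?Q"
      then have "Poly_Mapping.lookup (?G + (- s) *\<^sub>R ?Q) k = Poly_Mapping.lookup (?G + s *\<^sub>R ?Q) k" for k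
        by (simp only: eq)
      then have "s * Poly_Mapping.lookup ?Q k = 0" for k by (simp only: lookup_add scaleR_lookup) (metis add_left_cancel minus_mult_left neg_equal_zero)
      then have "?Q = 0" using s by (intro poly_mapping_eqI) simp
      then show False using \<open>?Q \<noteq> 0\<close> by simp
    qed
    ultimately have "?G \<in> open_segment (?G + (- s) *\<^sub>R ?Q) (?G + s *\<^sub>R ?Q)"
      unfolding in_segment by (intro conjI exI[of _ "1/2"]) auto
    then show False using ext mem[of s] mem[of "- s"] unfolding extreme_point_of_def by auto
  qed
  obtain \<phi> :: "nat \<Rightarrow> poly2 \<Rightarrow> real" where \<phi>: "\<And>i. linear (\<phi> i)" "\<And>i j. j < r \<Longrightarrow> \<phi> i (p j) = (if i = j then 1 else 0)"
    using dual_functionals[OF p] by blast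
  have "0 = \<phi> j (contract (\<phi> i) ?Q)" by (simp add: \<open>?Q = 0\<close> linear_0[OF linear_contract] linear_0[OF \<phi>(1)])
  also have "\<dots> = (\<Sum>a<r. \<Sum>b<r. q a b * (\<phi> i (p a) * \<phi> j (p b)))"
    by (simp add: quad_tensor_def linear_sum[OF linear_contract] linear_scale[OF linear_contract]
        linear_sum[OF \<phi>(1)] linear_scale[OF \<phi>(1)] contract_tensor[OF \<phi>(1)] mult.assoc)
  also have "\<dots> = (\<Sum>a<r. if a = i then \<Sum>b<r. if b = j then q a b else 0 else 0)"
    by (intro sum.cong refl) (auto simp: \<phi> mult_delta_right)
  also have "\<dots> = q i j" using ij by simp
  finally show "q i j = 0" by simp
qed

section \<open>Multiples of coprime polynomials\<close>

text \<open>An element of least degree in the ideal generated by the \<open>P\<^sub>j\<close> divides all of them.\<close>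

lemma ex_Bezout:
  fixes P :: "nat \<Rightarrow> real poly"
  assumes "j0 < r" "P j0 \<noteq> 0" and cop: "\<And>g. (\<And>j. j < r \<Longrightarrow> g dvd P j) \<Longrightarrow> degree g = 0"
  obtains u where "(\<Sum>j<r. u j * P j) = 1"
proof -
  define I where "I = range (\<lambda>u. \<Sum>j<r. u j * P j)"
  have I_comb: "a - c * b \<in> I" if ab: "a \<in> I" "b \<in> I" for a b c
  proof -
    obtain u v where "a = (\<Sum>j<r. u j * P j)" "b = (\<Sum>j<r. v j * P j)" using ab by (auto simp: I_def)
    then have "a - c * b = (\<Sum>j<r. (u j - c * v j) * P j)"
      by (simp add: sum_distrib_left sum_subtractf left_diff_distrib mult.assoc)
    then show ?thesis unfolding I_def by (rule range_eqI[of _ _ "\<lambda>j. u j - c * v j"])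
  qed
  have P_in: "P i \<in> I" if "i < r" for i
  proof -
    have "(\<Sum>j<r. (if j = i then 1 else 0) * P j) = P i" using that by (simp add: mult_delta_left)
    then show ?thesis unfolding I_def by (intro range_eqI[of _ _ "\<lambda>j. if j = i then 1 else 0"]) simp
  qed
  have "\<exists>g. (g \<in> I \<and> g \<noteq> 0) \<and> (\<forall>h. h \<in> I \<and> h \<noteq> 0 \<longrightarrow> degree g \<le> degree h)"
    using P_in assms(1,2) by (intro ex_has_least_nat[of _ "P j0"]) blast
  then obtain g where g: "g \<in> I" "g \<noteq> 0" "\<And>h. h \<in> I \<Longrightarrow> h \<noteq> 0 \<Longrightarrow> degree g \<le> degree h" by blast
  have "g dvd P i" if "i < r" for i
  proof (rule ccontr)
    assume "\<not> g dvd P i"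
    then have "P i mod g \<noteq> 0" by (simp add: mod_eq_0_iff_dvd)
    moreover have "P i mod g \<in> I"
      using I_comb[OF P_in[OF that] g(1), of "P i div g"] by (simp add: minus_div_mult_eq_mod)
    ultimately have "degree g \<le> degree (P i mod g)" using g(3) by blast
    then show False using degree_mod_less'[OF g(2) \<open>P i mod g \<noteq> 0\<close>] by simp
  qed
  then have "degree g = 0" by (rule cop)
  then obtain c where c: "g = [:c:]" by (rule degree_eq_zeroE)
  obtain u where "g = (\<Sum>j<r. u j * P j)" using g(1) by (auto simp: I_def)
  then have "(\<Sum>j<r. ([:1 / c:] * u j) * P j) = [:1 / c:] * g"
    by (simp only: sum_distrib_left mult.assoc)
  also have "\<dots> = 1" using c g(2) by (simp add: one_pCons)
  finally show thesis by (rule that)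
qed

text \<open>Start with any representation \<open>H = \<Sum> P\<^sub>j (H u\<^sub>j)\<close> and reduce the cofactors with \<open>j \<noteq> j\<^sub>0\<close> modulo \<open>P\<^bsub>j\<^sub>0\<^esub>\<close>,
  which has degree exactly \<open>d\<close>. The remaining cofactor then has degree at most \<open>d\<close> as well, since
  all other terms have degree at most \<open>2d\<close>.\<close>

lemma coprime_multiples_surjective:
  fixes P :: "nat \<Rightarrow> real poly"
  assumes deg: "\<And>j. j < r \<Longrightarrow> degree (P j) \<le> d" and j0: "j0 < r" "P j0 \<noteq> 0" "degree (P j0) = d"
    and cop: "\<And>g. (\<And>j. j < r \<Longrightarrow> g dvd P j) \<Longrightarrow> degree g = 0"
    and H: "degree H \<le> 2 * d"
  shows "\<exists>X. (\<forall>j<r. degree (X j) \<le> d) \<and> (\<Sum>j<r. P j * X j) = H"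
proof -
  obtain u where u: "(\<Sum>j<r. u j * P j) = 1" using ex_Bezout[where P = P, OF j0(1,2) cop] by blast
  define Q where "Q = P j0"
  define v where "v j = (H * u j) mod Q" for j
  define w where "w = H * u j0 + (\<Sum>j\<in>{..<r} - {j0}. (H * u j) div Q * P j)"
  define X where "X j = (if j = j0 then w else v j)" for j
  have "H = (\<Sum>j<r. H * u j * P j)" using u by (simp add: sum_distrib_left[symmetric] mult.assoc)
  also have "\<dots> = H * u j0 * Q + (\<Sum>j\<in>{..<r} - {j0}. H * u j * P j)"
    using j0(1) by (simp add: sum.remove[of _ j0] Q_def)
  also have "(\<Sum>j\<in>{..<r} - {j0}. H * u j * P j) = (\<Sum>j\<in>{..<r} - {j0}. Q * ((H * u j) div Q * P j) + P j * v j)"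
  proof (intro sum.cong refl)
    fix j
    have "H * u j * P j = (H * u j div Q * Q + v j) * P j" by (simp only: v_def div_mult_mod_eq)
    also have "\<dots> = Q * ((H * u j) div Q * P j) + P j * v j" 
    proof -
      have "(a * b + c) * e = b * (a * e) + e * c" for a b c e :: "real poly" by (simp add: algebra_simps)
      then show ?thesis .
    qed
    finally show "H * u j * P j = Q * ((H * u j) div Q * P j) + P j * v j" .
  qed
  finally have H_eq: "H = Q * w + (\<Sum>j\<in>{..<r} - {j0}. P j * v j)"
    by (simp add: w_def sum.distrib sum_distrib_left algebra_simps)
  have "(\<Sum>j<r. P j * X j) = H"
    unfolding H_eq using j0(1) by (simp add: sum.remove[of _ j0] X_def Q_def)
  have Q0: "Q \<noteq> 0" "degree Q = d" using j0 by (auto simp: Q_def)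
  have dv: "degree (v j) \<le> d" for j
    using degree_mod_less[OF Q0(1), of "H * u j"] Q0(2) by (auto simp: v_def)
  have "degree (\<Sum>j\<in>{..<r} - {j0}. P j * v j) \<le> 2 * d"
  proof (rule degree_sum_le)
    fix j assume "j \<in> {..<r} - {j0}"
    then show "degree (P j * v j) \<le> 2 * d" using deg[of j] dv[of j] degree_mult_le[of "P j" "v j"] by simp
  qed simp
  then have "degree (H - (\<Sum>j\<in>{..<r} - {j0}. P j * v j)) \<le> 2 * d" using H by (intro degree_diff_le)
  moreover have "H - (\<Sum>j\<in>{..<r} - {j0}. P j * v j) = Q * w" by (simp add: H_eq)
  ultimately have "degree (Q * w) \<le> 2 * d" by simp
  then have "degree w \<le> d" using Q0 by (cases "w = 0") (auto simp: degree_mult_eq)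
  then show ?thesis using dv \<open>(\<Sum>j<r. P j * X j) = H\<close> by (intro exI[of _ X]) (auto simp: X_def)
qed

section \<open>Dehomogenization\<close>

text \<open>Setting \<open>x\<^sub>2 = 1\<close> in a form of degree \<open>d\<close>.\<close>

definition dehomogenize :: "nat \<Rightarrow> poly2 \<Rightarrow> real poly" where
  "dehomogenize d p = (\<Sum>i\<le>d. monom (Poly_Mapping.lookup p (i, d - i)) i)"

definition homogenize :: "nat \<Rightarrow> real poly \<Rightarrow> poly2" where
  "homogenize d P = form_of d (\<lambda>n. coeff P (fst n))"

lemma coeff_dehomogenize: "coeff (dehomogenize d p) i = (if i \<le> d then Poly_Mapping.lookup p (i, d - i) else 0)"
  by (simp add: dehomogenize_def coeff_sum)

lemma degree_dehomogenize: "degree (dehomogenize d p) \<le> d"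
  by (rule degree_le) (simp add: coeff_dehomogenize)

lemma homogenize_in_binary_forms: "homogenize d P \<in> binary_forms d"
  by (simp add: homogenize_def form_of_in_binary_forms)

lemma dehomogenize_homogenize: "degree P \<le> d \<Longrightarrow> dehomogenize d (homogenize d P) = P"
  by (rule poly_eqI) (auto simp: coeff_dehomogenize homogenize_def lookup_form_of mons_def coeff_eq_0)

lemma homogenize_dehomogenize: "p \<in> binary_forms d \<Longrightarrow> homogenize d (dehomogenize d p) = p"
proof (rule poly_mapping_eqI)
  fix n assume "p \<in> binary_forms d"
  from lookup_binary_form[OF this, of n] show "Poly_Mapping.lookup (homogenize d (dehomogenize d p)) n = Poly_Mapping.lookup p n"
    by (cases n) (auto simp: homogenize_def lookup_form_of coeff_dehomogenize mons_def)
qed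

lemma dehomogenize_sum: "dehomogenize d (\<Sum>i\<in>I. p i) = (\<Sum>i\<in>I. dehomogenize d (p i))"
  by (rule poly_eqI) (simp add: coeff_dehomogenize coeff_sum lookup_sum)

lemma dehomogenize_eq_iff:
  assumes "p \<in> binary_forms d" "q \<in> binary_forms d"
  shows "dehomogenize d p = dehomogenize d q \<longleftrightarrow> p = q"
  using homogenize_dehomogenize[OF assms(1)] homogenize_dehomogenize[OF assms(2)] by metis

lemma lookup_mult_map:
  assumes "Poly_Mapping.keys \<theta> \<subseteq> mons d \<times> mons d"
  shows "Poly_Mapping.lookup (mult_map \<theta>) k =
    (\<Sum>(m, n)\<in>mons d \<times> mons d. if m + n = k then Poly_Mapping.lookup \<theta> (m, n) else 0)"
  unfolding mult_map_superset[OF _ assms, simplified]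
  by (simp add: lookup_sum case_prod_beta lookup_single when_def cong: if_cong)

lemma keys_mult_map:
  assumes "Poly_Mapping.keys \<theta> \<subseteq> mons d \<times> mons d"
  shows "mult_map \<theta> \<in> binary_forms (2 * d)"
  unfolding binary_forms_iff
proof
  fix k assume "k \<in> Poly_Mapping.keys (mult_map \<theta>)"
  then have "(\<Sum>(m, n)\<in>mons d \<times> mons d. if m + n = k then Poly_Mapping.lookup \<theta> (m, n) else 0) \<noteq> 0"
    by (simp add: in_keys_iff lookup_mult_map[OF assms])
  then obtain mn where "mn \<in> mons d \<times> mons d" "(case mn of (m, n) \<Rightarrow> if m + n = k then Poly_Mapping.lookup \<theta> (m, n) else 0) \<noteq> 0"
    by (rule sum.not_neutral_contains_not_neutral)
  then show "k \<in> mons (2 * d)" by (auto simp: mons_def split: if_splits)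
qed

lemma mult_in_binary_forms: "p \<in> binary_forms d \<Longrightarrow> q \<in> binary_forms d \<Longrightarrow> p * q \<in> binary_forms (2 * d)"
  using keys_mult_map[of "tensor p q" d] by (auto simp: mult_map_tensor keys_tensor binary_forms_iff)

lemma mons_iff: "(i, j) \<in> mons d \<longleftrightarrow> i \<le> d \<and> j = d - i"
  by (auto simp: mons_def)

lemma dehomogenize_mult:
  assumes "p \<in> binary_forms d" "q \<in> binary_forms d"
  shows "dehomogenize (2 * d) (p * q) = dehomogenize d p * dehomogenize d q"
proof (rule poly_eqI)
  fix k
  show "coeff (dehomogenize (2 * d) (p * q)) k = coeff (dehomogenize d p * dehomogenize d q) k"
  proof (cases "k \<le> 2 * d")
    case True
    have "coeff (dehomogenize (2 * d) (p * q)) k = Poly_Mapping.lookup (mult_map (tensor p q)) (k, 2 * d - k)"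
      using True by (simp add: coeff_dehomogenize mult_map_tensor)
    also have "\<dots> = (\<Sum>(m, n)\<in>mons d \<times> mons d. if m + n = (k, 2 * d - k) then Poly_Mapping.lookup p m * Poly_Mapping.lookup q n else 0)"
      by (subst lookup_mult_map[of _ d]) (use assms in \<open>auto simp: keys_tensor binary_forms_iff lookup_tensor intro!: sum.cong\<close>)
    also have "\<dots> = (\<Sum>(i, j)\<in>{..d} \<times> {..d}. if i + j = k then Poly_Mapping.lookup p (i, d - i) * Poly_Mapping.lookup q (j, d - j) else 0)"
      by (rule sum.reindex_bij_witness[of _ "\<lambda>(i, j). ((i, d - i), (j, d - j))" "\<lambda>(m, n). (fst m, fst n)"])
         (use True in \<open>auto simp: mons_iff\<close>)
    also have "\<dots> = (\<Sum>i\<le>d. \<Sum>j\<le>d. if i + j = k then coeff (dehomogenize d p) i * coeff (dehomogenize d q) j else 0)"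
      by (simp add: sum.cartesian_product[symmetric] coeff_dehomogenize cong: if_cong)
    also have "\<dots> = coeff (\<Sum>i\<le>d. \<Sum>j\<le>d. monom (coeff (dehomogenize d p) i) i * monom (coeff (dehomogenize d q) j) j) k"
      by (simp add: coeff_sum mult_monom)
    also have "(\<Sum>i\<le>d. \<Sum>j\<le>d. monom (coeff (dehomogenize d p) i) i * monom (coeff (dehomogenize d q) j) j) = dehomogenize d p * dehomogenize d q"
      by (simp add: sum_product[symmetric] poly_as_sum_of_monoms'[OF degree_dehomogenize])
    finally show ?thesis .
  next
    case False
    have "degree (dehomogenize d p * dehomogenize d q) < k"
      using degree_mult_le[of "dehomogenize d p" "dehomogenize d q"] degree_dehomogenize[of d p] degree_dehomogenize[of d q] False by linarith
    then show ?thesis using False by (simp add: coeff_dehomogenize coeff_eq_0)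
  qed
qed

section \<open>Local coordinates on Gram tensors of fixed rank\<close>

text \<open>The coordinates of the linear space \<open>E\<close> of tuples \<open>(p\<^sub>0, \<dots>, p\<^sub>r\<^sub>-\<^sub>1)\<close> of forms such that \<open>p\<^sub>j\<close> vanishes at
  the pivot monomials \<open>M i\<close> with \<open>i < j\<close>. A tuple is stored as one finitely supported function on
  pairs of an index and a monomial, so that invariance of domain applies.\<close>

definition chart_keys :: "nat \<Rightarrow> (nat \<Rightarrow> mono2) \<Rightarrow> nat \<Rightarrow> (nat \<times> mono2) set" where
  "chart_keys d M r = {(j, n). j < r \<and> n \<in> mons d \<and> n \<notin> M ` {..<j}}"

lemma finite_chart_keys [simp]: "finite (chart_keys d M r)"
  by (rule finite_subset[of _ "{..<r} \<times> mons d"]) (auto simp: chart_keys_def)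

lemma card_chart_keys:
  assumes "inj_on M {..<r}" "\<And>j. j < r \<Longrightarrow> M j \<in> mons d"
  shows "card (chart_keys d M r) = (\<Sum>j<r. d + 1 - j)"
proof -
  have "chart_keys d M r = Sigma {..<r} (\<lambda>j. mons d - M ` {..<j})" by (auto simp: chart_keys_def)
  moreover have "card (mons d - M ` {..<j}) = d + 1 - j" if "j < r" for j
  proof -
    have "card (M ` {..<j}) = j" using assms(1) that by (subst card_image) (auto intro: inj_on_subset)
    moreover have "M ` {..<j} \<subseteq> mons d" using assms(2) that by auto
    ultimately show ?thesis by (simp add: card_Diff_subset card_mons)
  qed
  ultimately show ?thesis by simp
qed

definition component :: "(nat \<times> mono2 \<Rightarrow>\<^sub>0 real) \<Rightarrow> nat \<Rightarrow> poly2" where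
  "component q j = (\<Sum>k\<in>Poly_Mapping.keys q. if fst k = j then Poly_Mapping.single (snd k) (Poly_Mapping.lookup q k) else 0)"

lemma lookup_component: "Poly_Mapping.lookup (component q j) n = Poly_Mapping.lookup q (j, n)"
proof -
  have "Poly_Mapping.lookup (component q j) n = (\<Sum>k\<in>Poly_Mapping.keys q. if k = (j, n) then Poly_Mapping.lookup q (j, n) else 0)"
    unfolding component_def lookup_sum by (intro sum.cong refl) (auto simp: lookup_single when_def)
  then show ?thesis by (simp add: in_keys_iff)
qed

definition pack :: "nat \<Rightarrow> nat \<Rightarrow> (nat \<Rightarrow> poly2) \<Rightarrow> (nat \<times> mono2 \<Rightarrow>\<^sub>0 real)" where
  "pack d r p = (\<Sum>k\<in>{..<r} \<times> mons d. Poly_Mapping.single k (Poly_Mapping.lookup (p (fst k)) (snd k)))"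

lemma lookup_pack:
  "Poly_Mapping.lookup (pack d r p) (j, n) = (if j < r \<and> n \<in> mons d then Poly_Mapping.lookup (p j) n else 0)"
proof -
  have "Poly_Mapping.lookup (pack d r p) (j, n) =
      (\<Sum>k\<in>{..<r} \<times> mons d. if k = (j, n) then Poly_Mapping.lookup (p j) n else 0)"
    unfolding pack_def lookup_sum by (intro sum.cong refl) (auto simp: lookup_single when_def)
  then show ?thesis by simp
qed

lemma component_pack:
  assumes "\<And>j. j < r \<Longrightarrow> p j \<in> binary_forms d" "j < r"
  shows "component (pack d r p) j = p j"
proof (rule poly_mapping_eqI)
  fix n
  show "Poly_Mapping.lookup (component (pack d r p) j) n = Poly_Mapping.lookup (p j) n"
    using lookup_binary_form[OF assms(1)[OF assms(2)], of n] assms(2) by (simp add: lookup_component lookup_pack)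
qed

lemma component_in_binary_forms: "Poly_Mapping.keys q \<subseteq> chart_keys d M r \<Longrightarrow> component q j \<in> binary_forms d"
  unfolding binary_forms_iff
proof
  fix n assume q: "Poly_Mapping.keys q \<subseteq> chart_keys d M r" and "n \<in> Poly_Mapping.keys (component q j)"
  then have "(j, n) \<in> Poly_Mapping.keys q" by (simp add: in_keys_iff lookup_component)
  then show "n \<in> mons d" using q by (auto simp: chart_keys_def)
qed

lemma lookup_outside_chart:
  "Poly_Mapping.keys q \<subseteq> chart_keys d M r \<Longrightarrow> k \<notin> chart_keys d M r \<Longrightarrow> Poly_Mapping.lookup q k = 0"
  by (metis in_keys_iff subsetD)

lemma keys_pack:
  assumes "triangular M r p"
  shows "Poly_Mapping.keys (pack d r p) \<subseteq> chart_keys d M r"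
proof
  fix k assume "k \<in> Poly_Mapping.keys (pack d r p)"
  then have k: "fst k < r" "snd k \<in> mons d" "Poly_Mapping.lookup (p (fst k)) (snd k) \<noteq> 0"
    using lookup_pack[of d r p "fst k" "snd k"] by (simp_all add: in_keys_iff split: if_splits)
  then have "snd k \<notin> M ` {..<fst k}" using assms by (auto simp: triangular_def)
  then show "k \<in> chart_keys d M r" using k by (cases k) (simp add: chart_keys_def)
qed

lemma pack_component:
  assumes "Poly_Mapping.keys q \<subseteq> chart_keys d M r"
  shows "pack d r (component q) = q"
proof (rule poly_mapping_eqI)
  fix k :: "nat \<times> mono2"
  obtain j n where k: "k = (j, n)" by (cases k)
  have "Poly_Mapping.lookup q (j, n) = 0" if "\<not> (j < r \<and> n \<in> mons d)"
    using that by (intro lookup_outside_chart[OF assms]) (auto simp: chart_keys_def)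
  then show "Poly_Mapping.lookup (pack d r (component q)) k = Poly_Mapping.lookup q k"
    by (auto simp: k lookup_pack lookup_component)
qed

lemma triangular_component:
  assumes "Poly_Mapping.keys q \<subseteq> chart_keys d M r" "\<And>j. j < r \<Longrightarrow> Poly_Mapping.lookup q (j, M j) > 0"
  shows "triangular M r (component q)"
proof -
  have "Poly_Mapping.lookup q (j, M i) = 0" if "i < j" for i j
    using that by (intro lookup_outside_chart[OF assms(1)]) (auto simp: chart_keys_def)
  then show ?thesis using assms(2) by (simp add: triangular_def lookup_component)
qed

text \<open>The functions of a tensor from which local coordinates are chosen: the coefficients of its image
  under the multiplication, and its entries.\<close>

fun observable :: "nat \<Rightarrow> (mono2 \<Rightarrow> mono2 \<Rightarrow> real) \<Rightarrow> mono2 + mono2 \<times> mono2 \<Rightarrow> real" where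
  "observable d F (Inl k) = (\<Sum>(m, n)\<in>mons d \<times> mons d. if m + n = k then F m n else 0)"
| "observable d F (Inr mn) = F (fst mn) (snd mn)"

lemma observable_diff: "observable d (\<lambda>m n. F m n - G m n) b = observable d F b - observable d G b"
  by (cases b) (auto simp: sum_subtractf[symmetric] case_prod_beta intro!: sum.cong)

lemma observable_sum: "observable d (\<lambda>m n. \<Sum>k\<in>K. F k m n * x k) b = (\<Sum>k\<in>K. observable d (F k) b * x k)"
proof (cases b)
  case (Inl l)
  have "observable d (\<lambda>m n. \<Sum>k\<in>K. F k m n * x k) b =
      (\<Sum>mn\<in>mons d \<times> mons d. \<Sum>k\<in>K. (if fst mn + snd mn = l then F k (fst mn) (snd mn) else 0) * x k)"
    unfolding Inl by (simp add: case_prod_beta) (intro sum.cong refl, auto)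
  also have "\<dots> = (\<Sum>k\<in>K. \<Sum>mn\<in>mons d \<times> mons d. (if fst mn + snd mn = l then F k (fst mn) (snd mn) else 0) * x k)"
    by (rule sum.swap)
  finally show ?thesis by (simp add: Inl case_prod_beta sum_distrib_right)
qed simp

lemma observable_entries:
  assumes "\<theta> \<in> sym_tensors d"
  shows "observable d (entries \<theta>) (Inl k) = Poly_Mapping.lookup (mult_map \<theta>) k"
proof -
  have keys: "Poly_Mapping.keys \<theta> \<subseteq> mons d \<times> mons d" using assms by (simp only: sym_tensors_iff)
  show ?thesis unfolding lookup_mult_map[OF keys] observable.simps entries_def ..
qed

lemma tendsto_observable:
  assumes "\<And>m n. ((\<lambda>s. F s m n) \<longlongrightarrow> G m n) L"
  shows "((\<lambda>s. observable d (F s) b) \<longlongrightarrow> observable d G b) L"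
  by (cases b) (auto simp: case_prod_beta assms intro!: tendsto_intros)

lemma continuous_on_observable:
  assumes "\<And>m n. continuous_on S (\<lambda>s. F s m n)"
  shows "continuous_on S (\<lambda>s. observable d (F s) b)"
  using assms unfolding continuous_on_def by (auto intro: tendsto_observable)

text \<open>The polarization of the map from tuples to Gram tensors, at the level of entries.\<close>

definition polar :: "nat \<Rightarrow> (nat \<times> mono2 \<Rightarrow> real) \<Rightarrow> (nat \<times> mono2 \<Rightarrow> real) \<Rightarrow> mono2 \<Rightarrow> mono2 \<Rightarrow> real" where
  "polar r s x m n = (\<Sum>j<r. s (j, m) * x (j, n) + x (j, m) * s (j, n))"

definition polar_matrix :: "nat \<Rightarrow> nat \<Rightarrow> (nat \<times> mono2 \<Rightarrow> real) \<Rightarrow> mono2 + mono2 \<times> mono2 \<Rightarrow> nat \<times> mono2 \<Rightarrow> real" where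
  "polar_matrix d r s b k = observable d (polar r s (\<lambda>l. if l = k then 1 else 0)) b"

lemma polar_matrix_mult:
  assumes "finite K" "\<And>k. k \<notin> K \<Longrightarrow> x k = 0"
  shows "observable d (polar r s x) b = (\<Sum>k\<in>K. polar_matrix d r s b k * x k)"
proof -
  have x: "x l = (\<Sum>k\<in>K. (if l = k then 1 else 0) * x k)" for l
    using assms by (auto simp: mult_delta_left)
  have "polar r s x = (\<lambda>m n. \<Sum>k\<in>K. polar r s (\<lambda>l. if l = k then 1 else 0) m n * x k)"
  proof (intro ext)
    fix m n
    have "polar r s x m n = (\<Sum>j<r. \<Sum>k\<in>K. (s (j, m) * (if (j, n) = k then 1 else 0) + (if (j, m) = k then 1 else 0) * s (j, n)) * x k)"
      unfolding polar_def
    proof (intro sum.cong refl)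
      fix j
      show "s (j, m) * x (j, n) + x (j, m) * s (j, n) =
          (\<Sum>k\<in>K. (s (j, m) * (if (j, n) = k then 1 else 0) + (if (j, m) = k then 1 else 0) * s (j, n)) * x k)"
        by (subst x[of "(j, n)"], subst x[of "(j, m)"])
           (simp add: sum_distrib_left sum_distrib_right distrib_left distrib_right sum.distrib mult_ac)
    qed
    then show "polar r s x m n = (\<Sum>k\<in>K. polar r s (\<lambda>l. if l = k then 1 else 0) m n * x k)"
      unfolding polar_def sum_distrib_right by (subst (asm) sum.swap)
  qed
  then show ?thesis unfolding polar_matrix_def observable_sum[symmetric] by simp
qed

text \<open>The analogue of \<open>a\<^sup>2 - b\<^sup>2 = (a + b)(a - b)\<close>. The difference of two Gram tensors is the derivative at
  the midpoint of the tuples, applied to their difference, without any error term.\<close>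

lemma polar_difference:
  "(\<Sum>j<r. q (j, m) * q (j, n)) - (\<Sum>j<r. q' (j, m) * q' (j, n)) =
    polar r (\<lambda>k. (q k + q' k) / 2) (\<lambda>k. q k - q' k) m n"
  unfolding polar_def sum_subtractf[symmetric] by (intro sum.cong refl) (simp add: field_simps)

text \<open>The map from triangular tuples to tensors is an immersion: by induction on \<open>i\<close> the row of the pivot
  \<open>M i\<close> determines the component \<open>i\<close> of the tangent vector.\<close>

lemma polar_injective:
  assumes M: "\<And>j. j < r \<Longrightarrow> M j \<in> mons d" and tri: "triangular M r p"
    and x: "\<And>k. k \<notin> chart_keys d M r \<Longrightarrow> x k = 0"
    and zero: "\<And>m n. m \<in> mons d \<Longrightarrow> n \<in> mons d \<Longrightarrow> polar r (\<lambda>(j, n). Poly_Mapping.lookup (p j) n) x m n = 0"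
  shows "x (i, n) = 0"
proof (cases "(i, n) \<in> chart_keys d M r")
  case True
  then have "i < r" "n \<in> mons d" by (auto simp: chart_keys_def)
  then show ?thesis
  proof (induction i arbitrary: n rule: less_induct)
    case (less i)
    have x0: "x (j, M i) = 0" if "j < r" "j \<noteq> i" for j
    proof (cases "j < i")
      case True
      then show ?thesis using less.IH[OF True that(1) M[OF less.prems(1)]] by simp
    next
      case False
      then show ?thesis using that by (intro x) (auto simp: chart_keys_def)
    qed
    have pivot_entry: "polar r (\<lambda>(j, n). Poly_Mapping.lookup (p j) n) x (M i) n =
        Poly_Mapping.lookup (p i) (M i) * x (i, n) + x (i, M i) * Poly_Mapping.lookup (p i) n" if "n \<in> mons d" for n
    proof -
      have "Poly_Mapping.lookup (p j) (M i) * x (j, n) + x (j, M i) * Poly_Mapping.lookup (p j) n = 0"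
        if "j < r" "j \<noteq> i" for j
      proof (cases "j < i")
        case True
        then show ?thesis using x0[OF that] less.IH[OF True that(1) \<open>n \<in> mons d\<close>] by simp
      next
        case False
        then have "Poly_Mapping.lookup (p j) (M i) = 0" using tri that by (simp add: triangular_def)
        then show ?thesis using x0[OF that] by simp
      qed
      then have "polar r (\<lambda>(j, n). Poly_Mapping.lookup (p j) n) x (M i) n =
          (\<Sum>j\<in>{i}. Poly_Mapping.lookup (p j) (M i) * x (j, n) + x (j, M i) * Poly_Mapping.lookup (p j) n)"
        unfolding polar_def prod.case by (intro sum.mono_neutral_right) (use less.prems in auto)
      then show ?thesis by simp
    qed
    have pos: "Poly_Mapping.lookup (p i) (M i) > 0" using tri less.prems by (simp add: triangular_def)
    have "x (i, M i) = 0"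
      using pivot_entry[of "M i"] zero[of "M i" "M i"] M less.prems pos by auto
    then show ?case using pivot_entry[OF less.prems(2)] zero[of "M i" n] M less.prems pos by auto
  qed
qed (rule x)

lemma triangular_solve:
  assumes tri: "triangular M r p" and "k \<le> r"
  shows "\<exists>a. \<forall>i<k. b i + (\<Sum>l<k. a l * Poly_Mapping.lookup (p l) (M i)) = 0"
  using assms(2)
proof (induction k)
  case (Suc k)
  then obtain a where a: "\<And>i. i < k \<Longrightarrow> b i + (\<Sum>l<k. a l * Poly_Mapping.lookup (p l) (M i)) = 0" by auto
  define a' where "a' = a(k := - (b k + (\<Sum>l<k. a l * Poly_Mapping.lookup (p l) (M k))) / Poly_Mapping.lookup (p k) (M k))"
  have s: "(\<Sum>l<k. a' l * Poly_Mapping.lookup (p l) (M i)) = (\<Sum>l<k. a l * Poly_Mapping.lookup (p l) (M i))" for i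
    by (intro sum.cong) (auto simp: a'_def)
  have pk: "Poly_Mapping.lookup (p k) (M k) > 0" "\<And>i. i < k \<Longrightarrow> Poly_Mapping.lookup (p k) (M i) = 0"
    using tri Suc.prems by (auto simp: triangular_def)
  have "b i + (\<Sum>l<Suc k. a' l * Poly_Mapping.lookup (p l) (M i)) = 0" if "i < Suc k" for i
  proof (cases "i = k")
    case True
    then show ?thesis using pk(1) by (simp add: s) (simp add: a'_def)
  next
    case False
    then show ?thesis using that a[of i] pk(2)[of i] by (simp add: s)
  qed
  then show ?case by blast
qed simp

lemma mult_scaleR_poly2: "u * (c *\<^sub>R v) = c *\<^sub>R (u * v :: poly2)"
proof -
  have "tensor u (c *\<^sub>R v) = c *\<^sub>R tensor u v"
    by (rule poly_mapping_eqI) (metis (no_types) lookup_tensor scaleR_lookup mult.left_commute prod.collapse)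
  then show ?thesis using linear_scale[OF linear_mult_map, of c "tensor u v"] by (simp add: mult_map_tensor[symmetric])
qed

text \<open>The sum \<open>\<Sum> p\<^sub>j X\<^sub>j\<close> does not change if \<open>\<Sum>\<^sub>l s\<^sub>j\<^sub>l p\<^sub>l\<close> with a skew-symmetric \<open>s\<close> is added to \<open>X\<^sub>j\<close>: these are the tangent
  directions of the orthogonal group. They can be used to move any \<open>X\<close> into the space \<open>E\<close>.\<close>

lemma ex_chart_direction:
  fixes X p :: "nat \<Rightarrow> poly2"
  assumes V: "\<And>j. j < r \<Longrightarrow> p j \<in> binary_forms d" and X: "\<And>j. j < r \<Longrightarrow> X j \<in> binary_forms d"
    and tri: "triangular M r p"
  obtains Y where "\<And>j. j < r \<Longrightarrow> Y j \<in> binary_forms d" "\<And>i j. i < j \<Longrightarrow> j < r \<Longrightarrow> Poly_Mapping.lookup (Y j) (M i) = 0"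
    "(\<Sum>j<r. p j * Y j) = (\<Sum>j<r. p j * X j)"
proof -
  have "\<forall>j. \<exists>a. j < r \<longrightarrow> (\<forall>i<j. Poly_Mapping.lookup (X j) (M i) + (\<Sum>l<j. a l * Poly_Mapping.lookup (p l) (M i)) = 0)"
    using triangular_solve[OF tri] by (meson less_imp_le)
  then obtain a where "\<forall>j. j < r \<longrightarrow> (\<forall>i<j. Poly_Mapping.lookup (X j) (M i) + (\<Sum>l<j. a j l * Poly_Mapping.lookup (p l) (M i)) = 0)"
    unfolding choice_iff by blast
  then have a: "i < j \<Longrightarrow> j < r \<Longrightarrow>
      Poly_Mapping.lookup (X j) (M i) + (\<Sum>l<j. a j l * Poly_Mapping.lookup (p l) (M i)) = 0" for i j
    by blast
  \<comment> \<open>The component \<open>j\<close> is corrected by the \<open>p l\<close> with \<open>l < j\<close>; the skew-symmetric counterparts, with \<open>l > j\<close>, vanish at the pivots \<open>M i\<close> with \<open>i < j\<close>.\<close>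
  define s where "s j l = (if l < j then a j l else if j < l then - a l j else 0)" for j l
  define Y where "Y j = X j + (\<Sum>l<r. s j l *\<^sub>R p l)" for j
  show thesis
  proof (rule that)
    show "Y j \<in> binary_forms d" if "j < r" for j
      unfolding Y_def using subspace_binary_forms X V that
      by (intro subspace_add subspace_sum subspace_scale) auto
    show "Poly_Mapping.lookup (Y j) (M i) = 0" if ij: "i < j" "j < r" for i j
    proof -
      have "(\<Sum>l<r. s j l * Poly_Mapping.lookup (p l) (M i)) = (\<Sum>l<j. a j l * Poly_Mapping.lookup (p l) (M i))"
      proof (rule sum.mono_neutral_cong_right)
        show "\<forall>l\<in>{..<r} - {..<j}. s j l * Poly_Mapping.lookup (p l) (M i) = 0"
          using tri ij by (auto simp: s_def triangular_def)
      qed (use ij in \<open>auto simp: s_def\<close>)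
      then show ?thesis using a[OF ij] by (simp add: Y_def lookup_add lookup_sum scaleR_lookup)
    qed
    have skew: "(\<Sum>j<r. \<Sum>l<r. s j l *\<^sub>R (p j * p l)) = 0" (is "?S = 0")
    proof -
      have "?S = (\<Sum>l<r. \<Sum>j<r. s j l *\<^sub>R (p j * p l))" by (rule sum.swap)
      also have "\<dots> = - ?S"
        unfolding sum_negf[symmetric] by (intro sum.cong refl) (auto simp: s_def mult.commute)
      finally have "2 *\<^sub>R ?S = 0" by (simp only: scaleR_2 eq_neg_iff_add_eq_0)
      then show ?thesis by simp
    qed
    have "(\<Sum>j<r. p j * Y j) = (\<Sum>j<r. p j * X j) + ?S"
      by (simp add: Y_def distrib_left sum_distrib_left sum.distrib mult_scaleR_poly2)
    then show "(\<Sum>j<r. p j * Y j) = (\<Sum>j<r. p j * X j)" by (simp add: skew)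
  qed
qed

text \<open>The derivative of \<open>(p\<^sub>j) \<mapsto> \<Sum> p\<^sub>j\<^sup>2\<close> is onto.\<close>

definition spans_multiples :: "nat \<Rightarrow> nat \<Rightarrow> (nat \<Rightarrow> poly2) \<Rightarrow> bool" where
  "spans_multiples d r p \<longleftrightarrow>
     (\<forall>h\<in>binary_forms (2 * d). \<exists>X. (\<forall>j<r. X j \<in> binary_forms d) \<and> (\<Sum>j<r. p j * X j) = h)"

lemma polar_surjective:
  assumes V: "\<And>j. j < r \<Longrightarrow> p j \<in> binary_forms d" and tri: "triangular M r p" and span: "spans_multiples d r p"
  shows "surjective_system (chart_keys d M r) (Inl ` mons (2 * d)) (polar_matrix d r (\<lambda>(j, n). Poly_Mapping.lookup (p j) n))"
  unfolding surjective_system_def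
proof
  fix y :: "mono2 + mono2 \<times> mono2 \<Rightarrow> real"
  define h where "h = form_of (2 * d) (\<lambda>n. y (Inl n) / 2)"
  have "h \<in> binary_forms (2 * d)" unfolding h_def by (rule form_of_in_binary_forms)
  then obtain X where X0: "\<forall>j<r. X j \<in> binary_forms d" "(\<Sum>j<r. p j * X j) = h"
    using span unfolding spans_multiples_def by (elim ballE exE conjE) auto
  then have X: "X j \<in> binary_forms d" if "j < r" for j using that by blast
  obtain Y where Y: "\<And>j. j < r \<Longrightarrow> Y j \<in> binary_forms d" "\<And>i j. i < j \<Longrightarrow> j < r \<Longrightarrow> Poly_Mapping.lookup (Y j) (M i) = 0"
    "(\<Sum>j<r. p j * Y j) = (\<Sum>j<r. p j * X j)"
    by (rule ex_chart_direction[of r p d X M]) (rule V, assumption, rule X, assumption, rule tri, rule that)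
  have Yh: "(\<Sum>j<r. p j * Y j) = h" using Y(3) X0(2) by simp
  define x where "x = (\<lambda>(j, n). if j < r then Poly_Mapping.lookup (Y j) n else 0)"
  define T where "T = (\<Sum>j<r. tensor (p j) (Y j) + tensor (Y j) (p j))"
  have T: "Poly_Mapping.lookup T (m, n) = polar r (\<lambda>(j, n). Poly_Mapping.lookup (p j) n) x m n" for m n
    unfolding T_def polar_def lookup_sum by (intro sum.cong refl) (simp add: lookup_add lookup_tensor x_def)
  have keys: "Poly_Mapping.keys T \<subseteq> mons d \<times> mons d"
  proof
    fix k assume "k \<in> Poly_Mapping.keys T"
    then have "(\<Sum>j<r. Poly_Mapping.lookup (tensor (p j) (Y j) + tensor (Y j) (p j)) k) \<noteq> 0"
      by (simp add: in_keys_iff T_def lookup_sum)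
    then obtain j where "j < r" "Poly_Mapping.lookup (tensor (p j) (Y j) + tensor (Y j) (p j)) k \<noteq> 0"
      by (meson lessThan_iff sum.not_neutral_contains_not_neutral)
    then have "k \<in> Poly_Mapping.keys (tensor (p j) (Y j)) \<union> Poly_Mapping.keys (tensor (Y j) (p j))"
      by (auto simp: in_keys_iff lookup_add)
    then show "k \<in> mons d \<times> mons d"
      using V[OF \<open>j < r\<close>] Y(1)[OF \<open>j < r\<close>] by (auto simp: keys_tensor binary_forms_iff)
  qed
  have "mult_map T = h + h"
    by (simp add: T_def linear_sum[OF linear_mult_map] linear_add[OF linear_mult_map] mult_map_tensor sum.distrib
        mult.commute[of "Y _"] Yh)
  have "(\<Sum>k\<in>chart_keys d M r. polar_matrix d r (\<lambda>(j, n). Poly_Mapping.lookup (p j) n) (Inl l) k * x k) = y (Inl l)"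
    if "l \<in> mons (2 * d)" for l
  proof -
    have "(\<Sum>k\<in>chart_keys d M r. polar_matrix d r (\<lambda>(j, n). Poly_Mapping.lookup (p j) n) (Inl l) k * x k) =
        observable d (polar r (\<lambda>(j, n). Poly_Mapping.lookup (p j) n) x) (Inl l)"
    proof (rule polar_matrix_mult[symmetric])
      fix k assume "k \<notin> chart_keys d M r"
      then show "x k = 0" using Y(2) lookup_binary_form[OF Y(1)]
        by (cases k) (auto simp: x_def chart_keys_def)
    qed simp
    also have "\<dots> = Poly_Mapping.lookup (mult_map T) l"
      unfolding lookup_mult_map[OF keys] T by simp
    also have "\<dots> = y (Inl l)"
    proof -
      have "Poly_Mapping.lookup h l = y (Inl l) / 2" using that by (simp add: h_def lookup_form_of)
      then show ?thesis unfolding \<open>mult_map T = h + h\<close> lookup_add by simp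
    qed
    finally show ?thesis .
  qed
  then show "\<exists>x. \<forall>b\<in>Inl ` mons (2 * d). (\<Sum>k\<in>chart_keys d M r. polar_matrix d r (\<lambda>(j, n). Poly_Mapping.lookup (p j) n) b k * x k) = y b"
    by blast
qed

definition gram_coordinates :: "nat \<Rightarrow> nat \<Rightarrow> (nat \<times> mono2 \<Rightarrow>\<^sub>0 real) \<Rightarrow> mono2 + mono2 \<times> mono2 \<Rightarrow> real" where
  "gram_coordinates d r q = observable d (entries (gram_tensor r (component q)))"

text \<open>The derivative of the coefficients of \<open>\<Sum> p\<^sub>j\<^sup>2\<close> on \<open>E\<close> is onto and the derivative of all entries is
  injective, so a set \<open>C\<close> of entries completes the former to an invertible square matrix. Its
  invertibility persists at nearby tuples, in particular at the midpoint of two such tuples, and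
  by \<open>polar_difference\<close> this gives injectivity of the coordinates themselves.\<close>

lemma local_coordinates:
  assumes V: "\<And>j. j < r \<Longrightarrow> p j \<in> binary_forms d" and M: "\<And>j. j < r \<Longrightarrow> M j \<in> mons d"
    and tri: "triangular M r p" and span: "spans_multiples d r p"
  obtains C e where "C \<subseteq> mons d \<times> mons d" "2 * d + 1 + card C = card (chart_keys d M r)" "e > 0"
    "\<forall>q q'. Poly_Mapping.keys q \<subseteq> chart_keys d M r \<longrightarrow> Poly_Mapping.keys q' \<subseteq> chart_keys d M r \<longrightarrow>
       dist q (pack d r p) < e \<longrightarrow> dist q' (pack d r p) < e \<longrightarrow>
       (\<forall>b\<in>mons (2 * d) <+> C. gram_coordinates d r q b = gram_coordinates d r q' b) \<longrightarrow> q = q'"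
proof -
  define J where "J = chart_keys d M r"
  define P where "P = (\<lambda>(j, n). Poly_Mapping.lookup (p j) n)"
  define p0 where "p0 = pack d r p"
  have J: "finite J" by (simp add: J_def)
  have inj0: "injective_system J (Inl ` mons (2 * d) \<union> Inr ` (mons d \<times> mons d)) (polar_matrix d r P)"
    unfolding injective_system_def
  proof (intro allI impI ballI)
    fix x k assume x: "\<forall>b\<in>Inl ` mons (2 * d) \<union> Inr ` (mons d \<times> mons d). (\<Sum>k\<in>J. polar_matrix d r P b k * x k) = 0" and k: "k \<in> J"
    define y where "y k = (if k \<in> J then x k else 0)" for k
    have "polar r P y m n = 0" if "m \<in> mons d" "n \<in> mons d" for m n
    proof -
      have "polar r P y m n = observable d (polar r P y) (Inr (m, n))" by simp
      also have "\<dots> = (\<Sum>k\<in>J. polar_matrix d r P (Inr (m, n)) k * y k)"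
        by (rule polar_matrix_mult[OF J]) (simp add: y_def)
      also have "\<dots> = (\<Sum>k\<in>J. polar_matrix d r P (Inr (m, n)) k * x k)" by (intro sum.cong) (auto simp: y_def)
      finally show ?thesis using x that by simp
    qed
    from this have "y (fst k, snd k) = 0"
      unfolding P_def
    proof (intro polar_injective[of r M d p y])
      show "y k = 0" if "k \<notin> chart_keys d M r" for k using that by (simp add: y_def J_def)
    qed (rule M, assumption, rule tri)
    then show "x k = 0" using k by (simp add: y_def)
  qed
  have "\<exists>C'\<subseteq>Inr ` (mons d \<times> mons d). finite C' \<and> card (Inl ` mons (2 * d) :: (mono2 + mono2 \<times> mono2) set) + card C' = card J \<and>
      injective_system J (Inl ` mons (2 * d) \<union> C') (polar_matrix d r P)"
    using polar_surjective[OF V tri span] inj0 unfolding J_def P_def by (intro complete_to_square_system) auto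
  then obtain C' where C': "C' \<subseteq> Inr ` (mons d \<times> mons d)" "card (Inl ` mons (2 * d) :: (mono2 + mono2 \<times> mono2) set) + card C' = card J"
    "injective_system J (Inl ` mons (2 * d) \<union> C') (polar_matrix d r P)" by blast
  define C where "C = Inr -` C'"
  have C'_eq: "C' = Inr ` C" using C'(1) by (auto simp: C_def)
  have cardC: "card C' = card C" unfolding C'_eq by (simp add: card_image)
  have B: "Inl ` mons (2 * d) \<union> C' = mons (2 * d) <+> C" by (auto simp: C'_eq)
  have p0: "Poly_Mapping.lookup p0 k = P k" if "fst k < r" for k
    using that lookup_binary_form[OF V, of "fst k" "snd k"] by (cases k) (auto simp: p0_def lookup_pack P_def)
  have pm: "polar_matrix d r (Poly_Mapping.lookup p0) = polar_matrix d r P"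
    unfolding polar_matrix_def by (intro ext arg_cong2[where f = "observable d"]) (auto simp: polar_def p0 fun_eq_iff)
  have "eventually (\<lambda>s. injective_system J (mons (2 * d) <+> C) (polar_matrix d r (Poly_Mapping.lookup s))) (nhds p0)"
  proof (rule injective_system_tendsto[OF J])
    show "((\<lambda>s. polar_matrix d r (Poly_Mapping.lookup s) b k) \<longlongrightarrow> polar_matrix d r (Poly_Mapping.lookup p0) b k) (nhds p0)" for b k
      unfolding polar_matrix_def polar_def by (intro tendsto_observable tendsto_intros filterlim_ident)
    show "injective_system J (mons (2 * d) <+> C) (polar_matrix d r (Poly_Mapping.lookup p0))"
      using C'(3) by (simp add: pm B)
  qed
  then obtain e where e: "e > 0"
    "\<And>s. dist s p0 < e \<Longrightarrow> injective_system J (mons (2 * d) <+> C) (polar_matrix d r (Poly_Mapping.lookup s))"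
    unfolding eventually_nhds_metric by blast
  show thesis
  proof (rule that[of C e])
    show "C \<subseteq> mons d \<times> mons d" using C'(1) by (auto simp: C_def)
    show "2 * d + 1 + card C = card (chart_keys d M r)"
      using C'(2) by (simp add: cardC J_def card_image card_mons)
    show "\<forall>q q'. Poly_Mapping.keys q \<subseteq> chart_keys d M r \<longrightarrow> Poly_Mapping.keys q' \<subseteq> chart_keys d M r \<longrightarrow>
       dist q (pack d r p) < e \<longrightarrow> dist q' (pack d r p) < e \<longrightarrow>
       (\<forall>b\<in>mons (2 * d) <+> C. gram_coordinates d r q b = gram_coordinates d r q' b) \<longrightarrow> q = q'"
    proof (intro allI impI)
    fix q q' assume q: "Poly_Mapping.keys q \<subseteq> chart_keys d M r" and q': "Poly_Mapping.keys q' \<subseteq> chart_keys d M r"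
      and near: "dist q (pack d r p) < e" "dist q' (pack d r p) < e"
      and eq: "\<forall>b\<in>mons (2 * d) <+> C. gram_coordinates d r q b = gram_coordinates d r q' b"
    define s where "s = (1/2) *\<^sub>R (q + q')"
    have "s \<in> ball p0 e"
    proof -
      have "(1 - 1/2) *\<^sub>R q + (1/2) *\<^sub>R q' \<in> ball p0 e"
        using near by (intro convexD_alt[OF convex_ball]) (auto simp: p0_def dist_commute)
      then show ?thesis by (simp add: s_def scaleR_add_right)
    qed
    then have inj: "injective_system J (mons (2 * d) <+> C) (polar_matrix d r (Poly_Mapping.lookup s))"
      using e(2) by (simp add: dist_commute)
    have look: "Poly_Mapping.lookup q k - Poly_Mapping.lookup q' k = 0" if "k \<in> J" for k
    proof (rule injective_systemD[OF inj _ that])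
      fix b :: "mono2 + mono2 \<times> mono2" assume b: "b \<in> mons (2 * d) <+> C"
      have "(\<Sum>k\<in>J. polar_matrix d r (Poly_Mapping.lookup s) b k * (Poly_Mapping.lookup q k - Poly_Mapping.lookup q' k)) =
          observable d (polar r (Poly_Mapping.lookup s) (\<lambda>k. Poly_Mapping.lookup q k - Poly_Mapping.lookup q' k)) b"
      proof (rule polar_matrix_mult[symmetric, OF J])
        fix k assume "k \<notin> J"
        then show "Poly_Mapping.lookup q k - Poly_Mapping.lookup q' k = 0"
          using lookup_outside_chart[OF q] lookup_outside_chart[OF q'] by (simp add: J_def)
      qed
      also have ls: "Poly_Mapping.lookup s = (\<lambda>k. (Poly_Mapping.lookup q k + Poly_Mapping.lookup q' k) / 2)"
        by (simp add: s_def fun_eq_iff scaleR_lookup lookup_add)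
      also have "observable d (polar r (\<lambda>k. (Poly_Mapping.lookup q k + Poly_Mapping.lookup q' k) / 2)
          (\<lambda>k. Poly_Mapping.lookup q k - Poly_Mapping.lookup q' k)) b = gram_coordinates d r q b - gram_coordinates d r q' b"
        unfolding gram_coordinates_def observable_diff[symmetric]
        by (simp only: entries_gram_tensor lookup_component
              polar_difference[where q = "Poly_Mapping.lookup q" and q' = "Poly_Mapping.lookup q'"])
      finally show "(\<Sum>k\<in>J. polar_matrix d r (Poly_Mapping.lookup s) b k * (Poly_Mapping.lookup q k - Poly_Mapping.lookup q' k)) = 0"
        using eq[rule_format, OF b] unfolding ls by simp
    qed
    show "q = q'"
    proof (rule poly_mapping_eqI)
      fix k
      show "Poly_Mapping.lookup q k = Poly_Mapping.lookup q' k"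
        using look[of k] lookup_outside_chart[OF q, of k] lookup_outside_chart[OF q', of k]
        by (cases "k \<in> J") (simp_all add: J_def)
    qed
    qed
  qed (use e in auto)
qed

section \<open>Sums of two squares\<close>

definition complex_eval :: "real poly \<Rightarrow> complex \<Rightarrow> complex" where
  "complex_eval p z = poly (map_poly of_real p) z"

lemma complex_eval_0 [simp]: "complex_eval 0 z = 0"
  by (simp add: complex_eval_def)

lemma complex_eval_pCons [simp]: "complex_eval (pCons a p) z = of_real a + z * complex_eval p z"
  by (simp add: complex_eval_def map_poly_pCons)

lemma complex_eval_add: "complex_eval (p + q) z = complex_eval p z + complex_eval q z"
proof -
  have "map_poly complex_of_real (p + q) = map_poly of_real p + map_poly of_real q"
    by (rule poly_eqI) (simp add: coeff_map_poly)
  then show ?thesis by (simp add: complex_eval_def)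
qed

lemma complex_eval_smult: "complex_eval (smult a p) z = of_real a * complex_eval p z"
  by (induction p) (simp_all add: algebra_simps)

lemma complex_eval_mult: "complex_eval (p * q) z = complex_eval p z * complex_eval q z"
  by (induction p) (simp_all add: complex_eval_add complex_eval_smult algebra_simps)

lemma complex_eval_of_real: "complex_eval p (of_real x) = of_real (poly p x)"
  by (induction p) simp_all

lemma two_squares_mult:
  fixes a b c e :: "'a::comm_ring_1"
  shows "(a\<^sup>2 + b\<^sup>2) * (c\<^sup>2 + e\<^sup>2) = (a * c - b * e)\<^sup>2 + (a * e + b * c)\<^sup>2"
  by (simp add: power2_eq_square algebra_simps)

text \<open>A complex root \<open>z\<close> of \<open>F\<close> is not real, so \<open>F\<close> is divisible by \<open>(x - Re z)\<^sup>2 + (Im z)\<^sup>2\<close>, and sums of two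
  squares are closed under multiplication.\<close>

lemma positive_poly_sum_of_two_squares:
  fixes F :: "real poly"
  assumes "\<And>x. poly F x > 0"
  shows "\<exists>A B. F = A\<^sup>2 + B\<^sup>2"
  using assms
proof (induction "degree F" arbitrary: F rule: less_induct)
  case less
  show ?case
  proof (cases "degree F = 0")
    case True
    then obtain c where c: "F = [:c:]" by (rule degree_eq_zeroE)
    then have "c > 0" using less.prems[of 0] by simp
    then have "F = [:sqrt c:]\<^sup>2 + 0\<^sup>2" by (simp add: c power2_eq_square)
    then show ?thesis by blast
  next
    case False
    then have "degree (map_poly complex_of_real F) > 0" by (simp add: degree_map_poly)
    then obtain z where z: "complex_eval F z = 0"
      unfolding complex_eval_def using alg_closed_imp_poly_has_root by blast
    have "Im z \<noteq> 0"
    proof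
      assume "Im z = 0"
      then have "z = of_real (Re z)" by (simp add: complex_eq_iff)
      then have "poly F (Re z) = 0" using z complex_eval_of_real by (metis of_real_eq_0_iff)
      then show False using less.prems[of "Re z"] by simp
    qed
    define m where "m = [:(Re z)\<^sup>2 + (Im z)\<^sup>2, - 2 * Re z, 1:]"
    have m_squares: "m = [:- Re z, 1:]\<^sup>2 + [:Im z:]\<^sup>2" by (simp add: m_def power2_eq_square)
    have m_pos: "poly m x > 0" for x
      using \<open>Im z \<noteq> 0\<close> unfolding m_squares by (simp add: add_nonneg_pos)
    have mz: "complex_eval m z = 0"
      by (simp add: m_def complex_eq_iff power2_eq_square algebra_simps)
    have degm: "degree m = 2" "m \<noteq> 0" by (simp_all add: m_def)
    define R where "R = F mod m"
    have "degree R < 2" using degree_mod_less[OF degm(2), of F] degm by (auto simp: R_def)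
    then have R: "R = [:coeff R 0, coeff R 1:]"
      by (intro poly_eqI) (auto simp: coeff_pCons coeff_eq_0 split: nat.split)
    have "F = F div m * m + R" by (simp add: R_def)
    then have "complex_eval R z = 0" using z mz complex_eval_add complex_eval_mult by (metis add_0 mult_zero_right)
    then have Rz: "complex_eval [:coeff R 0, coeff R 1:] z = 0" using R by simp
    then have "coeff R 1 = 0" using \<open>Im z \<noteq> 0\<close> by (simp add: complex_eq_iff)
    moreover from this have "coeff R 0 = 0" using Rz by (simp add: complex_eq_iff)
    ultimately have "R = 0" using R by simp
    then have F: "F = F div m * m" using \<open>F = F div m * m + R\<close> by simp
    define Q where "Q = F div m"
    have FQ: "F = Q * m" using F by (simp add: Q_def)
    have "Q \<noteq> 0" using FQ False by auto
    then have "degree F = degree Q + 2" unfolding FQ using degm by (simp add: degree_mult_eq)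
    moreover have "poly Q x > 0" for x
      using less.prems[of x] m_pos[of x] unfolding FQ by (simp add: zero_less_mult_iff)
    ultimately obtain A B where AB: "Q = A\<^sup>2 + B\<^sup>2" using less.hyps[of Q] by auto
    have "F = (A * [:- Re z, 1:] - B * [:Im z:])\<^sup>2 + (A * [:Im z:] + B * [:- Re z, 1:])\<^sup>2"
      unfolding FQ AB m_squares by (rule two_squares_mult)
    then show ?thesis by blast
  qed
qed

lemma coeff_square_top:
  fixes C :: "real poly"
  assumes "degree C \<le> m"
  shows "coeff (C * C) (2 * m) = (coeff C m)\<^sup>2"
proof (cases "degree C = m")
  case True
  then show ?thesis using coeff_mult_degree_sum[of C C] by (simp add: power2_eq_square mult_2)
next
  case False
  then have "degree (C * C) < 2 * m" using assms degree_mult_le[of C C] by linarith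
  then show ?thesis using False assms by (simp add: coeff_eq_0)
qed

lemma degree_sum_of_two_squares:
  fixes A B :: "real poly"
  assumes "degree (A\<^sup>2 + B\<^sup>2) \<le> 2 * d"
  shows "degree A \<le> d" "degree B \<le> d"
proof -
  define m where "m = max (degree A) (degree B)"
  have "m \<le> d"
  proof (rule ccontr)
    assume "\<not> m \<le> d"
    have "coeff (A\<^sup>2 + B\<^sup>2) (2 * m) = 0" using assms \<open>\<not> m \<le> d\<close> by (intro coeff_eq_0) simp
    then have "(coeff A m)\<^sup>2 + (coeff B m)\<^sup>2 = 0" using coeff_square_top[of A m] coeff_square_top[of B m]
      by (simp add: m_def power2_eq_square)
    then have "coeff A m = 0" "coeff B m = 0" by (simp_all add: sum_power2_eq_zero_iff)
    then show False using \<open>\<not> m \<le> d\<close> unfolding m_def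
      by (metis leading_coeff_0_iff max_def degree_0 le0 nat_le_linear)
  qed
  then show "degree A \<le> d" "degree B \<le> d" by (simp_all add: m_def)
qed

section \<open>Forms without multiple factors\<close>

text \<open>The Sylvester matrix of \<open>F\<close> and its derivative: the columns \<open>Inl i\<close> and \<open>Inr j\<close> hold the coefficients of
  \<open>x\<^sup>i F\<close> and \<open>x\<^sup>j F'\<close>.\<close>

definition sylvester :: "nat \<Rightarrow> real poly \<Rightarrow> nat \<Rightarrow> nat + nat \<Rightarrow> real" where
  "sylvester n F k = case_sum (\<lambda>i. coeff (monom 1 i * F) k) (\<lambda>j. coeff (monom 1 j * pderiv F) k)"

abbreviation sylvester_columns :: "nat \<Rightarrow> (nat + nat) set" where
  "sylvester_columns n \<equiv> {..<n - 1} <+> {..<n}"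

text \<open>A form without multiple factors. This is expressed by the injectivity of a matrix with entries
  linear in \<open>f\<close>, because then openness and density follow from the lemmas on linear systems. The
  condition on the leading coefficient keeps the point at infinity out of the discussion.\<close>

definition regular_form :: "nat \<Rightarrow> poly2 \<Rightarrow> bool" where
  "regular_form d f \<longleftrightarrow> Poly_Mapping.lookup f (2 * d, 0) \<noteq> 0 \<and>
     injective_system (sylvester_columns (2 * d)) UNIV (sylvester (2 * d) (dehomogenize (2 * d) f))"

lemma sylvester_combination:
  assumes "degree u < n - 1 \<or> u = 0" "degree v < n \<or> v = 0"
  shows "(\<Sum>c\<in>sylvester_columns n. sylvester n F k c * case_sum (coeff u) (coeff v) c) = coeff (u * F + v * pderiv F) k"
proof -
  have expand: "(\<Sum>i<m. coeff (monom 1 i * G) k * coeff w i) = coeff (w * G) k" if "degree w < m \<or> w = 0" for m G and w :: "real poly"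
  proof -
    have "w = (\<Sum>i<m. monom (coeff w i) i)"
      by (rule poly_eqI) (use that in \<open>auto simp: coeff_sum coeff_eq_0\<close>)
    then have "w * G = (\<Sum>i<m. smult (coeff w i) (monom 1 i * G))"
      by (metis (no_types, lifting) sum_distrib_right sum.cong smult_monom mult.right_neutral mult_smult_left)
    then show ?thesis by (simp add: coeff_sum mult.commute)
  qed
  have "(\<Sum>c\<in>sylvester_columns n. sylvester n F k c * case_sum (coeff u) (coeff v) c) =
      (\<Sum>i<n - 1. coeff (monom 1 i * F) k * coeff u i) + (\<Sum>j<n. coeff (monom 1 j * pderiv F) k * coeff v j)"
    by (simp add: sum.Plus sylvester_def)
  also have "\<dots> = coeff (u * F) k + coeff (v * pderiv F) k"
    using expand[OF assms(1)] expand[OF assms(2)] by simp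
  finally show ?thesis by simp
qed

text \<open>If \<open>F = g a\<close> and \<open>F' = g b\<close>, then \<open>b F - a F' = 0\<close>. This is a relation in the range of degrees of the
  Sylvester matrix if \<open>g\<close> is not constant.\<close>

lemma regular_form_no_square_factor:
  assumes d: "d \<ge> 1" and f: "regular_form d f" and g: "g\<^sup>2 dvd dehomogenize (2 * d) f"
  shows "degree g = 0"
proof (rule ccontr)
  assume pos: "degree g \<noteq> 0"
  define n where "n = 2 * d"
  define F where "F = dehomogenize n f"
  have "coeff F n \<noteq> 0" using f by (simp add: regular_form_def F_def n_def coeff_dehomogenize)
  moreover have "degree F \<le> n" by (simp add: F_def degree_dehomogenize)
  ultimately have degF: "degree F = n" "F \<noteq> 0" by (auto intro: le_antisym le_degree)
  obtain B where B: "F = g\<^sup>2 * B" using g unfolding F_def n_def by (elim dvdE)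
  define a where "a = g * B"
  define b where "b = 2 * pderiv g * B + g * pderiv B"
  have Fa: "F = g * a" by (simp add: B a_def power2_eq_square)
  have Fb: "pderiv F = g * b" by (simp add: B b_def power2_eq_square pderiv_mult algebra_simps)
  have "g \<noteq> 0" "a \<noteq> 0" using degF(2) Fa by auto
  have "degree g + degree a = n" using degF(1) \<open>g \<noteq> 0\<close> \<open>a \<noteq> 0\<close> by (simp add: Fa degree_mult_eq)
  then have dega: "degree a < n" using pos by simp
  have "degree b < n - 1 \<or> b = 0"
  proof (cases "b = 0")
    case False
    have "degree g + degree b = degree (pderiv F)" unfolding Fb using False \<open>g \<noteq> 0\<close> by (simp add: degree_mult_eq)
    also have "\<dots> = n - 1" using degF by (simp add: degree_pderiv)
    finally show ?thesis using pos by simp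
  qed simp
  moreover have "b * F + - a * pderiv F = 0" unfolding Fb unfolding Fa by (simp add: mult_ac)
  ultimately have rel: "(\<Sum>c\<in>sylvester_columns n. sylvester n F k c * case_sum (coeff b) (coeff (- a)) c) = 0" for k
    using sylvester_combination[of b n "- a" F k] dega by simp
  have inj: "injective_system (sylvester_columns n) UNIV (sylvester n F)"
    using f unfolding regular_form_def F_def n_def by blast
  have "Inr (degree a) \<in> sylvester_columns n" using dega by auto
  from injective_systemD[OF inj rel this] show False using \<open>a \<noteq> 0\<close> by simp
qed

text \<open>A common factor of the \<open>p\<^sub>j\<close> would be a double factor of \<open>\<Sum> p\<^sub>j\<^sup>2\<close>; and as the leading coefficient of this
  sum does not vanish, some \<open>p\<^sub>j\<close> has full degree in \<open>x\<^sub>1\<close>.\<close>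

lemma regular_form_spans_multiples:
  assumes d: "d \<ge> 1" and V: "\<And>j. j < r \<Longrightarrow> p j \<in> binary_forms d"
    and f: "regular_form d (\<Sum>j<r. p j * p j)"
  shows "spans_multiples d r p"
  unfolding spans_multiples_def
proof
  fix h assume h: "h \<in> binary_forms (2 * d)"
  define P where "P j = dehomogenize d (p j)" for j
  define F where "F = dehomogenize (2 * d) (\<Sum>j<r. p j * p j)"
  have FP: "F = (\<Sum>j<r. P j * P j)"
    by (simp add: F_def P_def dehomogenize_sum dehomogenize_mult V)
  have "\<exists>j0<r. coeff (P j0) d \<noteq> 0"
  proof (rule ccontr)
    assume no: "\<not> ?thesis"
    have "coeff (P j * P j) (2 * d) = 0" if "j < r" for j
      using coeff_square_top[of "P j" d] no that by (simp add: P_def degree_dehomogenize)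
    then have "coeff F (2 * d) = 0" by (simp add: FP coeff_sum)
    then show False using f by (simp add: F_def regular_form_def coeff_dehomogenize)
  qed
  then obtain j0 where j0: "j0 < r" "coeff (P j0) d \<noteq> 0" by blast
  have deg: "degree (P j) \<le> d" for j by (simp add: P_def degree_dehomogenize)
  have "\<exists>X. (\<forall>j<r. degree (X j) \<le> d) \<and> (\<Sum>j<r. P j * X j) = dehomogenize (2 * d) h"
  proof (rule coprime_multiples_surjective[of r P d j0])
    show "degree (P j0) = d" using j0(2) deg by (intro le_antisym le_degree)
    show "P j0 \<noteq> 0" using j0(2) by auto
    show "degree g = 0" if g: "\<And>j. j < r \<Longrightarrow> g dvd P j" for g
    proof (rule regular_form_no_square_factor[OF d f])
      show "g\<^sup>2 dvd dehomogenize (2 * d) (\<Sum>j<r. p j * p j)"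
        unfolding F_def[symmetric] FP power2_eq_square using g by (intro dvd_sum mult_dvd_mono) auto
    qed
  qed (use j0 deg degree_dehomogenize in auto)
  then obtain X where X: "\<And>j. j < r \<Longrightarrow> degree (X j) \<le> d" "(\<Sum>j<r. P j * X j) = dehomogenize (2 * d) h" by blast
  have "dehomogenize (2 * d) (\<Sum>j<r. p j * homogenize d (X j)) = dehomogenize (2 * d) h"
    using X by (simp add: dehomogenize_sum dehomogenize_mult V homogenize_in_binary_forms dehomogenize_homogenize P_def)
  moreover have "(\<Sum>j<r. p j * homogenize d (X j)) \<in> binary_forms (2 * d)"
    by (intro subspace_sum[OF subspace_binary_forms] mult_in_binary_forms V homogenize_in_binary_forms) auto
  ultimately have "(\<Sum>j<r. p j * homogenize d (X j)) = h" using dehomogenize_eq_iff[OF _ h] by blast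
  then show "\<exists>X. (\<forall>j<r. X j \<in> binary_forms d) \<and> (\<Sum>j<r. p j * X j) = h"
    by (intro exI[of _ "\<lambda>j. homogenize d (X j)"]) (simp add: homogenize_in_binary_forms)
qed

lemma sylvester_lookup:
  "sylvester n (dehomogenize m f) k c = (case c of
     Inl i \<Rightarrow> if k < i then 0 else if k - i \<le> m then Poly_Mapping.lookup f (k - i, m - (k - i)) else 0
   | Inr j \<Rightarrow> if k < j then 0 else real (Suc (k - j)) * (if Suc (k - j) \<le> m then Poly_Mapping.lookup f (Suc (k - j), m - Suc (k - j)) else 0))"
  by (cases c) (simp_all add: sylvester_def coeff_monom_mult coeff_pderiv coeff_dehomogenize)

lemma eventually_regular_form:
  assumes "regular_form d f"
  shows "eventually (regular_form d) (nhds f)"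
proof -
  have "eventually (\<lambda>f. Poly_Mapping.lookup f (2 * d, 0) \<noteq> 0) (nhds f)"
    using assms by (intro tendsto_imp_eventually_ne[OF tendsto_lookup[OF filterlim_ident]]) (simp add: regular_form_def)
  moreover have "eventually (\<lambda>f. injective_system (sylvester_columns (2 * d)) UNIV
      (sylvester (2 * d) (dehomogenize (2 * d) f))) (nhds f)"
  proof (rule injective_system_tendsto)
    show "((\<lambda>f. sylvester (2 * d) (dehomogenize (2 * d) f) k c) \<longlongrightarrow> sylvester (2 * d) (dehomogenize (2 * d) f) k c) (nhds f)" for k c
      by (cases c) (auto simp: sylvester_lookup intro!: tendsto_intros filterlim_ident)
  qed (use assms in \<open>auto simp: regular_form_def\<close>)
  ultimately show ?thesis unfolding regular_form_def by eventually_elim blast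
qed

section \<open>Density\<close>

lemma dehomogenize_add: "dehomogenize d (p + q) = dehomogenize d p + dehomogenize d q"
  by (rule poly_eqI) (simp add: coeff_dehomogenize lookup_add)

lemma dehomogenize_scaleR: "dehomogenize d (c *\<^sub>R p) = smult c (dehomogenize d p)"
  by (rule poly_eqI) (simp add: coeff_dehomogenize scaleR_lookup)

lemma ex_small_inverse_notin:
  fixes X :: "real set"
  assumes "finite X" "e > 0"
  obtains t where "0 < t" "t < e" "inverse t \<notin> X"
proof -
  have "finite (inverse ` X)" using assms(1) by simp
  moreover have "infinite {0<..<e}" using assms(2) by simp
  ultimately obtain t where "t \<in> {0<..<e}" "t \<notin> inverse ` X" by (meson finite_subset subsetI)
  moreover from this have "inverse t \<notin> X" by (metis image_eqI inverse_inverse_eq)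
  ultimately show thesis using that by auto
qed

lemma injective_system_scale:
  assumes "c \<noteq> 0"
  shows "injective_system K B (\<lambda>b k. c * f b k) \<longleftrightarrow> injective_system K B f"
proof -
  have "(\<Sum>k\<in>K. c * f b k * x k) = c * (\<Sum>k\<in>K. f b k * x k)" for b x
    by (simp add: sum_distrib_left mult.assoc)
  then show ?thesis using assms by (simp add: injective_system_def)
qed

lemma sylvester_1_plus_power:
  assumes n: "n \<ge> 1"
  shows "injective_system (sylvester_columns n) UNIV (sylvester n (1 + monom 1 n))"
  unfolding injective_system_def
proof (intro allI impI)
  fix x :: "nat + nat \<Rightarrow> real"
  assume x: "\<forall>k\<in>UNIV. (\<Sum>c\<in>sylvester_columns n. sylvester n (1 + monom 1 n) k c * x c) = 0"
  have "pderiv (1 + monom 1 n) = (monom (real n) (n - 1) :: real poly)"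
    by (simp add: pderiv_add pderiv_monom)
  then have relation: "(\<Sum>i<n - 1. ((if i = k then 1 else 0) + (if i + n = k then 1 else 0)) * x (Inl i)) +
      (\<Sum>j<n. (if j + (n - 1) = k then real n else 0) * x (Inr j)) = 0" for k
    using x[rule_format, of k] by (simp add: sum.Plus sylvester_def distrib_left mult_monom)
  have Inl: "x (Inl i) = 0" if "i < n - 1" for i
  proof -
    have "(\<Sum>l<n - 1. ((if l = i then 1 else 0) + (if l + n = i then 1 else 0)) * x (Inl l)) = (\<Sum>l<n - 1. if l = i then x (Inl i) else 0)"
      using that by (intro sum.cong) auto
    moreover have "(\<Sum>j<n. (if j + (n - 1) = i then real n else 0) * x (Inr j)) = 0"
      using that by (intro sum.neutral) auto
    ultimately show ?thesis using relation[of i] that by simp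
  qed
  have Inr: "x (Inr j) = 0" if "j < n" for j
  proof -
    have "(\<Sum>l<n. (if l + (n - 1) = j + (n - 1) then real n else 0) * x (Inr l)) = (\<Sum>l<n. if l = j then real n * x (Inr j) else 0)"
      by (intro sum.cong) auto
    moreover have "(\<Sum>l<n - 1. ((if l = j + (n - 1) then 1 else 0) + (if l + n = j + (n - 1) then 1 else 0)) * x (Inl l)) = 0"
      by (intro sum.neutral) (simp add: Inl)
    ultimately show ?thesis using relation[of "j + (n - 1)"] that by simp
  qed
  show "\<forall>c\<in>sylvester_columns n. x c = 0" using Inl Inr by auto
qed

lemma sylvester_add: "sylvester n (F + G) k c = sylvester n F k c + sylvester n G k c"
  by (cases c) (simp_all add: sylvester_def distrib_left pderiv_add)

lemma sylvester_smult: "sylvester n (smult a F) k c = a * sylvester n F k c"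
  by (cases c) (simp_all add: sylvester_def pderiv_smult)

lemma sos_cone_binary_form:
  assumes "f \<in> sos_cone d"
  shows "f \<in> binary_forms (2 * d)"
proof -
  obtain r p where "f = (\<Sum>i<r. p i * p i)" "\<forall>i<(r::nat). p i \<in> binary_forms d"
    using assms unfolding sos_cone_def by blast
  then show ?thesis by (auto intro!: subspace_sum[OF subspace_binary_forms] mult_in_binary_forms)
qed

text \<open>Add a small multiple of \<open>x\<^sub>1\<^sup>2\<^sup>d + x\<^sub>2\<^sup>2\<^sup>d\<close>, which is positive and has no multiple factor. In the pencil
  \<open>G + s F\<close> all but finitely many members are regular, since \<open>G\<close> is; the member with \<open>s = 1 / t\<close> is a
  multiple of \<open>F + t G\<close>.\<close>

lemma regular_sum_of_two_squares_dense:
  assumes d: "d \<ge> 1" and f: "f \<in> sos_cone d" and e: "e > 0"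
  obtains a b where "a \<in> binary_forms d" "b \<in> binary_forms d" "regular_form d (a * a + b * b)" "dist f (a * a + b * b) < e"
proof -
  define n where "n = 2 * d"
  define G :: "real poly" where "G = 1 + monom 1 n"
  define g where "g = homogenize n G"
  have "degree G \<le> n" unfolding G_def by (intro degree_add_le) (simp_all add: degree_monom_eq)
  then have g: "dehomogenize n g = G" "g \<in> binary_forms n"
    by (simp_all add: g_def dehomogenize_homogenize homogenize_in_binary_forms)
  obtain r p where p: "f = (\<Sum>i<r. p i * p i)" "\<forall>i<(r::nat). p i \<in> binary_forms d"
    using f unfolding sos_cone_def by blast
  define F where "F = dehomogenize n f"
  have F: "F = (\<Sum>i<r. dehomogenize d (p i) * dehomogenize d (p i))"
    using p by (simp add: F_def n_def dehomogenize_sum dehomogenize_mult)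
  have "finite {s. \<not> injective_system (sylvester_columns n) UNIV (sylvester n (G + smult s F))}"
  proof (rule injective_system_polynomial)
    show "\<exists>P. \<forall>s. sylvester n (G + smult s F) k c = poly P s" for k c
      by (intro exI[of _ "[:sylvester n G k c, sylvester n F k c:]"]) (simp add: sylvester_add sylvester_smult)
    show "injective_system (sylvester_columns n) UNIV (sylvester n (G + smult 0 F))"
      using sylvester_1_plus_power[of n] d by (simp add: G_def n_def)
  qed simp
  moreover have "e / (norm g + 1) > 0" using e by (simp add: add_nonneg_pos)
  ultimately obtain t where t: "0 < t" "t < e / (norm g + 1)"
    "injective_system (sylvester_columns n) UNIV (sylvester n (G + smult (inverse t) F))"
    by (rule ex_small_inverse_notin) auto
  \<comment> \<open>The form \<open>g\<close> is \<open>x\<^sub>1\<^sup>n + x\<^sub>2\<^sup>n\<close>.\<close>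
  define f1 where "f1 = f + t *\<^sub>R g"
  define F1 where "F1 = F + smult t G"
  have F1: "dehomogenize n f1 = F1"
    by (simp add: f1_def F1_def dehomogenize_add dehomogenize_scaleR g F_def)
  have F1': "F1 = smult t (G + smult (inverse t) F)" using t(1) by (simp add: F1_def smult_add_right add.commute)
  have "degree A \<le> d \<and> degree B \<le> d" if AB: "F1 = A\<^sup>2 + B\<^sup>2" for A B
  proof -
    have "degree F1 \<le> 2 * d" unfolding F1[symmetric] unfolding n_def by (rule degree_dehomogenize)
    then show ?thesis using degree_sum_of_two_squares[of A B d] unfolding AB by blast
  qed
  moreover have "poly F1 x > 0" for x
  proof -
    have "0 \<le> poly F x" by (simp add: F poly_sum sum_nonneg)
    moreover have "poly G x > 0" by (simp add: G_def poly_monom n_def power_mult add_pos_nonneg)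
    ultimately show ?thesis using t(1) by (simp add: F1_def add_nonneg_pos)
  qed
  ultimately obtain A B where AB: "F1 = A\<^sup>2 + B\<^sup>2" "degree A \<le> d" "degree B \<le> d"
    using positive_poly_sum_of_two_squares by blast
  define a where "a = homogenize d A"
  define b where "b = homogenize d B"
  have ab: "a \<in> binary_forms d" "b \<in> binary_forms d" by (simp_all add: a_def b_def homogenize_in_binary_forms)
  have "dehomogenize n (a * a + b * b) = F1"
    using ab AB by (simp add: n_def dehomogenize_add dehomogenize_mult) (simp add: a_def b_def dehomogenize_homogenize power2_eq_square)
  moreover have "f1 \<in> binary_forms n"
    unfolding f1_def using sos_cone_binary_form[OF f] g(2) subspace_binary_forms
    by (intro subspace_add subspace_scale) (auto simp: n_def)
  moreover have "a * a + b * b \<in> binary_forms n"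
    unfolding n_def using ab by (intro subspace_add[OF subspace_binary_forms] mult_in_binary_forms)
  ultimately have f1: "a * a + b * b = f1" using F1 dehomogenize_eq_iff by metis
  have "regular_form d f1"
    unfolding regular_form_def
  proof
    have "0 \<le> coeff F n" unfolding F n_def coeff_sum by (intro sum_nonneg) (simp add: coeff_square_top degree_dehomogenize)
    then have "coeff F1 n > 0" using t(1) d by (simp add: F1_def G_def n_def)
    then show "Poly_Mapping.lookup f1 (2 * d, 0) \<noteq> 0" using F1[symmetric] by (simp add: coeff_dehomogenize n_def)
    have "sylvester n F1 = (\<lambda>k c. t * sylvester n (G + smult (inverse t) F) k c)"
      unfolding F1' by (simp add: fun_eq_iff sylvester_smult)
    then have "injective_system (sylvester_columns n) UNIV (sylvester n F1)"
      using t(1,3) by (simp add: injective_system_scale)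
    then show "injective_system (sylvester_columns (2 * d)) UNIV (sylvester (2 * d) (dehomogenize (2 * d) f1))"
      using F1 by (simp add: n_def)
  qed
  moreover have "dist f f1 < e"
  proof -
    have "dist f f1 = t * norm g" using t(1) by (simp add: f1_def dist_norm)
    also have "\<dots> \<le> t * (norm g + 1)" using t(1) by simp
    also have "\<dots> < e" using t(2) by (simp add: pos_less_divide_eq add_nonneg_pos)
    finally show ?thesis .
  qed
  ultimately show thesis using that[OF ab] f1 by simp
qed

definition dehomogenized_curve :: "nat \<Rightarrow> (nat \<Rightarrow> poly2) \<Rightarrow> real \<Rightarrow> nat \<Rightarrow> real" where
  "dehomogenized_curve d p t i = poly (dehomogenize d (p i)) t"

lemma indep_products_iff_off_quadrics:
  assumes V: "\<And>i. i < r \<Longrightarrow> p i \<in> binary_forms d"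
  shows "indep_products r p \<longleftrightarrow> off_quadrics r (dehomogenized_curve d p ` UNIV)"
proof -
  have "mult_map (quad_tensor r q p) = 0 \<longleftrightarrow> (\<forall>t. quad r q (dehomogenized_curve d p t) = 0)" for q
  proof -
    have eq: "mult_map (quad_tensor r q p) = (\<Sum>i<r. \<Sum>j<r. q i j *\<^sub>R (p i * p j))"
      by (simp add: quad_tensor_def linear_sum[OF linear_mult_map] linear_scale[OF linear_mult_map] mult_map_tensor)
    have "mult_map (quad_tensor r q p) \<in> binary_forms (2 * d)"
      unfolding eq by (intro subspace_sum[OF subspace_binary_forms] subspace_scale[OF subspace_binary_forms] mult_in_binary_forms V) auto
    moreover have "0 \<in> binary_forms (2 * d)" by (rule subspace_0[OF subspace_binary_forms])
    ultimately have "mult_map (quad_tensor r q p) = 0 \<longleftrightarrow> dehomogenize (2 * d) (mult_map (quad_tensor r q p)) = dehomogenize (2 * d) 0"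
      by (simp add: dehomogenize_eq_iff)
    also have "dehomogenize (2 * d) 0 = 0" by (rule poly_eqI) (simp add: coeff_dehomogenize)
    also have "dehomogenize (2 * d) (mult_map (quad_tensor r q p)) =
        (\<Sum>i<r. \<Sum>j<r. smult (q i j) (dehomogenize d (p i) * dehomogenize d (p j)))" (is "_ = ?D")
      unfolding eq by (simp add: dehomogenize_sum dehomogenize_scaleR dehomogenize_mult V)
    also have "?D = 0 \<longleftrightarrow> (\<forall>t. poly ?D t = 0)" using poly_all_0_iff_0 by blast
    also have "\<dots> \<longleftrightarrow> (\<forall>t. quad r q (dehomogenized_curve d p t) = 0)"
      by (simp add: quad_def dehomogenized_curve_def poly_sum mult.assoc)
    finally show ?thesis .
  qed
  then show ?thesis unfolding indep_products_def off_quadrics_def by (simp add: image_def) blast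
qed

text \<open>Extend \<open>(a, b)\<close> by zeros to a tuple of \<open>r\<close> forms and add a small multiple of a tuple with independent
  products.\<close>

lemma extreme_points_dense:
  assumes r: "2 \<le> r" "(r + 1) choose 2 \<le> 2 * d + 1"
    and a: "a \<in> binary_forms d" and b: "b \<in> binary_forms d" and e: "e > 0"
  obtains f where "f \<in> sos_cone d" "dist (a * a + b * b) f < e" "extreme_points_of_rank d r f \<noteq> {}"
proof -
  obtain c z where c: "\<forall>i<r. degree (c i) \<le> d" "off_quadrics r (curve_and_points c z ` (UNIV <+> {..<0}))"
    using ex_rational_curve_off_quadrics[of r d 0] r by auto
  define w where "w i = homogenize d (c i)" for i
  define p where "p i = (if i = 0 then a else if i = 1 then b else 0)" for i :: nat
  have V: "p i \<in> binary_forms d" "w i \<in> binary_forms d" for i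
    using a b subspace_0[OF subspace_binary_forms] by (simp_all add: p_def w_def homogenize_in_binary_forms)
  have w: "dehomogenized_curve d w t i = poly (c i) t" if "i < r" for t i
    using c(1) that by (simp add: dehomogenized_curve_def w_def dehomogenize_homogenize)
  define v where "v s t i = dehomogenized_curve d w t i + s * dehomogenized_curve d p t i" for s t i
  have "finite {s. \<not> off_quadrics r (v s ` UNIV)}"
  proof (rule off_quadrics_polynomial)
    show "\<exists>P. \<forall>s. v s t i = poly P s" for t i
      by (intro exI[of _ "[:dehomogenized_curve d w t i, dehomogenized_curve d p t i:]"]) (simp add: v_def)
    show "off_quadrics r (v 0 ` UNIV)"
      unfolding off_quadrics_def
    proof (intro allI impI)
      fix q :: "nat \<Rightarrow> nat \<Rightarrow> real" and i j
      assume q: "\<forall>i j. q i j = q j i" "\<forall>x\<in>v 0 ` UNIV. quad r q x = 0" and ij: "i < r" "j < r"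
      have "quad r q (\<lambda>i. poly (c i) t) = 0" for t
      proof -
        have "quad r q (\<lambda>i. poly (c i) t) = quad r q (v 0 t)" by (rule quad_cong) (simp add: v_def w)
        then show ?thesis using q(2) by simp
      qed
      then have "\<forall>x\<in>curve_and_points c z ` (UNIV <+> {..<0}). quad r q x = 0"
        unfolding Ball_curve_and_points by simp
      then show "q i j = 0" using c(2) q(1) ij unfolding off_quadrics_def by blast
    qed
  qed
  moreover define h1 where "h1 = (\<Sum>i<r. p i * w i + w i * p i)"
  moreover define h2 where "h2 = (\<Sum>i<r. w i * w i)"
  have "min 1 (e / (norm h1 + norm h2 + 1)) > 0" using e by (simp add: add_nonneg_pos)
  ultimately obtain t where t: "0 < t" "t < min 1 (e / (norm h1 + norm h2 + 1))" "off_quadrics r (v (inverse t) ` UNIV)"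
    by - (rule ex_small_inverse_notin, assumption, assumption, auto)
  define p' where "p' i = p i + t *\<^sub>R w i" for i
  have V': "p' i \<in> binary_forms d" for i
    unfolding p'_def using V subspace_binary_forms by (intro subspace_add subspace_scale) auto
  have "dehomogenized_curve d p' s = (\<lambda>i. t * v (inverse t) s i)" for s
    using t(1) by (simp add: fun_eq_iff dehomogenized_curve_def v_def p'_def dehomogenize_add dehomogenize_scaleR algebra_simps)
  then have "quad r q (dehomogenized_curve d p' s) = t\<^sup>2 * quad r q (v (inverse t) s)" for q s
    by (simp add: quad_scale)
  then have "off_quadrics r (dehomogenized_curve d p' ` UNIV)"
    using t(1,3) by (simp add: off_quadrics_def)
  then have "indep_products r p'" using indep_products_iff_off_quadrics V' by blast
  from extreme_point_if_indep_products[OF V' this]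
  have ext: "extreme_points_of_rank d r (mult_map (gram_tensor r p')) \<noteq> {}" by blast
  show thesis
  proof (rule that)
    show "(\<Sum>i<r. p' i * p' i) \<in> sos_cone d" unfolding sos_cone_def using V' by blast
    show "extreme_points_of_rank d r (\<Sum>i<r. p' i * p' i) \<noteq> {}" using ext by (simp add: mult_map_gram_tensor)
    have "(\<Sum>i<r. p i * p i) = (\<Sum>i\<in>{0, 1}. p i * p i)"
      using r(1) by (intro sum.mono_neutral_right) (auto simp: p_def)
    then have ab: "a * a + b * b = (\<Sum>i<r. p i * p i)" by (simp add: p_def)
    have scale': "(t *\<^sub>R u) * v = t *\<^sub>R (u * v)" for u v :: poly2
      using mult_scaleR_poly2[of v t u] by (simp add: mult.commute)
    have "p' i * p' i = p i * p i + t *\<^sub>R (p i * w i + w i * p i) + t\<^sup>2 *\<^sub>R (w i * w i)" for i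
      by (simp only: p'_def distrib_left distrib_right mult_scaleR_poly2 scale' scaleR_add_right power2_eq_square scaleR_scaleR add_ac)
    then have "(\<Sum>i<r. p' i * p' i) = a * a + b * b + (t *\<^sub>R h1 + t\<^sup>2 *\<^sub>R h2)"
      by (simp add: sum.distrib ab h1_def h2_def scaleR_sum_right scaleR_add_right add_ac)
    then have "dist (a * a + b * b) (\<Sum>i<r. p' i * p' i) = norm (t *\<^sub>R h1 + t\<^sup>2 *\<^sub>R h2)"
      by (subst dist_commute) (simp add: dist_norm)
    also have "\<dots> \<le> t * norm h1 + t\<^sup>2 * norm h2"
      using norm_triangle_ineq[of "t *\<^sub>R h1" "t\<^sup>2 *\<^sub>R h2"] t(1) by simp
    also have "\<dots> \<le> t * (norm h1 + norm h2 + 1)"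
    proof -
      have "t\<^sup>2 \<le> t" using t by (simp add: power2_eq_square mult_left_le)
      then have "t\<^sup>2 * norm h2 \<le> t * norm h2" by (simp add: mult_right_mono)
      then show ?thesis using t(1) by (simp add: distrib_left)
    qed
    also have "\<dots> < e" using t(2) by (simp add: pos_less_divide_eq add_nonneg_pos)
    finally show "dist (a * a + b * b) (\<Sum>i<r. p' i * p' i) < e" .
  qed
qed

section \<open>Charts of the set of Gram tensors\<close>

lemma continuous_on_schur:
  "(\<And>m n. continuous_on S (\<lambda>x. A x m n)) \<Longrightarrow> continuous_on S (\<lambda>x. schur M (A x) j m n)"
  by (induction j arbitrary: m n) (auto intro!: continuous_intros)

lemma continuous_on_pivot_product:
  "(\<And>m n. continuous_on S (\<lambda>x. A x m n)) \<Longrightarrow> continuous_on S (\<lambda>x. pivot_product M (A x) j)"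
  by (induction j) (auto intro!: continuous_intros continuous_on_schur)

lemma continuous_on_cholesky:
  assumes "\<And>m n. continuous_on S (\<lambda>x. A x m n)"
    and "\<And>x i. x \<in> S \<Longrightarrow> i \<le> j \<Longrightarrow> schur M (A x) i (M i) (M i) > 0"
  shows "continuous_on S (\<lambda>x. cholesky M (A x) j n)"
  unfolding cholesky_def
proof (intro continuous_intros continuous_on_schur continuous_on_pivot_product assms(1) ballI)
  fix x assume "x \<in> S"
  then have "pivot_product M (A x) (Suc j) > 0" using assms(2) by (intro pivot_product_pos) auto
  then show "sqrt (pivot_product M (A x) (Suc j)) \<noteq> 0" by (simp del: pivot_product.simps)
qed

definition cholesky_chart :: "nat \<Rightarrow> (nat \<Rightarrow> mono2) \<Rightarrow> nat \<Rightarrow> tensor2 \<Rightarrow> (nat \<times> mono2 \<Rightarrow>\<^sub>0 real)" where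
  "cholesky_chart d M r \<theta> = pack d r (cholesky_form d M \<theta>)"

lemma continuous_on_entries [continuous_intros]:
  "continuous_on S F \<Longrightarrow> continuous_on S (\<lambda>x. entries (F x) m n)"
  unfolding entries_def by (intro continuous_intros)

lemma continuous_on_cholesky_chart:
  assumes F: "continuous_on S F" and piv: "\<And>x j. x \<in> S \<Longrightarrow> j < r \<Longrightarrow> schur M (entries (F x)) j (M j) (M j) > 0"
  shows "continuous_on S (\<lambda>x. cholesky_chart d M r (F x))"
proof (rule continuous_on_poly_mapping[of "{..<r} \<times> mons d"])
  show "Poly_Mapping.keys (cholesky_chart d M r (F x)) \<subseteq> {..<r} \<times> mons d" for x
  proof
    fix k assume "k \<in> Poly_Mapping.keys (cholesky_chart d M r (F x))"
    then show "k \<in> {..<r} \<times> mons d"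
      using lookup_pack[of d r "cholesky_form d M (F x)" "fst k" "snd k"]
      by (cases k) (auto simp: in_keys_iff cholesky_chart_def split: if_splits)
  qed
  show "continuous_on S (\<lambda>x. Poly_Mapping.lookup (cholesky_chart d M r (F x)) k)" if k: "k \<in> {..<r} \<times> mons d" for k
  proof -
    obtain j n where k: "k = (j, n)" "j < r" "n \<in> mons d" using k by auto
    have "continuous_on S (\<lambda>x. cholesky M (entries (F x)) j n)"
      using piv k(2) by (intro continuous_on_cholesky continuous_intros F) auto
    then show ?thesis using k by (simp add: cholesky_chart_def lookup_pack cholesky_form_def lookup_form_of)
  qed
qed simp

text \<open>The conclusion of \<open>local_coordinates\<close> around a triangular tuple \<open>p\<close>, with a radius \<open>e\<close> within which all
  tuples remain triangular.\<close>

definition gram_chart :: "nat \<Rightarrow> nat \<Rightarrow> (nat \<Rightarrow> mono2) \<Rightarrow> (nat \<times> mono2 \<Rightarrow>\<^sub>0 real) \<Rightarrow> (mono2 \<times> mono2) set \<Rightarrow> real \<Rightarrow> bool" where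
  "gram_chart d r M p C e \<longleftrightarrow> (\<forall>j<r. M j \<in> mons d) \<and> C \<subseteq> mons d \<times> mons d \<and>
     2 * d + 1 + card C = card (chart_keys d M r) \<and> e > 0 \<and> Poly_Mapping.keys p \<subseteq> chart_keys d M r \<and>
     (\<forall>q. Poly_Mapping.keys q \<subseteq> chart_keys d M r \<longrightarrow> dist q p < e \<longrightarrow> triangular M r (component q)) \<and>
     (\<forall>q q'. Poly_Mapping.keys q \<subseteq> chart_keys d M r \<longrightarrow> Poly_Mapping.keys q' \<subseteq> chart_keys d M r \<longrightarrow>
        dist q p < e \<longrightarrow> dist q' p < e \<longrightarrow>
        (\<forall>b\<in>mons (2 * d) <+> C. gram_coordinates d r q b = gram_coordinates d r q' b) \<longrightarrow> q = q')"

definition chart_ball :: "nat \<Rightarrow> nat \<Rightarrow> (nat \<Rightarrow> mono2) \<Rightarrow> (nat \<times> mono2 \<Rightarrow>\<^sub>0 real) \<Rightarrow> real \<Rightarrow> (nat \<times> mono2 \<Rightarrow>\<^sub>0 real) set" where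
  "chart_ball d r M p e = {q. Poly_Mapping.keys q \<subseteq> chart_keys d M r \<and> dist q p < e}"

lemma gram_chartD:
  assumes "gram_chart d r M p C e"
  shows "\<And>j. j < r \<Longrightarrow> M j \<in> mons d" "C \<subseteq> mons d \<times> mons d" "finite C"
    "2 * d + 1 + card C = card (chart_keys d M r)" "e > 0" "Poly_Mapping.keys p \<subseteq> chart_keys d M r"
    "\<And>q. q \<in> chart_ball d r M p e \<Longrightarrow> triangular M r (component q)"
    "\<And>q q'. q \<in> chart_ball d r M p e \<Longrightarrow> q' \<in> chart_ball d r M p e \<Longrightarrow>
       (\<And>b. b \<in> mons (2 * d) <+> C \<Longrightarrow> gram_coordinates d r q b = gram_coordinates d r q' b) \<Longrightarrow> q = q'"
    "p \<in> chart_ball d r M p e"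
  using assms finite_subset[of C "mons d \<times> mons d"] unfolding gram_chart_def chart_ball_def by auto

lemma gram_tensor_cong: "(\<And>j. j < r \<Longrightarrow> p j = q j) \<Longrightarrow> gram_tensor r p = gram_tensor r q"
  unfolding gram_tensor_def by (intro sum.cong) auto

lemma gram_chart_smaller: "gram_chart d r M p C e \<Longrightarrow> 0 < e' \<Longrightarrow> e' \<le> e \<Longrightarrow> gram_chart d r M p C e'"
  unfolding gram_chart_def by force

lemma triangular_inj_on:
  assumes "triangular M r p"
  shows "inj_on M {..<r}"
proof (rule inj_onI, rule ccontr)
  have ne: "M i \<noteq> M j" if "i < j" "j < r" for i j
    using assms that unfolding triangular_def by (metis less_irrefl)
  fix i j assume "i \<in> {..<r}" "j \<in> {..<r}" "M i = M j" "i \<noteq> j"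
  then show False using ne[of i j] ne[of j i] by (cases "i < j") auto
qed

lemma ex_gram_chart:
  assumes d: "d \<ge> 1" and \<theta>: "\<theta> \<in> psd_tensors d" "tensor_rank \<theta> = r" and reg: "regular_form d (mult_map \<theta>)"
  obtains M p C e where "gram_chart d r M p C e" "\<theta> = gram_tensor r (component p)"
proof -
  obtain M P where MP: "\<And>j. j < r \<Longrightarrow> M j \<in> mons d" "\<And>j. j < r \<Longrightarrow> P j \<in> binary_forms d"
    "triangular M r P" "\<theta> = gram_tensor r P"
    using psd_tensor_triangular[OF \<theta>(1)] unfolding \<theta>(2) by blast
  have "regular_form d (\<Sum>j<r. P j * P j)" using reg MP(4) by (simp add: mult_map_gram_tensor)
  then have span: "spans_multiples d r P" by (intro regular_form_spans_multiples[OF d]) (rule MP(2))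
  obtain C e where C: "C \<subseteq> mons d \<times> mons d" "2 * d + 1 + card C = card (chart_keys d M r)" "e > 0"
    and inj: "\<forall>q q'. Poly_Mapping.keys q \<subseteq> chart_keys d M r \<longrightarrow> Poly_Mapping.keys q' \<subseteq> chart_keys d M r \<longrightarrow>
       dist q (pack d r P) < e \<longrightarrow> dist q' (pack d r P) < e \<longrightarrow>
       (\<forall>b\<in>mons (2 * d) <+> C. gram_coordinates d r q b = gram_coordinates d r q' b) \<longrightarrow> q = q'"
    by (rule local_coordinates[of r P d M]) (rule MP(2), assumption, rule MP(1), assumption, rule MP(3), rule span, rule that)
  define p where "p = pack d r P"
  have p: "Poly_Mapping.keys p \<subseteq> chart_keys d M r" unfolding p_def by (rule keys_pack[OF MP(3)])
  have component_p: "component p j = P j" if "j < r" for j unfolding p_def by (rule component_pack[OF MP(2) that])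
  have "\<forall>j\<in>{..<r}. eventually (\<lambda>q. Poly_Mapping.lookup q (j, M j) > 0) (nhds p)"
  proof
    fix j assume j: "j \<in> {..<r}"
    have "Poly_Mapping.lookup p (j, M j) > 0"
      using MP(3) j component_p[of j] by (simp add: triangular_def lookup_component[symmetric])
    then show "eventually (\<lambda>q. Poly_Mapping.lookup q (j, M j) > 0) (nhds p)"
      by (intro order_tendstoD(1)[OF tendsto_lookup[OF filterlim_ident]])
  qed
  then have "eventually (\<lambda>q. \<forall>j\<in>{..<r}. Poly_Mapping.lookup q (j, M j) > 0) (nhds p)"
    by (intro eventually_ball_finite) auto
  then obtain e' where e': "e' > 0" "\<And>q j. dist q p < e' \<Longrightarrow> j < r \<Longrightarrow> Poly_Mapping.lookup q (j, M j) > 0"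
    unfolding eventually_nhds_metric by auto
  have "gram_chart d r M p C (min e e')"
    unfolding gram_chart_def
  proof (intro conjI allI impI)
    show "triangular M r (component q)" if "Poly_Mapping.keys q \<subseteq> chart_keys d M r" "dist q p < min e e'" for q
      using that e'(2) by (intro triangular_component) auto
    show "q = q'" if "Poly_Mapping.keys q \<subseteq> chart_keys d M r" "Poly_Mapping.keys q' \<subseteq> chart_keys d M r"
      "dist q p < min e e'" "dist q' p < min e e'"
      "\<forall>b\<in>mons (2 * d) <+> C. gram_coordinates d r q b = gram_coordinates d r q' b" for q q'
      using inj[rule_format, of q q'] that unfolding p_def by simp
  qed (use C MP(1) p e'(1) in auto)
  moreover have "\<theta> = gram_tensor r (component p)" unfolding MP(4) by (intro gram_tensor_cong) (simp add: component_p)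
  ultimately show thesis by (rule that)
qed

text \<open>The number of coordinates that are left after \<open>f\<close> has been fixed.\<close>

lemma card_chart:
  assumes "gram_chart d r M p C e"
  shows "real (card C) = 1 / 2 * (real r - 2) * (2 * real d - real r + 1)"
proof -
  note ch = gram_chartD[OF assms]
  have inj: "inj_on M {..<r}" by (rule triangular_inj_on[OF ch(7)[OF ch(9)]])
  have "r = card (M ` {..<r})" by (simp add: card_image[OF inj])
  also have "\<dots> \<le> card (mons d)" using ch(1) by (intro card_mono) auto
  finally have r: "r \<le> d + 1" by (simp add: card_mons)
  have "real (\<Sum>j<r. d + 1 - j) = real r * (real d + 1) - real r * (real r - 1) / 2"
    using r
  proof (induction r)
    case (Suc r)
    then show ?case by (simp add: of_nat_diff field_simps)
  qed simp
  then have "2 * real d + 1 + real (card C) = real r * (real d + 1) - real r * (real r - 1) / 2"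
    using ch(4) card_chart_keys[OF inj ch(1)] by (metis (no_types, lifting) of_nat_1 of_nat_add of_nat_mult of_nat_numeral)
  then show ?thesis by (simp add: field_simps)
qed

lemma gram_coordinates_Inl:
  assumes "Poly_Mapping.keys q \<subseteq> chart_keys d M r"
  shows "gram_coordinates d r q (Inl k) = Poly_Mapping.lookup (mult_map (gram_tensor r (component q))) k"
  unfolding gram_coordinates_def
  by (rule observable_entries) (intro gram_tensor_in_sym_tensors component_in_binary_forms[OF assms])

lemma gram_coordinates_Inr: "gram_coordinates d r q (Inr c) = entries (gram_tensor r (component q)) (fst c) (snd c)"
  by (simp add: gram_coordinates_def)

lemma cholesky_chart_inverse:
  assumes "Poly_Mapping.keys q \<subseteq> chart_keys d M r" "triangular M r (component q)"
  shows "cholesky_chart d M r (gram_tensor r (component q)) = q"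
proof -
  have "cholesky_form d M (gram_tensor r (component q)) j = component q j" if "j < r" for j
    using cholesky_form_gram_tensor(3)[OF component_in_binary_forms[OF assms(1)] assms(2) that] .
  then have "pack d r (cholesky_form d M (gram_tensor r (component q))) = pack d r (component q)"
    unfolding pack_def by (intro sum.cong) auto
  then show ?thesis using pack_component[OF assms(1)] by (simp add: cholesky_chart_def)
qed

lemma gram_tensor_cholesky_chart:
  assumes \<theta>: "\<theta> \<in> sym_tensors d" and M: "\<And>j. j < r \<Longrightarrow> M j \<in> mons d"
    and piv: "\<And>j. j < r \<Longrightarrow> schur M (entries \<theta>) j (M j) (M j) > 0"
    and zero: "\<And>m n. schur M (entries \<theta>) r m n = 0"
  shows "gram_tensor r (component (cholesky_chart d M r \<theta>)) = \<theta>"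
    and "Poly_Mapping.keys (cholesky_chart d M r \<theta>) \<subseteq> chart_keys d M r"
proof -
  note fac = cholesky_form_factorization[OF \<theta> M piv zero]
  have "gram_tensor r (component (cholesky_chart d M r \<theta>)) = gram_tensor r (cholesky_form d M \<theta>)"
    by (intro gram_tensor_cong) (simp add: cholesky_chart_def component_pack cholesky_form_in_binary_forms)
  then show "gram_tensor r (component (cholesky_chart d M r \<theta>)) = \<theta>" using fac(1) by simp
  show "Poly_Mapping.keys (cholesky_chart d M r \<theta>) \<subseteq> chart_keys d M r"
    unfolding cholesky_chart_def by (rule keys_pack[OF fac(2)])
qed

lemma continuous_on_gram_coordinates: "continuous_on S (\<lambda>q. gram_coordinates d r q b)"
  unfolding gram_coordinates_def entries_gram_tensor lookup_component
  by (intro continuous_on_observable continuous_intros)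

lemma gram_chart_open:
  assumes ch: "gram_chart d r M p C e" and S: "openin (top_of_set {q. Poly_Mapping.keys q \<subseteq> chart_keys d M r}) S"
    and sub: "S \<subseteq> chart_ball d r M p e" and q: "q \<in> S"
  obtains \<delta> where "\<delta> > 0" "\<And>y. (\<And>b. b \<in> mons (2 * d) <+> C \<Longrightarrow> \<bar>y b - gram_coordinates d r q b\<bar> < \<delta>) \<Longrightarrow>
    \<exists>q\<in>S. \<forall>b\<in>mons (2 * d) <+> C. gram_coordinates d r q b = y b"
proof (rule coordinate_invariance_of_domain[OF finite_chart_keys _ _ S _ _ q, of "mons (2 * d) <+> C" "gram_coordinates d r"])
  show "finite (mons (2 * d) <+> C)" using gram_chartD(3)[OF ch] by simp
  show "card (chart_keys d M r) = card (mons (2 * d) <+> C)"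
    using gram_chartD(3,4)[OF ch] by (simp add: card_Plus card_mons)
  show "x = y" if "x \<in> S" "y \<in> S" "\<And>b. b \<in> mons (2 * d) <+> C \<Longrightarrow> gram_coordinates d r x b = gram_coordinates d r y b" for x y
    using gram_chartD(8)[OF ch _ _ that(3)] that(1,2) sub by blast
qed (use continuous_on_gram_coordinates that in auto)

lemma openin_chart_ball: "openin (top_of_set {q. Poly_Mapping.keys q \<subseteq> chart_keys d M r}) (chart_ball d r M p e)"
proof -
  have "chart_ball d r M p e = {q. Poly_Mapping.keys q \<subseteq> chart_keys d M r} \<inter> ball p e"
    by (auto simp: chart_ball_def dist_commute)
  then show ?thesis by (simp add: openin_open_Int)
qed

section \<open>The upper bound for the dimension\<close>

lemma openin_open_cube: "openin (top_of_set {x. Poly_Mapping.keys x \<subseteq> {..<k}}) (open_cube k)"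
proof -
  have "open_cube k = {x. Poly_Mapping.keys x \<subseteq> {..<k}} \<inter>
      (\<Inter>i\<in>{..<k}. (\<lambda>x. Poly_Mapping.lookup x i) -` {0<..<1})"
    by (auto simp: open_cube_def coord_space_def)
  moreover have "open (\<Inter>i\<in>{..<k}. (\<lambda>x :: nat \<Rightarrow>\<^sub>0 real. Poly_Mapping.lookup x i) -` {0<..<1})"
    by (intro open_INT ballI open_vimage continuous_intros) auto
  ultimately show ?thesis by (simp add: openin_open_Int)
qed

lemma open_cube_nonempty: "open_cube k \<noteq> {}"
proof -
  have "(\<Sum>i<k. Poly_Mapping.single i (1/2)) \<in> open_cube k"
    by (auto simp: open_cube_def coord_space_def in_keys_iff lookup_sum lookup_single when_def split: if_splits)
  then show ?thesis by blast
qed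

lemma openin_positive:
  fixes h :: "'a::topological_space \<Rightarrow> real"
  assumes "continuous_on S h"
  shows "openin (top_of_set S) {x \<in> S. h x > 0}"
proof -
  have "{x \<in> S. h x > 0} = S \<inter> h -` {0<..}" by auto
  then show ?thesis using continuous_openin_preimage_gen[OF assms, of "{0<..}"] by simp
qed

text \<open>Near a point \<open>F x0\<close> of the cell the extreme points are determined by their entries at \<open>C\<close>, since their image under the multiplication is fixed.
  So these entries embed an open part of the \<open>k\<close>-dimensional cube into \<open>card C\<close>
  dimensions.\<close>

lemma cell_dimension_le:
  assumes d: "d \<ge> 1" and reg: "regular_form d f" and cell: "has_cell W (extreme_points_of_rank d r f) k"
  shows "real k \<le> 1 / 2 * (real r - 2) * (2 * real d - real r + 1)"
proof -
  obtain F G where F: "F ` open_cube k \<subseteq> extreme_points_of_rank d r f" and FG: "homeomorphism (open_cube k) (F ` open_cube k) F G"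
    using cell unfolding has_cell_def by blast
  have contF: "continuous_on (open_cube k) F" using FG by (simp add: homeomorphism_def)
  have F_psd: "F x \<in> psd_tensors d" "mult_map (F x) = f" "tensor_rank (F x) = r" if "x \<in> open_cube k" for x
    using F that by (auto simp: extreme_points_of_rank_def extreme_point_of_def gram_def)
  obtain x0 where x0: "x0 \<in> open_cube k" using open_cube_nonempty by blast
  obtain M p C e where ch: "gram_chart d r M p C e" and p: "F x0 = gram_tensor r (component p)"
    using ex_gram_chart[OF d F_psd(1,3)[OF x0]] F_psd(2)[OF x0] reg by metis
  note chD = gram_chartD[OF ch]
  define A where "A = {x \<in> open_cube k. \<forall>j\<in>{..<r}. schur M (entries (F x)) j (M j) (M j) > 0}"
  define S where "S = {x \<in> A. dist (cholesky_chart d M r (F x)) p < e}"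
  have "A = open_cube k \<inter> (\<Inter>j\<in>{..<r}. {x \<in> open_cube k. schur M (entries (F x)) j (M j) (M j) > 0})"
    by (auto simp: A_def)
  moreover have "openin (top_of_set (open_cube k)) (open_cube k \<inter> (\<Inter>j\<in>{..<r}. {x \<in> open_cube k. schur M (entries (F x)) j (M j) (M j) > 0}))"
    by (intro openin_Int_Inter) (auto intro!: openin_positive continuous_on_schur continuous_intros contF)
  ultimately have A: "openin (top_of_set (open_cube k)) A" by simp
  have chart_cont: "continuous_on A (\<lambda>x. cholesky_chart d M r (F x))"
    by (intro continuous_on_cholesky_chart continuous_on_subset[OF contF]) (auto simp: A_def)
  have "S = {x \<in> A. e - dist (cholesky_chart d M r (F x)) p > 0}" by (auto simp: S_def)
  moreover have "openin (top_of_set A) {x \<in> A. e - dist (cholesky_chart d M r (F x)) p > 0}"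
    by (intro openin_positive continuous_intros chart_cont)
  ultimately have "openin (top_of_set A) S" by simp
  then have S: "openin (top_of_set {x. Poly_Mapping.keys x \<subseteq> {..<k}}) S"
    using A openin_open_cube openin_trans by blast
  have "triangular M r (component p)" by (rule chD(7)[OF chD(9)])
  note V = component_in_binary_forms[OF chD(6)]
  have "x0 \<in> A" using x0 cholesky_form_gram_tensor(1)[OF V \<open>triangular M r (component p)\<close>] by (auto simp: A_def p)
  moreover have "cholesky_chart d M r (F x0) = p"
    unfolding p by (rule cholesky_chart_inverse[OF chD(6) \<open>triangular M r (component p)\<close>])
  ultimately have x0S: "x0 \<in> S" using chD(5) by (simp add: S_def)
  have SS: "S \<subseteq> open_cube k" by (auto simp: S_def A_def)
  have chart: "gram_tensor r (component (cholesky_chart d M r (F x))) = F x"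
    "cholesky_chart d M r (F x) \<in> chart_ball d r M p e" if x: "x \<in> S" for x
  proof -
    have psd: "F x \<in> psd_tensors d" "tensor_rank (F x) = r" using F_psd x SS by auto
    have piv: "schur M (entries (F x)) j (M j) (M j) > 0" if "j < r" for j using x that by (simp add: S_def A_def)
    have "schur M (entries (F x)) r m n = 0" for m n
      using psd_tensor_pivots_complete[OF psd(1), of M m n] piv chD(1) unfolding psd(2) by blast
    note g = gram_tensor_cholesky_chart[OF _ chD(1) piv this]
    have "F x \<in> sym_tensors d" using psd(1) psd_tensors_subset by blast
    then show "gram_tensor r (component (cholesky_chart d M r (F x))) = F x"
      "cholesky_chart d M r (F x) \<in> chart_ball d r M p e" using g x by (auto simp: chart_ball_def S_def)
  qed
  have "card {..<k} \<le> card C"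
  proof (rule coordinate_invariance_of_dimension[OF _ chD(3) S _ _ x0S])
    show "continuous_on S (\<lambda>x. entries (F x) (fst c) (snd c))" for c
      by (intro continuous_intros continuous_on_subset[OF contF SS])
    fix x y assume x: "x \<in> S" and y: "y \<in> S"
      and eq: "\<And>c. c \<in> C \<Longrightarrow> entries (F x) (fst c) (snd c) = entries (F y) (fst c) (snd c)"
    have "cholesky_chart d M r (F x) = cholesky_chart d M r (F y)"
    proof (rule chD(8)[OF chart(2)[OF x] chart(2)[OF y]])
      fix b :: "mono2 + mono2 \<times> mono2" assume b: "b \<in> mons (2 * d) <+> C"
      have keys: "Poly_Mapping.keys (cholesky_chart d M r (F z)) \<subseteq> chart_keys d M r" if "z \<in> S" for z
        using chart(2)[OF that] by (simp add: chart_ball_def)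
      have xy: "x \<in> open_cube k" "y \<in> open_cube k" using x y SS by auto
      show "gram_coordinates d r (cholesky_chart d M r (F x)) b = gram_coordinates d r (cholesky_chart d M r (F y)) b"
      proof (cases b)
        case (Inl m)
        then show ?thesis
          by (simp add: gram_coordinates_Inl[OF keys[OF x]] gram_coordinates_Inl[OF keys[OF y]] chart(1) x y F_psd(2) xy)
      next
        case (Inr c)
        then show ?thesis using b eq by (auto simp: gram_coordinates_Inr chart(1) x y)
      qed
    qed
    then have "gram_tensor r (component (cholesky_chart d M r (F x))) = gram_tensor r (component (cholesky_chart d M r (F y)))"
      by (simp only:)
    then have "F x = F y" unfolding chart(1)[OF x] chart(1)[OF y] .
    moreover have "G (F x) = x" "G (F y) = y" using x y SS by (auto intro!: homeomorphism_apply1[OF FG])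
    ultimately show "x = y" by metis
  qed simp
  then have "real k \<le> real (card C)" by simp
  then show ?thesis unfolding card_chart[OF ch] .
qed

section \<open>Stability of extremality\<close>

text \<open>By dehomogenization the products are independent iff the curve given by the components lies on no quadric, which is
  the injectivity of a matrix that depends continuously on the components.\<close>

lemma indep_products_near:
  assumes p: "Poly_Mapping.keys p \<subseteq> chart_keys d M r" and ind: "indep_products r (component p)"
  obtains e where "e > 0" "\<And>q. q \<in> chart_ball d r M p e \<Longrightarrow> indep_products r (component q)"
proof -
  let ?K = "{(i, j). i \<le> j \<and> j < r}"
  let ?f = "\<lambda>q t (i, j). dehomogenized_curve d (component q) t i * dehomogenized_curve d (component q) t j"
  have iff: "indep_products r (component q) \<longleftrightarrow> injective_system ?K UNIV (?f q)" if "Poly_Mapping.keys q \<subseteq> chart_keys d M r" for q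
    using indep_products_iff_off_quadrics[OF component_in_binary_forms[OF that]] off_quadrics_injective_system by simp
  have curve: "dehomogenized_curve d (component q) t i = (\<Sum>l\<le>d. Poly_Mapping.lookup q (i, (l, d - l)) * t ^ l)" for q t i
    by (simp add: dehomogenized_curve_def dehomogenize_def poly_sum poly_monom lookup_component)
  have "eventually (\<lambda>q. injective_system ?K UNIV (?f q)) (nhds p)"
  proof (rule injective_system_tendsto[OF finite_pairs_le])
    show "((\<lambda>q. ?f q t k) \<longlongrightarrow> ?f p t k) (nhds p)" for t k
      by (cases k) (auto simp: curve intro!: tendsto_intros filterlim_ident)
    show "injective_system ?K UNIV (?f p)" using ind iff[OF p] by simp
  qed
  then obtain e where "e > 0" "\<And>q. dist q p < e \<Longrightarrow> injective_system ?K UNIV (?f q)"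
    unfolding eventually_nhds_metric by blast
  then show thesis using that[of e] iff by (auto simp: chart_ball_def)
qed

definition extreme_chart :: "nat \<Rightarrow> nat \<Rightarrow> (nat \<Rightarrow> mono2) \<Rightarrow> (nat \<times> mono2 \<Rightarrow>\<^sub>0 real) \<Rightarrow> (mono2 \<times> mono2) set \<Rightarrow> real \<Rightarrow> bool" where
  "extreme_chart d r M p C e \<longleftrightarrow> gram_chart d r M p C e \<and> (\<forall>q\<in>chart_ball d r M p e. indep_products r (component q))"

lemma ex_extreme_chart:
  assumes d: "d \<ge> 1" and reg: "regular_form d f" and \<theta>: "\<theta> \<in> extreme_points_of_rank d r f"
  obtains M p C e where "extreme_chart d r M p C e" "\<theta> = gram_tensor r (component p)"
proof -
  have \<theta>': "\<theta> extreme_point_of gram d f" "\<theta> \<in> psd_tensors d" "mult_map \<theta> = f" "tensor_rank \<theta> = r"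
    using \<theta> by (auto simp: extreme_points_of_rank_def extreme_point_of_def gram_def)
  obtain M p C e where ch: "gram_chart d r M p C e" and p: "\<theta> = gram_tensor r (component p)"
    using ex_gram_chart[OF d \<theta>'(2,4)] reg unfolding \<theta>'(3) by metis
  note chD = gram_chartD[OF ch]
  have "indep_products r (component p)"
  proof (rule indep_products_if_extreme_point)
    show "component p j \<in> binary_forms d" for j by (rule component_in_binary_forms[OF chD(6)])
    show "indep_family r (component p)" by (rule indep_family_if_triangular[OF chD(7)[OF chD(9)]])
    show "gram_tensor r (component p) extreme_point_of gram d f" using \<theta>'(1) p by simp
  qed
  then obtain e' where e': "e' > 0" "\<And>q. q \<in> chart_ball d r M p e' \<Longrightarrow> indep_products r (component q)"
    using indep_products_near[OF chD(6)] by blast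
  have "extreme_chart d r M p C (min e e')"
    unfolding extreme_chart_def
  proof
    show "gram_chart d r M p C (min e e')" using e'(1) chD(5) by (intro gram_chart_smaller[OF ch]) auto
    show "\<forall>q\<in>chart_ball d r M p (min e e'). indep_products r (component q)"
      using e'(2) by (auto simp: chart_ball_def)
  qed
  then show thesis using p by (rule that)
qed

lemma extreme_chart_point:
  assumes ch: "extreme_chart d r M p C e" and q: "q \<in> chart_ball d r M p e" and f: "f \<in> binary_forms (2 * d)"
    and coord: "\<And>k. k \<in> mons (2 * d) \<Longrightarrow> gram_coordinates d r q (Inl k) = Poly_Mapping.lookup f k"
  shows "gram_tensor r (component q) \<in> extreme_points_of_rank d r f" "mult_map (gram_tensor r (component q)) = f"
proof -
  have keys: "Poly_Mapping.keys q \<subseteq> chart_keys d M r" using q by (simp add: chart_ball_def)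
  have V: "component q j \<in> binary_forms d" for j by (rule component_in_binary_forms[OF keys])
  have "mult_map (gram_tensor r (component q)) \<in> binary_forms (2 * d)"
    unfolding mult_map_gram_tensor by (intro subspace_sum[OF subspace_binary_forms] mult_in_binary_forms V)
  then show f_eq: "mult_map (gram_tensor r (component q)) = f"
    using coord f by (intro poly_mapping_eqI) (metis gram_coordinates_Inl[OF keys] lookup_binary_form)
  have "indep_products r (component q)" using ch q by (simp add: extreme_chart_def)
  then show "gram_tensor r (component q) \<in> extreme_points_of_rank d r f"
    using extreme_point_if_indep_products[of r "component q" d] V f_eq by simp
qed

text \<open>The coefficients of the form are among the local coordinates, so they can be prescribed
  freely near those of \<open>f\<close>, while the tuple stays in the region where the products are independent.\<close>

lemma extreme_points_open:
  assumes d: "d \<ge> 1" and reg: "regular_form d f" and f: "f \<in> binary_forms (2 * d)"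
    and ex: "extreme_points_of_rank d r f \<noteq> {}"
  obtains \<delta> where "\<delta> > 0" "\<And>g. g \<in> binary_forms (2 * d) \<Longrightarrow> dist g f < \<delta> \<Longrightarrow> extreme_points_of_rank d r g \<noteq> {}"
proof -
  obtain \<theta> where \<theta>: "\<theta> \<in> extreme_points_of_rank d r f" using ex by blast
  obtain M p C e where ch: "extreme_chart d r M p C e" and p: "\<theta> = gram_tensor r (component p)"
    using ex_extreme_chart[OF d reg \<theta>] by blast
  have gch: "gram_chart d r M p C e" using ch by (simp add: extreme_chart_def)
  note chD = gram_chartD[OF gch]
  obtain \<delta> where \<delta>: "\<delta> > 0" "\<And>y. (\<And>b. b \<in> mons (2 * d) <+> C \<Longrightarrow> \<bar>y b - gram_coordinates d r p b\<bar> < \<delta>) \<Longrightarrow>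
      \<exists>q\<in>chart_ball d r M p e. \<forall>b\<in>mons (2 * d) <+> C. gram_coordinates d r q b = y b"
    using gram_chart_open[OF gch openin_chart_ball order_refl chD(9)] by blast
  have mu: "mult_map (gram_tensor r (component p)) = f"
    using \<theta> p by (auto simp: extreme_points_of_rank_def extreme_point_of_def gram_def)
  show thesis
  proof (rule that[OF \<delta>(1)])
    fix g assume g: "g \<in> binary_forms (2 * d)" "dist g f < \<delta>"
    define y where "y = case_sum (Poly_Mapping.lookup g) (\<lambda>c. gram_coordinates d r p (Inr c))"
    have "\<bar>y b - gram_coordinates d r p b\<bar> < \<delta>" for b
    proof (cases b)
      case (Inl k)
      have "\<bar>Poly_Mapping.lookup (g - f) k\<bar> \<le> dist g f" unfolding dist_norm by (rule abs_lookup_le_norm)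
      then show ?thesis using g(2) by (simp add: Inl y_def gram_coordinates_Inl[OF chD(6)] mu lookup_minus)
    qed (use \<delta>(1) in \<open>simp add: y_def\<close>)
    then obtain q where q: "q \<in> chart_ball d r M p e" "\<forall>b\<in>mons (2 * d) <+> C. gram_coordinates d r q b = y b"
      using \<delta>(2) by blast
    have "gram_tensor r (component q) \<in> extreme_points_of_rank d r g"
    proof (rule extreme_chart_point(1)[OF ch q(1) g(1)])
      show "gram_coordinates d r q (Inl k) = Poly_Mapping.lookup g k" if "k \<in> mons (2 * d)" for k
        using q(2)[rule_format, OF InlI[OF that]] by (simp add: y_def)
    qed
    then show "extreme_points_of_rank d r g \<noteq> {}" by blast
  qed
qed

section \<open>The lower bound for the dimension\<close>

lemma semialgebraic_in_conj:
  assumes "semialgebraic_in W {x \<in> W. P x}" "semialgebraic_in W {x \<in> W. Q x}"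
  shows "semialgebraic_in W {x \<in> W. P x \<and> Q x}"
proof -
  have "{x \<in> W. P x \<and> Q x} = W - ((W - {x \<in> W. P x}) \<union> (W - {x \<in> W. Q x}))" by auto
  then show ?thesis using assms by (simp add: semialgebraic_in.compl semialgebraic_in.union)
qed

lemma semialgebraic_in_eq_0:
  assumes "real_polynomial_function h"
  shows "semialgebraic_in W {x \<in> W. h x = 0}"
proof -
  have "{x \<in> W. h x = 0} = W - ({x \<in> W. h x > 0} \<union> {x \<in> W. - h x > 0})" by auto
  then show ?thesis
    using assms by (simp only:) (intro semialgebraic_in.compl semialgebraic_in.union semialgebraic_in.positive real_polynomial_function_minus)
qed

lemma semialgebraic_in_ball:
  assumes "finite I" "\<And>i. i \<in> I \<Longrightarrow> semialgebraic_in W {x \<in> W. P i x}"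
  shows "semialgebraic_in W {x \<in> W. \<forall>i\<in>I. P i x}"
  using assms
proof (induction I rule: finite_induct)
  case empty
  have "semialgebraic_in W {x \<in> W. (1::real) > 0}" by (intro semialgebraic_in.positive real_polynomial_function.intros(2))
  then show ?case by simp
next
  case (insert i I)
  then show ?case using semialgebraic_in_conj[of W "P i" "\<lambda>x. \<forall>i\<in>I. P i x"] by simp
qed

lemma real_polynomial_function_schur:
  assumes "\<And>m n. real_polynomial_function (\<lambda>x. A x m n)"
  shows "real_polynomial_function (\<lambda>x. schur M (A x) j m n)"
  using assms by (induction j arbitrary: m n) (auto intro!: real_polynomial_function_diff real_polynomial_function.intros(4))

lemma real_polynomial_function_entries:
  "real_polynomial_function (\<lambda>z :: (nat \<Rightarrow>\<^sub>0 real) \<times> tensor2. entries (snd z) m n)"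
  unfolding entries_def
  by (intro real_polynomial_function.intros(1) bounded_linear_compose[OF bounded_linear_lookup bounded_linear_snd])

lemma real_polynomial_function_coordinate:
  "real_polynomial_function (\<lambda>z :: (nat \<Rightarrow>\<^sub>0 real) \<times> tensor2. Poly_Mapping.lookup (fst z) i)"
  by (intro real_polynomial_function.intros(1) bounded_linear_compose[OF bounded_linear_lookup bounded_linear_fst])

lemma real_polynomial_function_observable:
  "real_polynomial_function (\<lambda>z :: (nat \<Rightarrow>\<^sub>0 real) \<times> tensor2. observable d (entries (snd z)) b)"
proof (cases b)
  case (Inl k)
  have "real_polynomial_function (\<lambda>z :: (nat \<Rightarrow>\<^sub>0 real) \<times> tensor2.
      \<Sum>mn\<in>mons d \<times> mons d. if fst mn + snd mn = k then entries (snd z) (fst mn) (snd mn) else 0)"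
  proof (rule real_polynomial_function_sum)
    show "real_polynomial_function (\<lambda>z :: (nat \<Rightarrow>\<^sub>0 real) \<times> tensor2.
        if fst mn + snd mn = k then entries (snd z) (fst mn) (snd mn) else 0)" for mn
      by (cases "fst mn + snd mn = k") (simp_all add: real_polynomial_function_entries real_polynomial_function.intros(2))
  qed simp
  then show ?thesis by (simp add: Inl case_prod_beta)
qed (simp add: real_polynomial_function_entries)

text \<open>With \<open>f\<close> fixed, prescribe the entries at \<open>C\<close> in a small cube around those of \<open>\<theta>\<close>. Solving for the tuple
  gives the cell. A tensor \<open>y\<close> near \<open>\<theta>\<close> belongs to it iff its first \<open>r\<close> pivots are positive, the next
  Schur complement vanishes, its image is \<open>f\<close> and its entries at \<open>C\<close> are the prescribed ones; all these
  conditions are polynomial.\<close>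

lemma ex_cell_of_extreme_points:
  assumes d: "d \<ge> 1" and reg: "regular_form d f" and f: "f \<in> binary_forms (2 * d)"
    and ex: "extreme_points_of_rank d r f \<noteq> {}"
  obtains k where "real k = 1 / 2 * (real r - 2) * (2 * real d - real r + 1)"
    "has_cell (sym_tensors d) (extreme_points_of_rank d r f) k"
proof -
  obtain \<theta> where \<theta>: "\<theta> \<in> extreme_points_of_rank d r f" using ex by blast
  obtain M p C e where ch: "extreme_chart d r M p C e" and p: "\<theta> = gram_tensor r (component p)"
    using ex_extreme_chart[OF d reg \<theta>] by blast
  have gch: "gram_chart d r M p C e" using ch by (simp add: extreme_chart_def)
  note chD = gram_chartD[OF gch]
  define J where "J = chart_keys d M r"
  define N where "N = card C"
  define mm where "mm = mons d \<times> mons d"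
  have V: "component q j \<in> binary_forms d" if "Poly_Mapping.keys q \<subseteq> J" for q j
    by (rule component_in_binary_forms[OF that[unfolded J_def]])
  have sym: "gram_tensor r (component q) \<in> sym_tensors d" if "Poly_Mapping.keys q \<subseteq> J" for q
    by (rule gram_tensor_in_sym_tensors) (rule V[OF that])
  have ball_keys: "Poly_Mapping.keys q \<subseteq> J" if "q \<in> chart_ball d r M p e" for q
    using that by (simp add: chart_ball_def J_def)
  have mu: "mult_map \<theta> = f" using \<theta> by (auto simp: extreme_points_of_rank_def extreme_point_of_def gram_def)
  have \<theta>_sym: "\<theta> \<in> sym_tensors d" unfolding p by (rule sym[OF ball_keys[OF chD(9)]])
  define Y where "Y = {y \<in> sym_tensors d. \<forall>j<r. schur M (entries y) j (M j) (M j) > 0}"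
  have pivots: "\<And>j. j < r \<Longrightarrow> schur M (entries (gram_tensor r (component q))) j (M j) (M j) > 0"
    "\<And>m n. schur M (entries (gram_tensor r (component q))) r m n = 0"
    "cholesky_chart d M r (gram_tensor r (component q)) = q" if q: "q \<in> chart_ball d r M p e" for q
    using cholesky_form_gram_tensor(1,2)[OF V[OF ball_keys[OF q]] chD(7)[OF q]]
      cholesky_chart_inverse[OF ball_keys[OF q, unfolded J_def] chD(7)[OF q]] by auto
  have "\<theta> \<in> Y" using pivots(1)[OF chD(9)] \<theta>_sym by (simp add: Y_def p)
  have "continuous_on Y (\<lambda>y. cholesky_chart d M r y)"
    by (rule continuous_on_cholesky_chart[OF continuous_on_id]) (simp add: Y_def)
  then obtain \<rho>0 where \<rho>0: "\<rho>0 > 0" "\<And>y. y \<in> Y \<Longrightarrow> dist y \<theta> < \<rho>0 \<Longrightarrow> dist (cholesky_chart d M r y) p < e"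
    using \<open>\<theta> \<in> Y\<close> chD(5) pivots(3)[OF chD(9)] unfolding continuous_on_iff p by metis
  \<comment> \<open>The norm is the sum of the absolute values of the entries, but nearness has to be a polynomial condition.\<close>
  define \<rho> where "\<rho> = \<rho>0 / (real (card mm) + 1)"
  define near where "near y \<longleftrightarrow> (\<forall>mn\<in>mm. \<rho>\<^sup>2 - (entries y (fst mn) (snd mn) - entries \<theta> (fst mn) (snd mn))\<^sup>2 > 0)" for y
  have \<rho>: "\<rho> > 0" using \<rho>0(1) by (simp add: \<rho>_def add_nonneg_pos)
  have near_dist: "dist y \<theta> < \<rho>0" if y: "y \<in> sym_tensors d" "near y" for y
  proof -
    have "Poly_Mapping.keys (y - \<theta>) \<subseteq> mm"
    proof
      fix k assume "k \<in> Poly_Mapping.keys (y - \<theta>)"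
      then have "k \<in> Poly_Mapping.keys y \<union> Poly_Mapping.keys \<theta>" by (auto simp: in_keys_iff lookup_minus)
      then show "k \<in> mm" using y(1) \<theta>_sym unfolding sym_tensors_iff mm_def by blast
    qed
    then have "dist y \<theta> = (\<Sum>k\<in>mm. \<bar>Poly_Mapping.lookup (y - \<theta>) k\<bar>)"
      unfolding dist_norm by (intro norm_poly_mapping_eq_sum) (simp add: mm_def)
    also have "\<dots> \<le> (\<Sum>k\<in>mm. \<rho>)"
    proof (rule sum_mono)
      fix k assume "k \<in> mm"
      then have "(Poly_Mapping.lookup (y - \<theta>) k)\<^sup>2 < \<rho>\<^sup>2" using y(2) by (simp add: near_def entries_def lookup_minus)
      then show "\<bar>Poly_Mapping.lookup (y - \<theta>) k\<bar> \<le> \<rho>" 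
        using \<rho> abs_le_square_iff[of "Poly_Mapping.lookup (y - \<theta>) k" \<rho>] by simp
    qed
    also have "\<dots> = real (card mm) * \<rho>" by simp
    also have "\<dots> < \<rho>0" using \<rho>0(1) by (simp add: \<rho>_def field_simps)
    finally show ?thesis .
  qed
  define S where "S = {q \<in> chart_ball d r M p e. near (gram_tensor r (component q))}"
  have "S = chart_ball d r M p e \<inter> (\<Inter>mn\<in>mm. {q \<in> chart_ball d r M p e.
      \<rho>\<^sup>2 - (entries (gram_tensor r (component q)) (fst mn) (snd mn) - entries \<theta> (fst mn) (snd mn))\<^sup>2 > 0})"
    by (auto simp: S_def near_def)
  moreover have "openin (top_of_set (chart_ball d r M p e)) (chart_ball d r M p e \<inter> (\<Inter>mn\<in>mm. {q \<in> chart_ball d r M p e.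
      \<rho>\<^sup>2 - (entries (gram_tensor r (component q)) (fst mn) (snd mn) - entries \<theta> (fst mn) (snd mn))\<^sup>2 > 0}))"
  proof (rule openin_Int_Inter)
    have "openin (top_of_set (chart_ball d r M p e)) {q \<in> chart_ball d r M p e.
        \<rho>\<^sup>2 - (entries (gram_tensor r (component q)) (fst mn) (snd mn) - entries \<theta> (fst mn) (snd mn))\<^sup>2 > 0}" for mn
      by (intro openin_positive, simp only: entries_gram_tensor lookup_component) (intro continuous_intros)
    then show "openin (top_of_set (chart_ball d r M p e)) A"
      if "A \<in> (\<lambda>mn. {q \<in> chart_ball d r M p e.
        \<rho>\<^sup>2 - (entries (gram_tensor r (component q)) (fst mn) (snd mn) - entries \<theta> (fst mn) (snd mn))\<^sup>2 > 0}) ` mm" for A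
      using that by blast
  qed (simp_all add: mm_def)
  ultimately have "openin (top_of_set (chart_ball d r M p e)) S" by simp
  then have S: "openin (top_of_set {q. Poly_Mapping.keys q \<subseteq> chart_keys d M r}) S"
    using openin_chart_ball openin_trans by blast
  have S_ball: "S \<subseteq> chart_ball d r M p e" by (auto simp: S_def)
  have "p \<in> S" using chD(9) \<rho> by (simp add: S_def near_def p)
  obtain \<delta> where \<delta>: "\<delta> > 0" "\<And>y. (\<And>b. b \<in> mons (2 * d) <+> C \<Longrightarrow> \<bar>y b - gram_coordinates d r p b\<bar> < \<delta>) \<Longrightarrow>
      \<exists>q\<in>S. \<forall>b\<in>mons (2 * d) <+> C. gram_coordinates d r q b = y b"
    using gram_chart_open[OF gch S S_ball \<open>p \<in> S\<close>] by blast
  obtain \<iota> where \<iota>: "bij_betw \<iota> C {..<N}"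
    using ex_bij_betw_finite_nat[OF chD(3)] by (auto simp: N_def atLeast0LessThan)
  have \<iota>_less: "\<iota> c < N" if "c \<in> C" for c using \<iota> that by (auto simp: bij_betw_def)
  define coord where "coord x = case_sum (Poly_Mapping.lookup f)
      (\<lambda>c. entries \<theta> (fst c) (snd c) + \<delta> * (Poly_Mapping.lookup x (\<iota> c) - 1 / 2))" for x :: "nat \<Rightarrow>\<^sub>0 real"
  have coord_p: "gram_coordinates d r p b = case_sum (Poly_Mapping.lookup f) (\<lambda>c. entries \<theta> (fst c) (snd c)) b" for b
    using mu by (cases b) (simp_all add: gram_coordinates_Inl[OF chD(6)] gram_coordinates_Inr p)
  have "\<exists>q. q \<in> S \<and> (\<forall>b\<in>mons (2 * d) <+> C. gram_coordinates d r q b = coord x b)" if x: "x \<in> open_cube N" for x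
  proof -
    have "\<bar>coord x b - gram_coordinates d r p b\<bar> < \<delta>" if b: "b \<in> mons (2 * d) <+> C" for b
    proof (cases b)
      case (Inr c)
      then have "0 < Poly_Mapping.lookup x (\<iota> c)" "Poly_Mapping.lookup x (\<iota> c) < 1"
        using b x \<iota>_less by (auto simp: open_cube_def)
      then have "\<bar>Poly_Mapping.lookup x (\<iota> c) - 1 / 2\<bar> < 1" by linarith
      then have "\<delta> * \<bar>Poly_Mapping.lookup x (\<iota> c) - 1 / 2\<bar> < \<delta> * 1" using \<delta>(1) by (intro mult_strict_left_mono)
      then show ?thesis using \<delta>(1) by (simp add: Inr coord_p coord_def abs_mult)
    qed (use \<delta>(1) in \<open>simp add: coord_p coord_def\<close>)
    then show ?thesis using \<delta>(2)[of "coord x"] by blast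
  qed
  then obtain sol where sol: "\<And>x. x \<in> open_cube N \<Longrightarrow> sol x \<in> S"
    "\<And>x b. x \<in> open_cube N \<Longrightarrow> b \<in> mons (2 * d) <+> C \<Longrightarrow> gram_coordinates d r (sol x) b = coord x b"
    by metis
  have sol_ball: "sol x \<in> chart_ball d r M p e" if "x \<in> open_cube N" for x using sol(1)[OF that] S_ball by blast
  have sol_unique: "q = sol x" if x: "x \<in> open_cube N" and q: "q \<in> chart_ball d r M p e"
    "\<And>b. b \<in> mons (2 * d) <+> C \<Longrightarrow> gram_coordinates d r q b = coord x b" for x q
    by (rule chD(8)[OF q(1) sol_ball[OF x]]) (simp add: q(2) sol(2)[OF x])
  have cont_sol: "continuous_on (open_cube N) sol"
    unfolding continuous_on_iff
  proof (intro ballI allI impI)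
    fix x \<eta> assume x: "x \<in> open_cube N" and \<eta>: "(\<eta>::real) > 0"
    \<comment> \<open>Solve once more, close to \<open>sol x\<close>; by uniqueness the solution found there is \<open>sol x'\<close>.\<close>
    define S' where "S' = S \<inter> ball (sol x) \<eta>"
    have S': "openin (top_of_set {q. Poly_Mapping.keys q \<subseteq> chart_keys d M r}) S'"
      unfolding S'_def by (intro openin_Int_open S) simp
    have "S' \<subseteq> chart_ball d r M p e" "sol x \<in> S'" using S_ball sol(1)[OF x] \<eta> by (auto simp: S'_def)
    then obtain \<delta>' where \<delta>': "\<delta>' > 0" "\<And>y. (\<And>b. b \<in> mons (2 * d) <+> C \<Longrightarrow> \<bar>y b - gram_coordinates d r (sol x) b\<bar> < \<delta>') \<Longrightarrow>
        \<exists>q\<in>S'. \<forall>b\<in>mons (2 * d) <+> C. gram_coordinates d r q b = y b"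
      using gram_chart_open[OF gch S'] by blast
    show "\<exists>\<epsilon>>0. \<forall>x'\<in>open_cube N. dist x' x < \<epsilon> \<longrightarrow> dist (sol x') (sol x) < \<eta>"
    proof (intro exI conjI ballI impI)
      show "\<delta>' / \<delta> > 0" using \<delta>(1) \<delta>'(1) by simp
      fix x' assume x': "x' \<in> open_cube N" and close: "dist x' x < \<delta>' / \<delta>"
      have "\<bar>coord x' b - gram_coordinates d r (sol x) b\<bar> < \<delta>'" if b: "b \<in> mons (2 * d) <+> C" for b
      proof (cases b)
        case (Inr c)
        have "\<bar>Poly_Mapping.lookup (x' - x) (\<iota> c)\<bar> \<le> dist x' x" unfolding dist_norm by (rule abs_lookup_le_norm)
        then have "\<delta> * \<bar>Poly_Mapping.lookup x' (\<iota> c) - Poly_Mapping.lookup x (\<iota> c)\<bar> < \<delta> * (\<delta>' / \<delta>)"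
          using close \<delta>(1) by (intro mult_strict_left_mono) (auto simp: lookup_minus)
        moreover have "coord x' b - gram_coordinates d r (sol x) b = \<delta> * (Poly_Mapping.lookup x' (\<iota> c) - Poly_Mapping.lookup x (\<iota> c))"
          using sol(2)[OF x b] by (simp add: Inr coord_def algebra_simps)
        ultimately show ?thesis using \<delta>(1) by (simp add: abs_mult)
      next
        case (Inl k)
        then show ?thesis using sol(2)[OF x b] \<delta>'(1) by (simp add: coord_def)
      qed
      then obtain q where q: "q \<in> S'" "\<forall>b\<in>mons (2 * d) <+> C. gram_coordinates d r q b = coord x' b"
        using \<delta>'(2)[of "coord x'"] by blast
      have "q = sol x'" by (rule sol_unique[OF x']) (use q S_ball in \<open>auto simp: S'_def\<close>)
      then show "dist (sol x') (sol x) < \<eta>" using q(1) by (simp add: S'_def dist_commute)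
    qed
  qed
  define F where "F x = gram_tensor r (component (sol x))" for x
  have F_sym: "F x \<in> sym_tensors d" if "x \<in> open_cube N" for x
    unfolding F_def by (rule sym[OF ball_keys[OF sol_ball[OF that]]])
  have cont_F: "continuous_on (open_cube N) F"
  proof (rule continuous_on_poly_mapping[of mm])
    show "finite mm" by (simp add: mm_def)
    show "Poly_Mapping.keys (F x) \<subseteq> mm" if "x \<in> open_cube N" for x
      using F_sym[OF that] by (simp add: sym_tensors_iff mm_def)
    fix k assume "k \<in> mm"
    then obtain m n where "k = (m, n)" by (cases k)
    then show "continuous_on (open_cube N) (\<lambda>x. Poly_Mapping.lookup (F x) k)"
      by (simp add: F_def lookup_gram_tensor lookup_component) (intro continuous_intros cont_sol)
  qed
  have F_Inl: "observable d (entries (F x)) (Inl k) = Poly_Mapping.lookup f k" if "x \<in> open_cube N" "k \<in> mons (2 * d)" for x k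
    using sol(2)[OF that(1) InlI[OF that(2)]] by (simp add: F_def coord_def gram_coordinates_def)
  have F_Inr: "entries (F x) (fst c) (snd c) = entries \<theta> (fst c) (snd c) + \<delta> * (Poly_Mapping.lookup x (\<iota> c) - 1 / 2)"
    if "x \<in> open_cube N" "c \<in> C" for x c
    using sol(2)[OF that(1) InrI[OF that(2)]] by (simp add: F_def coord_def gram_coordinates_Inr)
  have F_extreme: "F x \<in> extreme_points_of_rank d r f" if x: "x \<in> open_cube N" for x
    unfolding F_def
  proof (rule extreme_chart_point(1)[OF ch sol_ball[OF x] f])
    show "gram_coordinates d r (sol x) (Inl k) = Poly_Mapping.lookup f k" if "k \<in> mons (2 * d)" for k
      using sol(2)[OF x InlI[OF that]] by (simp add: coord_def)
  qed
  define G where "G y = (\<Sum>c\<in>C. Poly_Mapping.single (\<iota> c) ((entries y (fst c) (snd c) - entries \<theta> (fst c) (snd c)) / \<delta> + 1 / 2))" for y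
  have GF: "G (F x) = x" if x: "x \<in> open_cube N" for x
  proof -
    have "G (F x) = (\<Sum>c\<in>C. Poly_Mapping.single (\<iota> c) (Poly_Mapping.lookup x (\<iota> c)))"
      unfolding G_def using \<delta>(1) by (intro sum.cong) (simp_all add: F_Inr[OF x])
    also have "\<dots> = (\<Sum>i<N. Poly_Mapping.single i (Poly_Mapping.lookup x i))"
      by (rule sum.reindex_bij_betw[OF \<iota>])
    also have "\<dots> = x" using x by (intro poly_mapping_sum_single) (auto simp: open_cube_def coord_space_def)
    finally show ?thesis .
  qed
  have homeo: "homeomorphism (open_cube N) (F ` open_cube N) F G"
    unfolding homeomorphism_def
  proof (intro conjI ballI)
    show "G ` F ` open_cube N = open_cube N" by (auto simp: GF image_iff)
    show "continuous_on (F ` open_cube N) G" unfolding G_def by (intro continuous_intros) (use \<delta>(1) in auto)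
  qed (use GF cont_F in auto)
  let ?W = "coord_space N \<times> sym_tensors d"
  define graph where "graph = {z \<in> ?W. (\<forall>i\<in>{..<N}. Poly_Mapping.lookup (fst z) i > 0) \<and> (\<forall>i\<in>{..<N}. 1 - Poly_Mapping.lookup (fst z) i > 0) \<and>
      (\<forall>j\<in>{..<r}. schur M (entries (snd z)) j (M j) (M j) > 0) \<and> (\<forall>mn\<in>mm. schur M (entries (snd z)) r (fst mn) (snd mn) = 0) \<and>
      (\<forall>mn\<in>mm. \<rho>\<^sup>2 - (entries (snd z) (fst mn) (snd mn) - entries \<theta> (fst mn) (snd mn))\<^sup>2 > 0) \<and>
      (\<forall>k\<in>mons (2 * d). observable d (entries (snd z)) (Inl k) - Poly_Mapping.lookup f k = 0) \<and>
      (\<forall>c\<in>C. entries (snd z) (fst c) (snd c) - (entries \<theta> (fst c) (snd c) + \<delta> * (Poly_Mapping.lookup (fst z) (\<iota> c) - 1 / 2)) = 0)}"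
  note rpf = real_polynomial_function_diff real_polynomial_function.intros(2,3,4) real_polynomial_function_power
    real_polynomial_function_coordinate real_polynomial_function_entries real_polynomial_function_observable
    real_polynomial_function_schur
  have "semialgebraic_in ?W graph"
    unfolding graph_def
    by (intro semialgebraic_in_conj semialgebraic_in_ball semialgebraic_in.positive semialgebraic_in_eq_0 rpf)
       (use chD(3) in \<open>simp_all add: mm_def\<close>)
  also have "graph = (\<lambda>x. (x, F x)) ` open_cube N"
  proof (intro equalityI subsetI)
    fix z assume "z \<in> (\<lambda>x. (x, F x)) ` open_cube N"
    then obtain x where x: "x \<in> open_cube N" and z: "z = (x, F x)" by blast
    have "near (F x)" using sol(1)[OF x] by (simp add: S_def F_def)
    then show "z \<in> graph"
      using x F_sym[OF x] pivots(1,2)[OF sol_ball[OF x]] F_Inl[OF x] F_Inr[OF x]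
      by (simp add: graph_def z near_def open_cube_def F_def[symmetric] del: observable.simps(1))
  next
    fix z assume z: "z \<in> graph"
    define x where "x = fst z"
    define y where "y = snd z"
    have x: "x \<in> open_cube N" using z by (auto simp: graph_def x_def open_cube_def)
    have y_sym: "y \<in> sym_tensors d" using z by (auto simp: graph_def y_def)
    have piv: "schur M (entries y) j (M j) (M j) > 0" if "j < r" for j using z that by (simp add: graph_def y_def)
    have zero: "schur M (entries y) r m n = 0" for m n
    proof (cases "(m, n) \<in> mm")
      case True
      then show ?thesis using z by (force simp: graph_def y_def)
    next
      case False
      then have "m \<notin> mons d \<or> n \<notin> mons d" by (simp add: mm_def)
      moreover have "schur M (entries y) r m n = schur M (entries y) r n m" by (rule schur_sym) (rule entries_sym[OF y_sym])
      moreover have "schur M (entries y) r a b = 0" if "a \<notin> mons d" for a b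
        by (rule schur_support) (rule entries_outside[OF y_sym that])
      ultimately show ?thesis by metis
    qed
    note chart = gram_tensor_cholesky_chart[OF y_sym chD(1) piv zero]
    have "near y" using z by (simp add: graph_def y_def near_def)
    then have "dist (cholesky_chart d M r y) p < e"
      using y_sym piv by (intro \<rho>0(2) near_dist) (auto simp: Y_def)
    then have ball: "cholesky_chart d M r y \<in> chart_ball d r M p e" using chart(2) by (simp add: chart_ball_def)
    have "cholesky_chart d M r y = sol x"
    proof (rule sol_unique[OF x ball])
      fix b :: "mono2 + mono2 \<times> mono2" assume "b \<in> mons (2 * d) <+> C"
      then have "observable d (entries y) b = coord x b"
        using z by (auto simp: graph_def x_def y_def coord_def simp del: observable.simps(1))
      then show "gram_coordinates d r (cholesky_chart d M r y) b = coord x b"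
        by (simp only: gram_coordinates_def chart(1))
    qed
    then have "y = F x" using chart(1) by (simp add: F_def)
    then have "z = (x, F x)" by (simp add: x_def y_def prod_eq_iff)
    then show "z \<in> (\<lambda>x. (x, F x)) ` open_cube N" using x by blast
  qed
  finally have "has_cell (sym_tensors d) (extreme_points_of_rank d r f) N"
    unfolding has_cell_def using F_extreme homeo by blast
  then show thesis using that[of N] card_chart[OF gch] by (simp add: N_def)
qed

theorem dimension_of_extreme_points:
  assumes "d \<ge> 1" "regular_form d f" "f \<in> binary_forms (2 * d)" "extreme_points_of_rank d r f \<noteq> {}"
  shows "semialg_dim (sym_tensors d) (extreme_points_of_rank d r f) = ereal (1 / 2 * (real r - 2) * (2 * real d - real r + 1))"
  unfolding semialg_dim_def
proof (rule antisym)
  show "(SUP k\<in>{k. has_cell (sym_tensors d) (extreme_points_of_rank d r f) k}. ereal (real k))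
      \<le> ereal (1 / 2 * (real r - 2) * (2 * real d - real r + 1))"
    using cell_dimension_le[OF assms(1,2)] by (intro SUP_least) simp
  obtain k where k: "real k = 1 / 2 * (real r - 2) * (2 * real d - real r + 1)"
    "has_cell (sym_tensors d) (extreme_points_of_rank d r f) k"
    using ex_cell_of_extreme_points[OF assms] by blast
  have "ereal (real k) \<le> (SUP k\<in>{k. has_cell (sym_tensors d) (extreme_points_of_rank d r f) k}. ereal (real k))"
    using k(2) by (intro SUP_upper) simp
  then show "ereal (1 / 2 * (real r - 2) * (2 * real d - real r + 1))
      \<le> (SUP k\<in>{k. has_cell (sym_tensors d) (extreme_points_of_rank d r f) k}. ereal (real k))"
    by (simp only: k(1))
qed

section \<open>Generic sums of squares\<close>

definition good_forms :: "nat \<Rightarrow> nat set \<Rightarrow> poly2 set" where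
  "good_forms d R = {f \<in> sos_cone d. regular_form d f \<and> (\<forall>r\<in>R. extreme_points_of_rank d r f \<noteq> {})}"

lemma good_forms_open:
  assumes d: "d \<ge> 1" and R: "finite R" and f: "f \<in> good_forms d R"
  obtains \<delta> where "\<delta> > 0" "\<And>g. g \<in> sos_cone d \<Longrightarrow> dist g f < \<delta> \<Longrightarrow> g \<in> good_forms d R"
proof -
  have f': "f \<in> binary_forms (2 * d)" "regular_form d f" "\<And>r. r \<in> R \<Longrightarrow> extreme_points_of_rank d r f \<noteq> {}"
    using f sos_cone_binary_form by (auto simp: good_forms_def)
  have "\<forall>r\<in>R. eventually (\<lambda>g. g \<in> binary_forms (2 * d) \<longrightarrow> extreme_points_of_rank d r g \<noteq> {}) (nhds f)"
  proof
    fix r assume "r \<in> R"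
    from extreme_points_open[OF d f'(2,1) f'(3)[OF this]]
    show "eventually (\<lambda>g. g \<in> binary_forms (2 * d) \<longrightarrow> extreme_points_of_rank d r g \<noteq> {}) (nhds f)"
      unfolding eventually_nhds_metric by metis
  qed
  then have "eventually (\<lambda>g. \<forall>r\<in>R. g \<in> binary_forms (2 * d) \<longrightarrow> extreme_points_of_rank d r g \<noteq> {}) (nhds f)"
    using R by (intro eventually_ball_finite)
  moreover note eventually_regular_form[OF f'(2)]
  ultimately have "eventually (\<lambda>g. g \<in> sos_cone d \<longrightarrow> g \<in> good_forms d R) (nhds f)"
    by eventually_elim (auto simp: good_forms_def dest: sos_cone_binary_form)
  then show thesis using that unfolding eventually_nhds_metric by blast
qed

text \<open>Induction on \<open>R\<close>: approximate a good form for \<open>R\<close> by a sum of two squares and this sum by a form with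
  extreme points of rank \<open>r\<close>, staying within the open set of good forms for \<open>R\<close>.\<close>

lemma good_forms_dense:
  assumes d: "d \<ge> 1" and R: "finite R" "\<And>r. r \<in> R \<Longrightarrow> 2 \<le> r \<and> (r + 1) choose 2 \<le> 2 * d + 1"
    and f: "f \<in> sos_cone d" and e: "e > 0"
  shows "\<exists>g\<in>good_forms d R. dist f g < e"
  using R f e
proof (induction R arbitrary: f e rule: finite_induct)
  case empty
  obtain a b where ab: "a \<in> binary_forms d" "b \<in> binary_forms d" "regular_form d (a * a + b * b)" "dist f (a * a + b * b) < e"
    by (rule regular_sum_of_two_squares_dense[OF d empty.prems(2,3)])
  have "a * a + b * b = (\<Sum>i<(2::nat). (if i = 0 then a else b) * (if i = 0 then a else b))"
    by (simp add: numeral_2_eq_2)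
  moreover have "\<forall>i<(2::nat). (if i = 0 then a else b) \<in> binary_forms d" using ab by simp
  ultimately have "a * a + b * b \<in> sos_cone d"
    unfolding sos_cone_def by (intro CollectI exI[of _ "2::nat"] exI[of _ "\<lambda>i. if i = 0 then a else b"] conjI)
  then show ?case using ab by (auto simp: good_forms_def)
next
  case (insert r R)
  obtain f1 where f1: "f1 \<in> good_forms d R" "dist f f1 < e / 4"
    using insert.IH[of f "e / 4"] insert.prems by auto
  have "f1 \<in> sos_cone d" using f1(1) by (simp add: good_forms_def)
  obtain \<delta> where \<delta>: "\<delta> > 0" "\<And>g. g \<in> sos_cone d \<Longrightarrow> dist g f1 < \<delta> \<Longrightarrow> g \<in> good_forms d R"
    using good_forms_open[OF d insert.hyps(1) f1(1)] by blast
  define \<epsilon> where "\<epsilon> = min (e / 4) (\<delta> / 2)"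
  have \<epsilon>: "\<epsilon> > 0" using \<delta>(1) insert.prems(3) by (simp add: \<epsilon>_def)
  obtain a b where ab: "a \<in> binary_forms d" "b \<in> binary_forms d" "dist f1 (a * a + b * b) < \<epsilon>"
    by (rule regular_sum_of_two_squares_dense[OF d \<open>f1 \<in> sos_cone d\<close> \<epsilon>])
  have r: "2 \<le> r" "(r + 1) choose 2 \<le> 2 * d + 1" using insert.prems(1) by auto
  obtain g where g: "g \<in> sos_cone d" "dist (a * a + b * b) g < \<epsilon>" "extreme_points_of_rank d r g \<noteq> {}"
    by (rule extreme_points_dense[OF r ab(1,2) \<epsilon>])
  have f1g: "dist f1 g < 2 * \<epsilon>" using dist_triangle[of f1 g "a * a + b * b"] ab(3) g(2) by linarith
  then have "dist g f1 < \<delta>" by (simp add: \<epsilon>_def dist_commute)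
  then have "g \<in> good_forms d (insert r R)" using \<delta>(2)[OF g(1)] g(3) by (simp add: good_forms_def)
  moreover have "dist f g < e" using dist_triangle[of f g f1] f1g f1(2) insert.prems(3) by (simp add: \<epsilon>_def)
  ultimately show ?case by blast
qed

theorem corollary5p4:
  fixes d :: nat
  assumes "d \<ge> 1"
  shows "\<exists>U. openin (top_of_set (sos_cone d)) U \<and> sos_cone d \<subseteq> closure U \<and>
    (\<forall>f\<in>U. \<forall>r::nat. 2 \<le> r \<and> (r + 1) choose 2 \<le> 2 * d + 1 \<longrightarrow>
       semialg_dim (sym_tensors d) (extreme_points_of_rank d r f) =
         ereal (1 / 2 * (real r - 2) * (2 * real d - real r + 1)))"
proof -
  define R where "R = {r. 2 \<le> r \<and> (r + 1) choose 2 \<le> 2 * d + 1}"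
  have "R \<subseteq> {..2 * d + 1}"
  proof
    fix r assume r: "r \<in> R"
    have "r \<le> (r + 1) choose 2" by (simp add: numeral_2_eq_2)
    then show "r \<in> {..2 * d + 1}" using r by (simp add: R_def)
  qed
  then have R: "finite R" using finite_subset by blast
  show ?thesis
  proof (intro exI[of _ "good_forms d R"] conjI ballI allI impI)
    show "openin (top_of_set (sos_cone d)) (good_forms d R)"
      unfolding openin_euclidean_subtopology_iff
    proof (intro conjI ballI)
      show "good_forms d R \<subseteq> sos_cone d" by (auto simp: good_forms_def)
      show "\<exists>e>0. \<forall>g\<in>sos_cone d. dist g f < e \<longrightarrow> g \<in> good_forms d R" if f: "f \<in> good_forms d R" for f
        using good_forms_open[OF assms R f] by metis
    qed
    show "sos_cone d \<subseteq> closure (good_forms d R)"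
      using good_forms_dense[OF assms R] by (auto simp: closure_approachable R_def dist_commute)
    show "semialg_dim (sym_tensors d) (extreme_points_of_rank d r f) =
        ereal (1 / 2 * (real r - 2) * (2 * real d - real r + 1))"
      if "f \<in> good_forms d R" "2 \<le> r \<and> (r + 1) choose 2 \<le> 2 * d + 1" for f r
      using that by (intro dimension_of_extreme_points assms) (auto simp: good_forms_def R_def dest: sos_cone_binary_form)
  qed
qed

end
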